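(* Let $(M,g)$ be a non-reductive (not locally symmetric) homogeneous pseudo-Riemannian four-manifold of type $\mathbf{A2}$ with parameter $\kappa\in\mathbb R$ and with invariant metric $$g=a(-2\theta^1\circ\theta^3+\theta^2\circ\theta^2)+b\,\theta^3\circ\theta^3+2c\,\theta^3\circ\theta^4+d\,\theta^4\circ\theta^4,\qquad ad\neq0,$$ where $\{\theta^i\}$ is dual to the basis $\{u_1,u_2,u_3,u_4\}$ of $\mathfrak m$ given in the context. Let $F:\Sigma\to M$ be a hypersurface and $\alpha,\beta,\gamma,\delta:M\to\mathbb R$ functions such that the vector field $\xi=\alpha u_1+\beta u_2+\gamma u_3+\delta u_4$ is normal to $\Sigma$ and satisfies $\langle\xi,\xi\rangle=\varepsilon=\pm1$. (The conditions below are expressed in the normalization $a=b=1$, $c=0$, to which the metric is reduced without loss of generality as explained in the context.) Then $\Sigma$ is parallel if and only if one of the following sets of conditions holds. (1) $\beta=\gamma=0$, $d\delta^2=\varepsilon$ and $$V_1(\alpha)=V_2(\alpha)=0,\qquad V_3(\varphi)=2(\kappa+1)\alpha\varphi,$$ where $V_1=u_1$, $V_2=u_2$, $V_3=d\delta u_3+\alpha u_4$ and $\varphi=\alpha^2-\varepsilon-V_3(\alpha)$. In particular, $\Sigma$ is totally geodesic if and only if $V_1(\alpha)=V_2(\alpha)=0$ and $\kappa=\varphi=0$. (2) $\gamma=\delta=0$, $\beta^2=\varepsilon=1$ and either $$V_1(\alpha)=V_3(\alpha)-\alpha=0,\qquad V_2(\alpha)=0,$$ or $$\kappa=0\quad\text{and}\quad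 V_1(\alpha)=V_3(\alpha)-\alpha=0,\quad V_2(V_2(\alpha))=0,\quad V_2(\alpha)\neq0,$$ where $V_1=u_1$, $V_2=\alpha u_2+\beta u_3$, $V_3=u_4$. In the former case, $\Sigma$ is always totally geodesic; in the latter case, it is never totally geodesic. (3) $\kappa=2$, $\gamma=0$, $\beta\neq0$, $\delta\neq0$, $\beta^2+d\delta^2=\varepsilon$ and $$V_1(\beta)=V_2(\beta)=V_3(\beta)=0,\quad V_1(\alpha)=0,\quad V_2(\alpha)+\alpha\beta=0,\quad V_3(\alpha)+\beta\delta=0,$$ where $V_1=u_1$, $V_2=d\delta u_2-\beta u_4$, $V_3=\alpha u_2+\beta u_3$. These hypersurfaces are never totally geodesic.
   Context: Type $\mathbf{A2}$: $M=G/H$, where the Lie algebra $\mathfrak g$ of $G$ has a basis $e_1,\dots,e_5$ with non-zero brackets $[e_1,e_5]=(\kappa+1)e_1$, $[e_2,e_4]=e_1$, $[e_2,e_5]=\kappa e_2$, $[e_3,e_4]=e_2$, $[e_3,e_5]=(\kappa-1)e_3$, $[e_4,e_5]=e_4$, and the isotropy algebra is $\mathfrak h=\mathrm{span}\{e_4\}$. The complement $\mathfrak m=\mathrm{span}\{u_1=e_1,u_2=e_2,u_3=e_3,u_4=e_5\}$ is a subalgebra, with non-zero brackets $[u_1,u_4]=(\kappa+1)u_1$, $[u_2,u_4]=\kappa u_2$, $[u_3,u_4]=(\kappa-1)u_3$. The symbol $\circ$ denotes the symmetric product $\theta^i\circ\theta^j=\frac12(\theta^i\otimes\theta^j+\theta^j\otimes\theta^i)$;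 $a,b,c,d$ are real constants. The metric is locally symmetric if and only if $b=0$, and $b\neq0$ is assumed. Normalization: $M$ is locally isometric to a Lie group $M_0$ with Lie algebra $\mathfrak m$ and a left-invariant metric, and all computations are done on $M_0$, the $u_i$ being regarded as left-invariant vector fields. The metric with parameters $a,b,c,d$ is pulled back by the Lie algebra automorphism of $\mathfrak m$ given by $u_1\mapsto\frac{\sqrt b}{a}u_1$, $u_2\mapsto\frac1{\sqrt a}u_2$, $u_3\mapsto\frac1{\sqrt b}u_3$, $u_4\mapsto u_4+\frac ca u_1$, which turns it into $-2\theta^1\circ\theta^3+\theta^2\circ\theta^2+\theta^3\circ\theta^3+d\,\theta^4\circ\theta^4$, and on this basis one restricts without loss of generality to $a=b=1$, $c=0$. The components of $\xi$ and the $V_i$ are those for the metric so normalized. In each case $V_1,V_2,V_3$ span the orthogonal complement of $\xi$, and $V_i(f)$ denotes the derivative of $f$ in the direction $V_i$. A hypersurface is an isometric immersion $F:\Sigma^3\to M^4$ of pseudo-Riemannian manifolds with unit normal $\xi$, $\langle\xi,\xi\rangle=\varepsilon=\pm1$. Its second fundamental form $h$ is defined by $\nabla_XY=\nabla^\Sigma_XY+h(X,Y)\xi$, where $\nabla,\nabla^\Sigma$ are the Levi-Civita connections of $M$ and $\Sigma$. It is totally geodesic if $h=0$ and parallel if $\nabla^\Sigma h=0$.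
   Formalization: The formal theorem assumes a>0 and b>0, since the normalization to a=b=1, c=0 uses √a and √b and does not exist over the reals for other signs (the printed conditions fail there); Σ is assumed connected, as otherwise components could satisfy different sets of conditions. *)

theory Defs
  imports "HOL-Analysis.Analysis"
begin

section \<open>Smooth maps and smooth manifolds\<close>

text \<open>Only meant for open \<open>S\<close>: derivatives are taken in the ambient normed space.\<close>

primrec Ck_on :: "nat \<Rightarrow> 'a set \<Rightarrow> ('a::real_normed_vector \<Rightarrow> 'b::real_normed_vector) \<Rightarrow> bool" where
  "Ck_on 0 S f \<longleftrightarrow> continuous_on S f"
| "Ck_on (Suc k) S f \<longleftrightarrow>
     (\<forall>x\<in>S. f differentiable (at x)) \<and> (\<forall>v. Ck_on k S (\<lambda>x. frechet_derivative f (at x) v))"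

definition smooth_on :: "'a set \<Rightarrow> ('a::real_normed_vector \<Rightarrow> 'b::real_normed_vector) \<Rightarrow> bool" where
  "smooth_on S f \<longleftrightarrow> (\<forall>k. Ck_on k S f)"

text \<open>A smooth atlas on the whole type \<open>'m\<close>; a chart \<open>(U, \<phi>)\<close> maps the open set \<open>U\<close>
  homeomorphically onto the open set \<open>\<phi> ` U\<close> of Euclidean space. \<open>local_param\<close> is the inverse
  of a chart, with domain \<open>\<phi> ` U\<close>.\<close>

type_synonym ('m, 'n) chart = "'m set \<times> ('m \<Rightarrow> real ^ 'n)"

definition chart_dom :: "('m, 'n) chart \<Rightarrow> (real ^ 'n) set" where
  "chart_dom C = snd C ` fst C"

definition local_param :: "('m, 'n) chart \<Rightarrow> real ^ 'n \<Rightarrow> 'm" where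
  "local_param C = inv_into (fst C) (snd C)"

definition smooth_atlas :: "('m::topological_space, 'n::finite) chart set \<Rightarrow> bool" where
  "smooth_atlas A \<longleftrightarrow>
     (\<Union>C\<in>A. fst C) = UNIV \<and>
     (\<forall>C\<in>A. open (fst C) \<and> open (chart_dom C) \<and>
            homeomorphism (fst C) (chart_dom C) (snd C) (local_param C)) \<and>
     (\<forall>C\<in>A. \<forall>C'\<in>A. smooth_on (snd C ` (fst C \<inter> fst C')) (snd C' \<circ> local_param C))"

definition smooth_immersion ::
  "('m::topological_space, 'n::finite) chart set \<Rightarrow> ('m \<Rightarrow> real ^ 'k::finite) \<Rightarrow> bool" where
  "smooth_immersion A F \<longleftrightarrow>
     (\<forall>C\<in>A. smooth_on (chart_dom C) (F \<circ> local_param C) \<and>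
            (\<forall>x\<in>chart_dom C. inj (frechet_derivative (F \<circ> local_param C) (at x))))"

section \<open>Pseudo-Riemannian metrics in coordinates\<close>

text \<open>A metric on (an open subset of) Euclidean space assigns to each point a bilinear form.\<close>

type_synonym 'n metric = "real ^ 'n \<Rightarrow> real ^ 'n \<Rightarrow> real ^ 'n \<Rightarrow> real"

definition gram :: "('n::finite) metric \<Rightarrow> real ^ 'n \<Rightarrow> real ^ 'n ^ 'n" where
  "gram g x = (\<chi> i j. g x (axis i 1) (axis j 1))"

definition partial :: "'n::finite \<Rightarrow> (real ^ 'n \<Rightarrow> real) \<Rightarrow> real ^ 'n \<Rightarrow> real" where
  "partial i f x = frechet_derivative f (at x) (axis i 1)"

text \<open>Christoffel symbols (upper index first) of the Levi-Civita connection.\<close>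

definition christoffel :: "('n::finite) metric \<Rightarrow> 'n \<Rightarrow> 'n \<Rightarrow> 'n \<Rightarrow> real ^ 'n \<Rightarrow> real" where
  "christoffel g k i j x =
     (1/2) * (\<Sum>l\<in>UNIV. matrix_inv (gram g x) $ k $ l *
        (partial i (\<lambda>y. gram g y $ j $ l) x + partial j (\<lambda>y. gram g y $ i $ l) x
         - partial l (\<lambda>y. gram g y $ i $ j) x))"

text \<open>The value at \<open>x\<close> of \<open>\<nabla>\<^sub>v w\<close> when \<open>w\<close> is extended as a constant coordinate field.\<close>

definition christoffel_map :: "('n::finite) metric \<Rightarrow> real ^ 'n \<Rightarrow> real ^ 'n \<Rightarrow> real ^ 'n \<Rightarrow> real ^ 'n" where
  "christoffel_map g x v w = (\<chi> k. \<Sum>i\<in>UNIV. \<Sum>j\<in>UNIV. christoffel g k i j x * v $ i * w $ j)"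

text \<open>Levi-Civita derivative, in direction \<open>v\<close> at \<open>x\<close>, of a vector field \<open>Y\<close> along \<open>f\<close>.\<close>

definition cov_deriv_along ::
  "('k::finite) metric \<Rightarrow> (real ^ 'n::finite \<Rightarrow> real ^ 'k) \<Rightarrow> (real ^ 'n \<Rightarrow> real ^ 'k) \<Rightarrow>
   real ^ 'n \<Rightarrow> real ^ 'n \<Rightarrow> real ^ 'k" where
  "cov_deriv_along g f Y x v =
     frechet_derivative Y (at x) v + christoffel_map g (f x) (frechet_derivative f (at x) v) (Y x)"

section \<open>Hypersurfaces\<close>

definition pullback_metric ::
  "('k::finite) metric \<Rightarrow> (real ^ 'n::finite \<Rightarrow> real ^ 'k) \<Rightarrow> 'n metric" where
  "pullback_metric g f x v w =
     g (f x) (frechet_derivative f (at x) v) (frechet_derivative f (at x) w)"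

text \<open>The Gauss formula \<open>\<nabla>\<^sub>X Y = \<nabla>\<^sup>\<Sigma>\<^sub>X Y + h(X,Y) \<xi>\<close> in a local parametrization \<open>f\<close>, for constant
  coordinate fields \<open>X = v\<close>, \<open>Y = w\<close>; as \<open>h\<close> is a tensor these determine it. Here
  \<open>\<nabla>\<^sup>\<Sigma>\<close> is the Levi-Civita connection of the induced metric.\<close>

definition second_fundamental_form ::
  "('k::finite) metric \<Rightarrow> (real ^ 'k \<Rightarrow> real ^ 'k) \<Rightarrow> (real ^ 'n::finite \<Rightarrow> real ^ 'k) \<Rightarrow>
   real ^ 'n \<Rightarrow> real ^ 'n \<Rightarrow> real ^ 'n \<Rightarrow> real" where
  "second_fundamental_form g \<xi> f x v w =
     (THE r. cov_deriv_along g f (\<lambda>y. frechet_derivative f (at y) w) x v =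
             frechet_derivative f (at x) (christoffel_map (pullback_metric g f) x v w) + r *\<^sub>R \<xi> (f x))"

text \<open>\<open>(\<nabla>\<^sub>u h)(v, w)\<close> for a covariant 2-tensor \<open>h\<close>, with \<open>v\<close>, \<open>w\<close> extended as constant
  coordinate fields.\<close>

definition cov_deriv_form ::
  "('n::finite) metric \<Rightarrow> (real ^ 'n \<Rightarrow> real ^ 'n \<Rightarrow> real ^ 'n \<Rightarrow> real) \<Rightarrow>
   real ^ 'n \<Rightarrow> real ^ 'n \<Rightarrow> real ^ 'n \<Rightarrow> real ^ 'n \<Rightarrow> real" where
  "cov_deriv_form g h x u v w =
     frechet_derivative (\<lambda>y. h y v w) (at x) u
     - h x (christoffel_map g x u v) w - h x v (christoffel_map g x u w)"

definition normal_along ::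
  "('k::finite) metric \<Rightarrow> ('m::topological_space, 'n::finite) chart set \<Rightarrow> ('m \<Rightarrow> real ^ 'k) \<Rightarrow>
   (real ^ 'k \<Rightarrow> real ^ 'k) \<Rightarrow> bool" where
  "normal_along g A F \<xi> \<longleftrightarrow>
     (\<forall>C\<in>A. \<forall>x\<in>chart_dom C. \<forall>v. let f = F \<circ> local_param C in
        g (f x) (\<xi> (f x)) (frechet_derivative f (at x) v) = 0)"

definition totally_geodesic ::
  "('k::finite) metric \<Rightarrow> ('m::topological_space, 'n::finite) chart set \<Rightarrow> ('m \<Rightarrow> real ^ 'k) \<Rightarrow>
   (real ^ 'k \<Rightarrow> real ^ 'k) \<Rightarrow> bool" where
  "totally_geodesic g A F \<xi> \<longleftrightarrow>
     (\<forall>C\<in>A. \<forall>x\<in>chart_dom C. \<forall>v w. second_fundamental_form g \<xi> (F \<circ> local_param C) x v w = 0)"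

definition parallel_hypersurface ::
  "('k::finite) metric \<Rightarrow> ('m::topological_space, 'n::finite) chart set \<Rightarrow> ('m \<Rightarrow> real ^ 'k) \<Rightarrow>
   (real ^ 'k \<Rightarrow> real ^ 'k) \<Rightarrow> bool" where
  "parallel_hypersurface g A F \<xi> \<longleftrightarrow>
     (\<forall>C\<in>A. \<forall>x\<in>chart_dom C. \<forall>u v w. let f = F \<circ> local_param C in
        cov_deriv_form (pullback_metric g f) (second_fundamental_form g \<xi> f) x u v w = 0)"

section \<open>Vector fields\<close>

definition dir_deriv :: "('a::real_normed_vector \<Rightarrow> 'a) \<Rightarrow> ('a \<Rightarrow> real) \<Rightarrow> 'a \<Rightarrow> real" where
  "dir_deriv V f p = frechet_derivative f (at p) (V p)"

definition lie_bracket ::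
  "('a::real_normed_vector \<Rightarrow> 'a) \<Rightarrow> ('a \<Rightarrow> 'a) \<Rightarrow> 'a \<Rightarrow> 'a" where
  "lie_bracket X Y p = frechet_derivative Y (at p) (X p) - frechet_derivative X (at p) (Y p)"

section \<open>The Lie group of type A2 and its left-invariant metrics\<close>

text \<open>The simply connected Lie group with Lie algebra spanned by \<open>u\<^sub>1, u\<^sub>2, u\<^sub>3, u\<^sub>4\<close> and non-zero
  brackets \<open>[u\<^sub>1,u\<^sub>4] = (\<kappa>+1) u\<^sub>1\<close>, \<open>[u\<^sub>2,u\<^sub>4] = \<kappa> u\<^sub>2\<close>, \<open>[u\<^sub>3,u\<^sub>4] = (\<kappa>-1) u\<^sub>3\<close>, realized on
  four-dimensional space as a semidirect product of the translations in the first three coordinates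
  with the line. The neutral element is \<open>0\<close>.\<close>

definition A2_weight :: "real \<Rightarrow> 4 \<Rightarrow> real" where
  "A2_weight \<kappa> i = (if i = 1 then \<kappa> + 1 else if i = 2 then \<kappa> else if i = 3 then \<kappa> - 1 else 0)"

definition A2_mult :: "real \<Rightarrow> real ^ 4 \<Rightarrow> real ^ 4 \<Rightarrow> real ^ 4" where
  "A2_mult \<kappa> x y = (\<chi> i. x $ i + exp (- A2_weight \<kappa> i * x $ 4) * y $ i)"

text \<open>The left-invariant field \<open>u\<^sub>i\<close> and the dual left-invariant one-form \<open>\<theta>\<^sup>i\<close>.\<close>

definition A2_frame :: "real \<Rightarrow> 4 \<Rightarrow> real ^ 4 \<Rightarrow> real ^ 4" where
  "A2_frame \<kappa> i p = frechet_derivative (A2_mult \<kappa> p) (at 0) (axis i 1)"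

definition A2_coframe :: "real \<Rightarrow> 4 \<Rightarrow> real ^ 4 \<Rightarrow> real ^ 4 \<Rightarrow> real" where
  "A2_coframe \<kappa> i p v = exp (A2_weight \<kappa> i * p $ 4) * v $ i"

definition sym_prod :: "('a \<Rightarrow> real) \<Rightarrow> ('a \<Rightarrow> real) \<Rightarrow> 'a \<Rightarrow> 'a \<Rightarrow> real" where
  "sym_prod \<eta> \<omega> v w = (1/2) * (\<eta> v * \<omega> w + \<omega> v * \<eta> w)"

definition A2_metric :: "real \<Rightarrow> real \<Rightarrow> real \<Rightarrow> real \<Rightarrow> real \<Rightarrow> 4 metric" where
  "A2_metric \<kappa> a b c d p v w =
    (let \<theta> = (\<lambda>i. A2_coframe \<kappa> i p) in
       a * (- 2 * sym_prod (\<theta> 1) (\<theta> 3) v w + sym_prod (\<theta> 2) (\<theta> 2) v w)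
       + b * sym_prod (\<theta> 3) (\<theta> 3) v w + 2 * c * sym_prod (\<theta> 3) (\<theta> 4) v w
       + d * sym_prod (\<theta> 4) (\<theta> 4) v w)"

text \<open>The images of \<open>u\<^sub>1, \<dots>, u\<^sub>4\<close> under the Lie algebra automorphism that normalizes the metric;
  for \<open>a = b = 1\<close>, \<open>c = 0\<close> this is the frame \<open>u\<^sub>i\<close> itself. Meaningful only for \<open>a, b > 0\<close>.\<close>

definition A2_normal_frame :: "real \<Rightarrow> real \<Rightarrow> real \<Rightarrow> real \<Rightarrow> 4 \<Rightarrow> real ^ 4 \<Rightarrow> real ^ 4" where
  "A2_normal_frame \<kappa> a b c i p =
     (if i = 1 then (sqrt b / a) *\<^sub>R A2_frame \<kappa> 1 p
      else if i = 2 then (1 / sqrt a) *\<^sub>R A2_frame \<kappa> 2 p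
      else if i = 3 then (1 / sqrt b) *\<^sub>R A2_frame \<kappa> 3 p
      else A2_frame \<kappa> 4 p + (c / a) *\<^sub>R A2_frame \<kappa> 1 p)"

subsection \<open>Consistency of the model\<close>

lemma A2_weight_simps [simp]:
  "A2_weight \<kappa> 1 = \<kappa> + 1" "A2_weight \<kappa> 2 = \<kappa>" "A2_weight \<kappa> 3 = \<kappa> - 1" "A2_weight \<kappa> 4 = 0"
  by (simp_all add: A2_weight_def)

lemma A2_mult_assoc: "A2_mult \<kappa> (A2_mult \<kappa> x y) z = A2_mult \<kappa> x (A2_mult \<kappa> y z)"
  by (simp add: A2_mult_def vec_eq_iff algebra_simps flip: exp_add)

lemma A2_mult_0 [simp]: "A2_mult \<kappa> 0 x = x" "A2_mult \<kappa> x 0 = x"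
  by (simp_all add: A2_mult_def vec_eq_iff)

lemma A2_mult_left_inverse:
  "A2_mult \<kappa> (\<chi> i. - exp (A2_weight \<kappa> i * x $ 4) * x $ i) x = 0"
  by (simp add: A2_mult_def vec_eq_iff)

lemma A2_mult_has_derivative:
  "(A2_mult \<kappa> p has_derivative (\<lambda>v. \<chi> i. exp (- A2_weight \<kappa> i * p $ 4) * v $ i)) (at q)"
proof -
  have "bounded_linear (\<lambda>v::real^4. \<chi> i. exp (- A2_weight \<kappa> i * p $ 4) * v $ i)"
    by (rule linear_conv_bounded_linear[THEN iffD1], rule linearI)
       (simp_all add: vec_eq_iff algebra_simps)
  then have "((\<lambda>y. p + (\<chi> i. exp (- A2_weight \<kappa> i * p $ 4) * y $ i)) has_derivative
      (\<lambda>v. \<chi> i. exp (- A2_weight \<kappa> i * p $ 4) * v $ i)) (at q)"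
    by (auto intro!: derivative_eq_intros bounded_linear_imp_has_derivative)
  moreover have "A2_mult \<kappa> p = (\<lambda>y. p + (\<chi> i. exp (- A2_weight \<kappa> i * p $ 4) * y $ i))"
    by (simp add: A2_mult_def fun_eq_iff vec_eq_iff)
  ultimately show ?thesis
    by simp
qed

lemma A2_frame_eq: "A2_frame \<kappa> i p = exp (- A2_weight \<kappa> i * p $ 4) *\<^sub>R axis i 1"
  unfolding A2_frame_def frechet_derivative_at[OF A2_mult_has_derivative, symmetric]
  by (simp add: vec_eq_iff axis_def)

lemma A2_frame_left_invariant:
  "frechet_derivative (A2_mult \<kappa> p) (at q) (A2_frame \<kappa> i q) = A2_frame \<kappa> i (A2_mult \<kappa> p q)"
  unfolding A2_frame_eq frechet_derivative_at[OF A2_mult_has_derivative, symmetric]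
  by (simp add: vec_eq_iff axis_def A2_mult_def algebra_simps flip: exp_add)

lemma A2_coframe_frame: "A2_coframe \<kappa> i p (A2_frame \<kappa> j p) = (if i = j then 1 else 0)"
  by (simp add: A2_coframe_def A2_frame_eq axis_def flip: exp_add)

lemma A2_frame_has_derivative:
  "(A2_frame \<kappa> i has_derivative (\<lambda>v. (- A2_weight \<kappa> i * v $ 4) *\<^sub>R A2_frame \<kappa> i p)) (at p)"
  unfolding A2_frame_eq
  by (auto intro!: derivative_eq_intros bounded_linear_imp_has_derivative[OF bounded_linear_vec_nth]
      simp: fun_eq_iff)

lemma lie_bracket_A2_frame:
  "lie_bracket (A2_frame \<kappa> i) (A2_frame \<kappa> j) p =
     (if j = 4 then A2_weight \<kappa> i *\<^sub>R A2_frame \<kappa> i p else 0)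
     - (if i = 4 then A2_weight \<kappa> j *\<^sub>R A2_frame \<kappa> j p else 0)"
  unfolding lie_bracket_def frechet_derivative_at[OF A2_frame_has_derivative, symmetric]
  by (auto simp: A2_frame_eq axis_def)

lemma A2_normal_frame_normalized: "A2_normal_frame \<kappa> 1 1 0 = A2_frame \<kappa>"
proof -
  have "\<forall>i. A2_normal_frame \<kappa> 1 1 0 i = A2_frame \<kappa> i"
    unfolding forall_4 by (simp add: A2_normal_frame_def fun_eq_iff)
  then show ?thesis by blast
qed

lemma A2_metric_normal_frame:
  assumes "a > 0" "b > 0"
  shows "A2_metric \<kappa> a b c d p (A2_normal_frame \<kappa> a b c i p) (A2_normal_frame \<kappa> a b c j p)
       = A2_metric \<kappa> 1 1 0 d p (A2_frame \<kappa> i p) (A2_frame \<kappa> j p)"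
proof -
  have add: "A2_coframe \<kappa> k p (v + w) = A2_coframe \<kappa> k p v + A2_coframe \<kappa> k p w"
    and scale: "A2_coframe \<kappa> k p (r *\<^sub>R v) = r * A2_coframe \<kappa> k p v" for k v w r
    by (simp_all add: A2_coframe_def algebra_simps)
  have "sqrt a * sqrt a = a" "sqrt b * sqrt b = b"
    using assms by simp_all
  then have "\<forall>i j. A2_metric \<kappa> a b c d p (A2_normal_frame \<kappa> a b c i p) (A2_normal_frame \<kappa> a b c j p)
       = A2_metric \<kappa> 1 1 0 d p (A2_frame \<kappa> i p) (A2_frame \<kappa> j p)"
    using assms unfolding forall_4
    by (simp add: A2_metric_def A2_normal_frame_def sym_prod_def add scale A2_coframe_frame field_simps)
  then show ?thesis by blast
qed

end

theory Submission
  imports Defs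
begin

text \<open>In the left-invariant frame \<open>u\<^sub>i\<close> the Levi-Civita connection has constant coefficients, so for an
  immersion everything is expressed by the frame components \<open>\<tau>\<close> of its differential and
  \<open>\<Xi> = (\<alpha>, \<beta>, \<gamma>, \<delta>)\<close> of the unit normal. If \<open>h\<close> is parallel, the Codazzi equation says that
  \<open>R(X,Y)\<xi> = 0\<close> for tangent \<open>X, Y\<close>. As \<open>R\<close> is a constant curvature tensor plus a term that is
  quadratic in the null form \<open>\<theta>\<^sup>3\<close>, this forces \<open>\<gamma> = 0\<close> and \<open>\<beta> \<delta> (\<kappa> - 2) = 0\<close>. Evaluating
  \<open>\<nabla>h\<close> on the null tangent vector \<open>u\<^sub>1\<close> shows that \<open>\<delta>\<close> is constant, hence so is \<open>\<beta>\<^sup>2\<close>, and the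
  three cases \<open>\<beta> = 0\<close>, \<open>\<delta> = 0\<close>, \<open>\<beta> \<delta> \<noteq> 0\<close> exclude each other globally. In each of them
  \<open>\<nabla>\<xi> = \<kappa> \<delta> Id + \<eta> \<otimes> u\<^sub>1\<close>, where \<open>\<eta>\<close> is a multiple of \<open>\<theta>\<^sup>3\<close> because \<open>h\<close> is symmetric; so
  \<open>\<nabla>h\<close> depends on a single function and its differential.\<close>

section \<open>Calculus\<close>

text \<open>The conditions prescribe derivatives in few directions, while
  \<open>\<nabla>h = 0\<close> has many components. In case (1), and in the second alternative of
  case (2), the differential of the one remaining function is known only along a field on which
  \<open>\<theta>\<^sup>3\<close> is nonzero. With \<beta> = 0 or \<delta> = 0, however, the
  curvature term of the Codazzi equation vanishes, so \<open>\<nabla>h\<close> is symmetric in all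
  arguments and that single direction determines the others. Codazzi thus serves both implications.
  In case (3) the conditions cover a whole tangent frame.

  The evaluation on \<open>u\<^sub>1\<close> carries a factor \<kappa> and is empty for \<kappa> =
  0. There \<beta> \<delta> = 0 leaves only two values for \<open>d \<delta>\<^sup>2\<close>, and
  this makes \<delta> locally constant.

  The split of case (2) into two alternatives must be global too. It rests on
  \<open>W\<^sub>2(\<alpha>) exp(- 2 x\<^sub>4)\<close> being constant, where
  \<open>x\<^sub>4\<close> is the last coordinate of the group.

  All fields \<open>V\<^sub>i\<close> are tangent, which is why derivatives of functions on the
  ambient set can be read in a chart of the hypersurface.\<close>

lemma second_difference_bound:
  fixes f :: "'a::real_normed_vector \<Rightarrow> real"
  assumes S: "open S" "x \<in> S" and f: "\<And>y. y \<in> S \<Longrightarrow> (f has_derivative f' y) (at y)"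
    and D: "((\<lambda>y. f' y u) has_derivative D) (at x)" and "e > 0"
  obtains r where "r > 0"
    "\<And>s. 0 < s \<Longrightarrow> s < r \<Longrightarrow>
      \<bar>f (x + s *\<^sub>R u + s *\<^sub>R v) - f (x + s *\<^sub>R u) - f (x + s *\<^sub>R v) + f x - s\<^sup>2 * D v\<bar>
        \<le> e * s\<^sup>2"
proof -
  \<comment> \<open>All points used lie within distance \<open>s * c\<close> of \<open>x\<close>;
    the summand 1 keeps \<open>c\<close> positive.\<close>
  define c where "c = norm u + norm v + 1"
  have c: "c > 0" by (simp add: c_def add_nonneg_pos)
  interpret D: bounded_linear D using D by (rule has_derivative_bounded_linear)
  obtain r1 where r1: "r1 > 0" "ball x r1 \<subseteq> S" using S by (metis openE)
  have ep: "e / (2 * c) > 0" using \<open>e > 0\<close> c by simp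
  obtain r2 where r2: "r2 > 0" "\<And>y. norm (y - x) < r2 \<Longrightarrow>
      norm (f' y u - f' x u - D (y - x)) \<le> e / (2 * c) * norm (y - x)"
    using D ep unfolding has_derivative_at_alt by blast
  define r where "r = min r1 r2 / c"
  show ?thesis
  proof
    show "r > 0" using r1 r2 c by (simp add: r_def)
    fix s :: real assume s: "0 < s" "s < r"
    have sc: "s * c < r1" "s * c < r2" using s c by (simp_all add: r_def field_simps)
    have near: "norm (t *\<^sub>R u + k *\<^sub>R v) \<le> s * c" if "0 \<le> t" "t \<le> s" "0 \<le> k" "k \<le> s" for t k
    proof -
      have "norm (t *\<^sub>R u + k *\<^sub>R v) \<le> t * norm u + k * norm v"
        using norm_triangle_ineq[of "t *\<^sub>R u" "k *\<^sub>R v"] that by simp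
      also have "\<dots> \<le> s * norm u + s * norm v" using that by (intro add_mono mult_right_mono) auto
      also have "\<dots> \<le> s * c" using s by (simp add: c_def algebra_simps)
      finally show ?thesis .
    qed
    have inS: "x + t *\<^sub>R u + k *\<^sub>R v \<in> S" if "0 \<le> t" "t \<le> s" "0 \<le> k" "k \<le> s" for t k
    proof -
      have "dist (x + t *\<^sub>R u + k *\<^sub>R v) x \<le> s * c"
        using near[OF that] by (simp add: dist_norm add.assoc)
      then show ?thesis using sc r1 by (auto simp: dist_commute)
    qed
    have dir: "((\<lambda>t. f (x + t *\<^sub>R u + k *\<^sub>R v)) has_derivative (\<lambda>h. h * f' (x + t *\<^sub>R u + k *\<^sub>R v) u)) (at t within T)"
      if "0 \<le> t" "t \<le> s" "0 \<le> k" "k \<le> s" for t k T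
    proof -
      have "((\<lambda>t. f (x + t *\<^sub>R u + k *\<^sub>R v)) has_derivative
          (\<lambda>h. f' (x + t *\<^sub>R u + k *\<^sub>R v) (h *\<^sub>R u))) (at t within T)"
        by (rule has_derivative_compose[where f = "\<lambda>t. x + t *\<^sub>R u + k *\<^sub>R v" and g = f])
           (auto intro!: derivative_eq_intros f inS that)
      moreover have "linear (f' (x + t *\<^sub>R u + k *\<^sub>R v))"
        using f[OF inS[OF that]] by (rule has_derivative_linear)
      ultimately show ?thesis by (simp add: linear_scale)
    qed
    \<comment> \<open>The mean value theorem along \<open>u\<close> turns the second difference into
      a difference of two values of \<open>\<lambda>y. f' y u\<close>. Each is compared with its
      linearization at \<open>x\<close>, with half of the allowed error.\<close>
    define p where "p = (\<lambda>t. f (x + t *\<^sub>R u + s *\<^sub>R v) - f (x + t *\<^sub>R u + 0 *\<^sub>R v))"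
    have "\<exists>t\<in>{0<..<s}. p s - p 0 =
        (s - 0) * f' (x + t *\<^sub>R u + s *\<^sub>R v) u - (s - 0) * f' (x + t *\<^sub>R u + 0 *\<^sub>R v) u"
      unfolding p_def using s
      by (intro mvt_simple[where f' = "\<lambda>t h. h * f' (x + t *\<^sub>R u + s *\<^sub>R v) u - h * f' (x + t *\<^sub>R u + 0 *\<^sub>R v) u"]
           has_derivative_diff dir) auto
    then obtain t where t: "0 < t" "t < s" and
      pt: "p s - p 0 = s * (f' (x + t *\<^sub>R u + s *\<^sub>R v) u - f' (x + t *\<^sub>R u) u)"
      by (auto simp: algebra_simps)
    define A where "A = f' (x + t *\<^sub>R u + s *\<^sub>R v) u - f' x u - D (t *\<^sub>R u + s *\<^sub>R v)"
    define B where "B = f' (x + t *\<^sub>R u) u - f' x u - D (t *\<^sub>R u)"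
    have bound: "e / (2 * c) * n \<le> s * e / 2" if "n \<le> s * c" for n
      using mult_left_mono[OF that, of "e / (2 * c)"] ep c by (simp add: field_simps)
    have "\<bar>A\<bar> \<le> s * e / 2"
      using order_trans[OF r2(2)[of "x + t *\<^sub>R u + s *\<^sub>R v"] bound] near[of t s] t s sc
      by (simp add: A_def add.assoc)
    moreover have "\<bar>B\<bar> \<le> s * e / 2"
      using order_trans[OF r2(2)[of "x + t *\<^sub>R u"] bound] near[of t 0] t s sc
      by (simp add: B_def add.assoc)
    ultimately have "\<bar>A - B\<bar> \<le> s * e" by linarith
    moreover have "p s - p 0 - s\<^sup>2 * D v = s * (A - B)"
      unfolding pt A_def B_def by (simp add: D.add D.scale power2_eq_square algebra_simps)
    ultimately have "\<bar>p s - p 0 - s\<^sup>2 * D v\<bar> \<le> e * s\<^sup>2"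
      using s mult_left_mono[of "\<bar>A - B\<bar>" "s * e" s] by (simp only: abs_mult) (simp add: power2_eq_square mult_ac)
    then show "\<bar>f (x + s *\<^sub>R u + s *\<^sub>R v) - f (x + s *\<^sub>R u) - f (x + s *\<^sub>R v) + f x - s\<^sup>2 * D v\<bar> \<le> e * s\<^sup>2"
      by (simp add: p_def algebra_simps)
  qed
qed

text \<open>The second difference is symmetric in \<open>u\<close> and \<open>v\<close>, yet divided
  by \<open>s\<^sup>2\<close> it tends to \<open>Du v\<close> or to \<open>Dv u\<close>, depending
  on which direction is differentiated first. A tolerance of a quarter of the gap gives the
  contradiction.\<close>

lemma second_derivative_symmetric_real:
  fixes f :: "'a::real_normed_vector \<Rightarrow> real"
  assumes S: "open S" "x \<in> S" and f: "\<And>y. y \<in> S \<Longrightarrow> (f has_derivative f' y) (at y)"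
    and Du: "((\<lambda>y. f' y u) has_derivative Du) (at x)"
    and Dv: "((\<lambda>y. f' y v) has_derivative Dv) (at x)"
  shows "Du v = Dv u"
proof (rule ccontr)
  assume ne: "Du v \<noteq> Dv u"
  define e where "e = \<bar>Du v - Dv u\<bar> / 4"
  have e: "e > 0" using ne by (simp add: e_def)
  obtain r where r: "r > 0" "\<And>s. 0 < s \<Longrightarrow> s < r \<Longrightarrow>
      \<bar>f (x + s *\<^sub>R u + s *\<^sub>R v) - f (x + s *\<^sub>R u) - f (x + s *\<^sub>R v) + f x - s\<^sup>2 * Du v\<bar> \<le> e * s\<^sup>2"
    using second_difference_bound[OF S f Du e] by metis
  obtain q where q: "q > 0" "\<And>s. 0 < s \<Longrightarrow> s < q \<Longrightarrow>
      \<bar>f (x + s *\<^sub>R v + s *\<^sub>R u) - f (x + s *\<^sub>R v) - f (x + s *\<^sub>R u) + f x - s\<^sup>2 * Dv u\<bar> \<le> e * s\<^sup>2"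
    using second_difference_bound[OF S f Dv e] by metis
  define s where "s = min r q / 2"
  have s: "0 < s" "s < r" "s < q" using r q by (auto simp: s_def min_def)
  have "\<bar>s\<^sup>2 * Du v - s\<^sup>2 * Dv u\<bar> \<le> 2 * (e * s\<^sup>2)"
    using r(2)[OF s(1,2)] q(2)[OF s(1,3)] by (simp add: add.commute add.left_commute)
  moreover have "\<bar>s\<^sup>2 * Du v - s\<^sup>2 * Dv u\<bar> = s\<^sup>2 * \<bar>Du v - Dv u\<bar>"
    by (simp add: abs_mult flip: right_diff_distrib)
  ultimately have "s\<^sup>2 * \<bar>Du v - Dv u\<bar> \<le> s\<^sup>2 * (2 * e)"
    by (simp add: mult_ac)
  then show False using s ne by (simp add: e_def)
qed

lemma second_derivative_symmetric:
  fixes f :: "'a::real_normed_vector \<Rightarrow> real ^ 'k::finite"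
  assumes S: "open S" "x \<in> S" and f: "\<And>y. y \<in> S \<Longrightarrow> (f has_derivative f' y) (at y)"
    and D: "\<And>v. ((\<lambda>y. f' y v) has_derivative (\<lambda>u. f'' u v)) (at x)"
  shows "f'' u v = f'' v u"
proof -
  have "f'' v u $ i = f'' u v $ i" for i
  proof (rule second_derivative_symmetric_real[OF S, where f = "\<lambda>z. f z $ i" and f' = "\<lambda>y v. f' y v $ i"
        and u = u and v = v and Du = "\<lambda>w. f'' w u $ i" and Dv = "\<lambda>w. f'' w v $ i"])
    show "((\<lambda>z. f z $ i) has_derivative (\<lambda>v. f' y v $ i)) (at y)" if "y \<in> S" for y
      by (rule bounded_linear.has_derivative[OF bounded_linear_vec_nth f[OF that]])
    show "((\<lambda>y. f' y u $ i) has_derivative (\<lambda>v. f'' v u $ i)) (at x)"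
      "((\<lambda>y. f' y v $ i) has_derivative (\<lambda>u. f'' u v $ i)) (at x)"
      by (intro bounded_linear.has_derivative[OF bounded_linear_vec_nth] D)+
  qed
  then show ?thesis by (simp add: vec_eq_iff)
qed

lemma vec_eq_sum_axis: "(v :: real ^ 'n::finite) = (\<Sum>i\<in>UNIV. v $ i *\<^sub>R axis i 1)"
  by (simp add: vec_eq_iff axis_def if_distrib[of "\<lambda>x. _ * x"] cong: if_cong)

text \<open>Koszul's uniqueness argument at a single point. It replaces every computation with an
  inverse Gram matrix: a candidate is written in frame components, and only symmetry and metric
  compatibility are checked.\<close>

lemma christoffel_map_unique:
  fixes g :: "('n::finite) metric"
  assumes bil: "bilinear (g x)" and sym: "\<And>v w. g x v w = g x w v"
    and nondeg: "\<And>v. (\<And>w. g x v w = 0) \<Longrightarrow> v = 0"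
    and diff: "\<And>v w. ((\<lambda>y. g y v w) has_derivative (\<lambda>u. g x (Z u v) w + g x v (Z u w))) (at x)"
    and Z: "bilinear Z" "\<And>v w. Z v w = Z w v"
  shows "christoffel_map g x v w = Z v w"
proof -
  let ?e = "\<lambda>i. axis i (1::real) :: real ^ 'n"
  have sum1: "g x v w = (\<Sum>m\<in>UNIV. v $ m * g x (?e m) w)" for v w
  proof -
    have lin: "linear (\<lambda>v. g x v w)" using bil by (simp add: bilinear_def)
    have "g x (\<Sum>m\<in>UNIV. v $ m *\<^sub>R ?e m) w = (\<Sum>m\<in>UNIV. v $ m * g x (?e m) w)"
      by (simp add: linear_sum[OF lin] linear_scale[OF lin])
    then show ?thesis by (simp only: vec_eq_sum_axis[of v, symmetric])
  qed
  have gram_apply: "g x (?e i) v = (gram g x *v v) $ i" for i v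
  proof -
    have "g x (?e i) v = (\<Sum>m\<in>UNIV. v $ m * g x (?e m) (?e i))"
      by (subst sym) (rule sum1)
    also have "\<dots> = (gram g x *v v) $ i"
      by (simp add: matrix_vector_mult_def gram_def sym[of "?e i"] mult.commute)
    finally show ?thesis .
  qed
  have "invertible (gram g x)"
    unfolding invertible_left_inverse matrix_left_invertible_ker
  proof (intro allI impI)
    fix v assume v: "gram g x *v v = 0"
    have "g x (?e i) v = 0" for i
    proof -
      have "g x (?e i) v = (gram g x *v v) $ i"
        by (rule gram_apply)
      then show ?thesis using v by simp
    qed
    then have "g x w v = 0" for w by (subst sum1) simp
    then have "g x v w = 0" for w by (metis sym)
    then show "v = 0" by (rule nondeg)
  qed
  then have inv: "matrix_inv (gram g x) ** gram g x = mat 1"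
    unfolding invertible_def matrix_inv_def by (rule someI2_ex) simp
  have part: "partial i (\<lambda>y. gram g y $ j $ k) x = g x (Z (?e i) (?e j)) (?e k) + g x (?e j) (Z (?e i) (?e k))"
    for i j k
    unfolding partial_def gram_def
    using frechet_derivative_at[OF diff[of "?e j" "?e k"], symmetric] by simp
  have chr: "christoffel g k i j x = Z (?e i) (?e j) $ k" for k i j
  proof -
    \<comment> \<open>Koszul's combination of three derivatives of the metric; the symmetry of
      \<open>Z\<close> cancels all terms but one product, which occurs twice.\<close>
    have "g x (Z (?e i) (?e j)) (?e l) + g x (?e j) (Z (?e i) (?e l))
        + (g x (Z (?e j) (?e i)) (?e l) + g x (?e i) (Z (?e j) (?e l)))
        - (g x (Z (?e l) (?e i)) (?e j) + g x (?e i) (Z (?e l) (?e j)))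
        = 2 * g x (?e l) (Z (?e i) (?e j))" for l
      using Z(2)[of "?e j" "?e i"] Z(2)[of "?e l" "?e i"] Z(2)[of "?e l" "?e j"]
        sym[of "?e j" "Z (?e i) (?e l)"] sym[of "?e l" "Z (?e i) (?e j)"]
      by simp
    then have "christoffel g k i j x =
        1/2 * (\<Sum>l\<in>UNIV. matrix_inv (gram g x) $ k $ l * (2 * g x (?e l) (Z (?e i) (?e j))))"
      unfolding christoffel_def part by (simp only:)
    also have "\<dots> = (\<Sum>l\<in>UNIV. matrix_inv (gram g x) $ k $ l * g x (?e l) (Z (?e i) (?e j)))"
      unfolding sum_distrib_left by (rule sum.cong) auto
    also have "\<dots> = (matrix_inv (gram g x) *v (gram g x *v Z (?e i) (?e j))) $ k"
    proof -
      show ?thesis by (simp add: gram_apply matrix_vector_mult_def[of "matrix_inv (gram g x)"])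
    qed
    also have "\<dots> = Z (?e i) (?e j) $ k"
      by (simp add: matrix_vector_mul_assoc inv)
    finally show ?thesis .
  qed
  have "Z (\<Sum>i\<in>UNIV. v $ i *\<^sub>R ?e i) (\<Sum>j\<in>UNIV. w $ j *\<^sub>R ?e j)
      = (\<Sum>(i,j)\<in>UNIV \<times> UNIV. Z (v $ i *\<^sub>R ?e i) (w $ j *\<^sub>R ?e j))"
    by (rule bilinear_sum[OF Z(1)])
  then have Zvw: "Z v w = (\<Sum>i\<in>UNIV. \<Sum>j\<in>UNIV. Z (v $ i *\<^sub>R ?e i) (w $ j *\<^sub>R ?e j))"
    by (simp only: vec_eq_sum_axis[of v, symmetric] vec_eq_sum_axis[of w, symmetric] sum.cartesian_product)
  have "(\<Sum>i\<in>UNIV. \<Sum>j\<in>UNIV. Z (v $ i *\<^sub>R ?e i) (w $ j *\<^sub>R ?e j)) = christoffel_map g x v w"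
    by (simp add: vec_eq_iff christoffel_map_def chr bilinear_lmul[OF Z(1)] bilinear_rmul[OF Z(1)] mult_ac)
  then show ?thesis using Zvw by simp
qed

section \<open>Smooth maps, and constancy over a connected manifold\<close>

lemma smooth_on_has_derivative:
  assumes "smooth_on S f" "x \<in> S"
  shows "(f has_derivative frechet_derivative f (at x)) (at x)"
proof -
  have "Ck_on (Suc 0) S f" using assms unfolding smooth_on_def by blast
  then show ?thesis using assms(2) by (simp flip: frechet_derivative_works)
qed

lemma smooth_on_frechet_derivative:
  assumes "smooth_on S f"
  shows "smooth_on S (\<lambda>x. frechet_derivative f (at x) v)"
  unfolding smooth_on_def
proof
  fix k
  have "Ck_on (Suc k) S f" using assms unfolding smooth_on_def by blast
  then show "Ck_on k S (\<lambda>x. frechet_derivative f (at x) v)" by simp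
qed

text \<open>A chart domain may be disconnected, so constancy is first shown on preimages of balls
  and then spread by connectedness of the whole manifold.\<close>

lemma constant_on_connected_manifold:
  fixes A :: "('m::{t2_space, second_countable_topology}, 'n::finite) chart set"
    and k :: "'m \<Rightarrow> 'b::real_normed_vector"
  assumes A: "smooth_atlas A" and "connected (UNIV :: 'm set)"
    and D: "\<And>C x. C \<in> A \<Longrightarrow> x \<in> chart_dom C \<Longrightarrow> ((k \<circ> local_param C) has_derivative (\<lambda>_. 0)) (at x)"
  shows "k p = k q"
proof -
  have loc: "\<exists>T. open T \<and> p \<in> T \<and> (\<forall>x\<in>T. k x = k p)" for p :: 'm
  proof -
    have "p \<in> (\<Union>C\<in>A. fst C)" using A by (simp add: smooth_atlas_def)
    then obtain C where C: "C \<in> A" "p \<in> fst C" by blast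
    have op: "open (fst C)" "open (chart_dom C)"
      and hom: "homeomorphism (fst C) (chart_dom C) (snd C) (local_param C)"
      using A C by (auto simp: smooth_atlas_def)
    have "snd C p \<in> chart_dom C" using C by (auto simp: chart_dom_def)
    then obtain r where r: "r > 0" "ball (snd C p) r \<subseteq> chart_dom C" using op(2) by (metis openE)
    define T where "T = {q \<in> fst C. snd C q \<in> ball (snd C p) r}"
    have "open T"
    proof -
      have "open (fst C \<inter> snd C -` ball (snd C p) r)"
        by (rule continuous_open_preimage[OF homeomorphism_cont1[OF hom] op(1) open_ball])
      moreover have "fst C \<inter> snd C -` ball (snd C p) r = T" unfolding T_def by blast
      ultimately show ?thesis by (simp only:)
    qed
    moreover have "k q = k p" if "q \<in> T" for q
    proof -
      have "(k \<circ> local_param C) (snd C q) = (k \<circ> local_param C) (snd C p)"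
      proof (rule has_derivative_zero_unique[of "ball (snd C p) r" "k \<circ> local_param C"])
        show "((k \<circ> local_param C) has_derivative (\<lambda>_. 0)) (at y within ball (snd C p) r)"
          if "y \<in> ball (snd C p) r" for y
          by (rule has_derivative_at_withinI, rule D[OF C(1)], rule subsetD[OF r(2) that])
        show "snd C q \<in> ball (snd C p) r" using that unfolding T_def by blast
        show "snd C p \<in> ball (snd C p) r" using r(1) by simp
      qed (rule convex_ball)
      moreover have "local_param C (snd C q) = q" "local_param C (snd C p) = p"
        using that C(2) homeomorphism_apply1[OF hom] by (auto simp: T_def)
      ultimately show ?thesis by simp
    qed
    moreover have "p \<in> T" using C(2) r(1) by (simp add: T_def)
    ultimately show ?thesis by blast
  qed
  have "k constant_on UNIV"
    by (rule locally_constant_imp_constant[OF assms(2)]) (simp add: loc)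
  then show ?thesis by (auto simp: constant_on_def)
qed

section \<open>Hypersurfaces in a moving frame\<close>

lemma has_derivative_eq_on_open:
  assumes "(f has_derivative f') (at x)" "(g has_derivative g') (at x)"
    and "open U" "x \<in> U" "\<And>y. y \<in> U \<Longrightarrow> f y = g y"
  shows "f' v = g' v"
  using has_derivative_unique[OF assms(1) has_derivative_transform_within_open[OF assms(2-4)]] assms(5)
  by metis

section \<open>Metric, connection and curvature on left-invariant fields\<close>

definition vec4 :: "real \<Rightarrow> real \<Rightarrow> real \<Rightarrow> real \<Rightarrow> real ^ 4" where
  "vec4 p q r s = (\<chi> i. if i = 1 then p else if i = 2 then q else if i = 3 then r else s)"

lemma vec4_nth [simp]:
  "vec4 p q r s $ 1 = p" "vec4 p q r s $ 2 = q" "vec4 p q r s $ 3 = r" "vec4 p q r s $ 4 = s"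
  by (simp_all add: vec4_def)

lemma vec4_eq_iff: "X = Y \<longleftrightarrow> X $ 1 = Y $ 1 \<and> X $ 2 = Y $ 2 \<and> X $ 3 = Y $ 3 \<and> X $ 4 = Y $ 4"
  for X Y :: "real ^ 4"
  by (simp add: vec_eq_iff forall_4)

text \<open>The normalized metric, the coefficients of its Levi-Civita connection and the Lie bracket, on
  the components of left-invariant vector fields in the frame \<open>u\<^sub>i\<close>.\<close>

definition frame_form :: "real \<Rightarrow> real ^ 4 \<Rightarrow> real ^ 4 \<Rightarrow> real" where
  "frame_form d X Y = X $ 2 * Y $ 2 + X $ 3 * Y $ 3 - X $ 1 * Y $ 3 - X $ 3 * Y $ 1 + d * X $ 4 * Y $ 4"

definition frame_conn :: "real \<Rightarrow> real \<Rightarrow> real ^ 4 \<Rightarrow> real ^ 4 \<Rightarrow> real ^ 4" where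
  "frame_conn \<kappa> d X Y = vec4
     (Y $ 4 * (\<kappa> * X $ 1 + X $ 3) + X $ 4 * (Y $ 3 - Y $ 1))
     (\<kappa> * X $ 2 * Y $ 4)
     (\<kappa> * X $ 3 * Y $ 4 + X $ 4 * Y $ 3)
     ((X $ 3 * Y $ 3 - \<kappa> * (X $ 2 * Y $ 2 + X $ 3 * Y $ 3 - X $ 1 * Y $ 3 - X $ 3 * Y $ 1)) / d)"

definition frame_bracket :: "real \<Rightarrow> real ^ 4 \<Rightarrow> real ^ 4 \<Rightarrow> real ^ 4" where
  "frame_bracket \<kappa> X Y = (\<chi> i. A2_weight \<kappa> i * (X $ i * Y $ 4 - X $ 4 * Y $ i))"

definition frame_curvature :: "real \<Rightarrow> real \<Rightarrow> real ^ 4 \<Rightarrow> real ^ 4 \<Rightarrow> real ^ 4 \<Rightarrow> real ^ 4" where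
  "frame_curvature \<kappa> d X Y Z = frame_conn \<kappa> d X (frame_conn \<kappa> d Y Z)
     - frame_conn \<kappa> d Y (frame_conn \<kappa> d X Z) - frame_conn \<kappa> d (frame_bracket \<kappa> X Y) Z"

lemma bilinear_frame_form: "bilinear (frame_form d)"
  unfolding bilinear_def linear_iff frame_form_def by (simp add: algebra_simps)

lemma bilinear_frame_conn: "bilinear (frame_conn \<kappa> d)"
  unfolding bilinear_def linear_iff frame_conn_def vec4_eq_iff
  by (simp add: algebra_simps add_divide_distrib diff_divide_distrib)

interpretation frame_form: bounded_bilinear "frame_form d" for d
  using bilinear_frame_form by (simp add: bilinear_conv_bounded_bilinear)

interpretation frame_conn: bounded_bilinear "frame_conn \<kappa> d" for \<kappa> d
  using bilinear_frame_conn by (simp add: bilinear_conv_bounded_bilinear)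

lemma frame_form_commute: "frame_form d X Y = frame_form d Y X"
  by (simp add: frame_form_def)

lemma frame_form_nondegenerate:
  assumes "d \<noteq> 0" "\<And>Y. frame_form d X Y = 0"
  shows "X = 0"
proof -
  have "frame_form d X (axis i 1) = 0" for i by (rule assms)
  from this[of 1] this[of 2] this[of 3] this[of 4] show ?thesis
    using assms(1) by (simp add: vec4_eq_iff frame_form_def axis_def)
qed

text \<open>Products of left-invariant fields are constant, so metric compatibility has no
  derivative term. Together with \<open>frame_conn_torsion\<close> this identifies
  \<open>frame_conn\<close> as the Levi-Civita connection.\<close>

lemma frame_conn_metric:
  assumes "d \<noteq> 0"
  shows "frame_form d (frame_conn \<kappa> d X Y) Z + frame_form d Y (frame_conn \<kappa> d X Z) = 0"
  using assms by (simp add: frame_form_def frame_conn_def field_simps)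

lemma frame_conn_torsion: "frame_conn \<kappa> d X Y - frame_conn \<kappa> d Y X = frame_bracket \<kappa> X Y"
  by (simp add: frame_conn_def frame_bracket_def vec4_eq_iff algebra_simps)

text \<open>The curvature differs from constant curvature \<open>- \<kappa>\<^sup>2 / d\<close> by a tensor that is quadratic in the
  null form \<open>\<theta>\<^sup>3\<close>; the constant curvature part vanishes on vectors orthogonal to \<open>Z\<close>.\<close>

lemma frame_form_curvature:
  assumes d: "d \<noteq> 0" and "frame_form d X Z = 0" "frame_form d Y Z = 0"
  shows "frame_form d (frame_curvature \<kappa> d X Y Z) W =
    \<kappa> / d * (X $ 2 * Y $ 3 - X $ 3 * Y $ 2) * (Z $ 3 * W $ 2 - Z $ 2 * W $ 3)
    + (2 * \<kappa> - 2) * (X $ 3 * Y $ 4 - X $ 4 * Y $ 3) * (Z $ 4 * W $ 3 - Z $ 3 * W $ 4)"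
proof -
  have "frame_form d (frame_curvature \<kappa> d X Y Z) W =
    - \<kappa>\<^sup>2 / d * (frame_form d Y Z * frame_form d X W - frame_form d X Z * frame_form d Y W)
    + \<kappa> / d * (X $ 2 * Y $ 3 - X $ 3 * Y $ 2) * (Z $ 3 * W $ 2 - Z $ 2 * W $ 3)
    + (2 * \<kappa> - 2) * (X $ 3 * Y $ 4 - X $ 4 * Y $ 3) * (Z $ 4 * W $ 3 - Z $ 3 * W $ 4)"
    unfolding frame_form_def frame_curvature_def frame_conn_def frame_bracket_def
    using d by (simp add: field_simps power2_eq_square)
  then show ?thesis using assms by simp
qed

text \<open>\<open>\<tau> x v\<close> are the frame components of the image of \<open>v\<close> under the differential of an immersion
  at \<open>x\<close>, and \<open>\<Xi> x\<close> those of the unit normal; \<open>\<tau>' x u v\<close>, \<open>\<Xi>' x u\<close>, \<open>\<Xi>'' x u v\<close> are their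
  derivatives in direction \<open>u\<close>. That \<open>\<tau>\<close> comes from an immersion enters only through the structure
  equation \<open>torsion\<close>.\<close>

locale frame_hypersurface =
  fixes \<kappa> d \<epsilon> :: real and U :: "(real ^ 3) set"
    and \<tau> :: "real ^ 3 \<Rightarrow> real ^ 3 \<Rightarrow> real ^ 4" and \<tau>' :: "real ^ 3 \<Rightarrow> real ^ 3 \<Rightarrow> real ^ 3 \<Rightarrow> real ^ 4"
    and \<Xi> :: "real ^ 3 \<Rightarrow> real ^ 4" and \<Xi>' :: "real ^ 3 \<Rightarrow> real ^ 3 \<Rightarrow> real ^ 4"
    and \<Xi>'' :: "real ^ 3 \<Rightarrow> real ^ 3 \<Rightarrow> real ^ 3 \<Rightarrow> real ^ 4"
  assumes open_U: "open U" and d: "d \<noteq> 0" and eps: "\<epsilon> = 1 \<or> \<epsilon> = - 1"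
    and linear_tau: "x \<in> U \<Longrightarrow> linear (\<tau> x)" and inj_tau: "x \<in> U \<Longrightarrow> inj (\<tau> x)"
    and deriv_tau: "x \<in> U \<Longrightarrow> ((\<lambda>y. \<tau> y v) has_derivative (\<lambda>u. \<tau>' x u v)) (at x)"
    and torsion: "x \<in> U \<Longrightarrow> \<tau>' x u v - \<tau>' x v u = - frame_bracket \<kappa> (\<tau> x u) (\<tau> x v)"
    and deriv_Xi: "x \<in> U \<Longrightarrow> (\<Xi> has_derivative \<Xi>' x) (at x)"
    and deriv_Xi': "x \<in> U \<Longrightarrow> ((\<lambda>y. \<Xi>' y v) has_derivative (\<lambda>u. \<Xi>'' x u v)) (at x)"
    and sym_Xi'': "x \<in> U \<Longrightarrow> \<Xi>'' x u v = \<Xi>'' x v u"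
    and normal: "x \<in> U \<Longrightarrow> frame_form d (\<tau> x v) (\<Xi> x) = 0"
    and unit: "x \<in> U \<Longrightarrow> frame_form d (\<Xi> x) (\<Xi> x) = \<epsilon>"
begin

abbreviation "ip \<equiv> frame_form d"
abbreviation "conn \<equiv> frame_conn \<kappa> d"

text \<open>For constant coordinate fields \<open>u, v, w\<close>: \<open>T\<close> is the ambient \<open>\<nabla>\<^sub>u v\<close>, \<open>N\<close> is \<open>\<nabla>\<^sub>v \<xi>\<close>, \<open>\<Gamma>\<close> is
  \<open>\<nabla>\<^sup>\<Sigma>\<^sub>u v\<close>, and \<open>P\<close> is \<open>(\<nabla>\<^sup>\<Sigma>\<^sub>u h)(v, w)\<close>.\<close>

definition T where "T x u v = \<tau>' x u v + conn (\<tau> x u) (\<tau> x v)"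
definition N where "N x v = \<Xi>' x v + conn (\<tau> x v) (\<Xi> x)"
definition N' where "N' x u v = \<Xi>'' x u v + conn (\<tau>' x u v) (\<Xi> x) + conn (\<tau> x v) (\<Xi>' x u)"
definition \<Gamma> where "\<Gamma> x u v = inv (\<tau> x) (T x u v - (\<epsilon> * ip (T x u v) (\<Xi> x)) *\<^sub>R \<Xi> x)"
text \<open>The Weingarten form of the second fundamental form. Written with \<open>T\<close> it
  would need third derivatives of the immersion when differentiated; written with \<open>N\<close>
  it needs only \<tau>' and \<Xi>''.\<close>

definition h where "h x v w = - \<epsilon> * ip (\<tau> x w) (N x v)"
definition P where "P x u v w =
  - \<epsilon> * (ip (\<tau>' x u w) (N x v) + ip (\<tau> x w) (N' x u v)) - h x (\<Gamma> x u v) w - h x v (\<Gamma> x u w)"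

lemma eps_square [simp]: "\<epsilon> * \<epsilon> = 1" "\<epsilon> * (\<epsilon> * a) = a"
  using eps by auto

lemma linear_Xi': "x \<in> U \<Longrightarrow> linear (\<Xi>' x)"
  by (rule has_derivative_linear[OF deriv_Xi])

lemma linear_tau'_left: "x \<in> U \<Longrightarrow> linear (\<lambda>u. \<tau>' x u v)"
  by (rule has_derivative_linear[OF deriv_tau])

text \<open>The second argument is not a direction of differentiation; its linearity is obtained by
  differentiating that of \<open>\<tau> y\<close> for \<open>y\<close> near
  \<open>x\<close>.\<close>

lemma linear_tau'_right: assumes x: "x \<in> U" shows "linear (\<lambda>v. \<tau>' x u v)"
proof (rule linearI)
  fix v w :: "real ^ 3" and r :: real
  show "\<tau>' x u (v + w) = \<tau>' x u v + \<tau>' x u w"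
    by (rule has_derivative_eq_on_open[OF deriv_tau[OF x]
          has_derivative_add[OF deriv_tau[OF x] deriv_tau[OF x]] open_U x])
       (rule linear_add[OF linear_tau])
  show "\<tau>' x u (r *\<^sub>R v) = r *\<^sub>R \<tau>' x u v"
    by (rule has_derivative_eq_on_open[OF deriv_tau[OF x]
          has_derivative_scaleR_right[OF deriv_tau[OF x]] open_U x])
       (rule linear_scale[OF linear_tau])
qed

lemma bilinear_T: assumes x: "x \<in> U" shows "bilinear (T x)"
  unfolding bilinear_def T_def
  by (intro conjI allI linearI)
     (simp_all add: linear_add[OF linear_tau'_left[OF x]] linear_add[OF linear_tau'_right[OF x]]
       linear_add[OF linear_tau[OF x]] linear_scale[OF linear_tau'_left[OF x]]
       linear_scale[OF linear_tau'_right[OF x]] linear_scale[OF linear_tau[OF x]]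
       frame_conn.add_left frame_conn.add_right frame_conn.scaleR_left frame_conn.scaleR_right
       scaleR_add_right)

text \<open>The structure equation and the torsion of \<open>frame_conn\<close> contribute opposite
  brackets.\<close>

lemma T_commute: assumes x: "x \<in> U" shows "T x u v = T x v u"
  using torsion[OF x, of u v] frame_conn_torsion[of \<kappa> d "\<tau> x u" "\<tau> x v"]
  unfolding T_def by (simp add: algebra_simps)

lemma deriv_N: "x \<in> U \<Longrightarrow> ((\<lambda>y. N y v) has_derivative (\<lambda>u. N' x u v)) (at x)"
  unfolding N_def N'_def
  by (rule derivative_eq_intros frame_conn.FDERIV deriv_tau deriv_Xi deriv_Xi' refl | assumption)+
     (simp add: fun_eq_iff)

lemma N_orthogonal: assumes x: "x \<in> U" shows "ip (N x v) (\<Xi> x) = 0"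
proof -
  have "ip (\<Xi> x) (\<Xi>' x v) + ip (\<Xi>' x v) (\<Xi> x) = 0"
    by (rule has_derivative_eq_on_open[OF frame_form.FDERIV[OF deriv_Xi[OF x] deriv_Xi[OF x]]
        has_derivative_const open_U x unit])
  then show ?thesis
    using frame_conn_metric[OF d, of \<kappa> "\<tau> x v" "\<Xi> x" "\<Xi> x"]
    by (simp add: N_def frame_form.add_left frame_form_commute[of d "\<Xi> x"])
qed

lemma ip_T_Xi: assumes x: "x \<in> U" shows "ip (T x v w) (\<Xi> x) = - ip (\<tau> x w) (N x v)"
proof -
  have "ip (\<tau> x w) (\<Xi>' x v) + ip (\<tau>' x v w) (\<Xi> x) = 0"
    by (rule has_derivative_eq_on_open[OF frame_form.FDERIV[OF deriv_tau[OF x] deriv_Xi[OF x]]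
        has_derivative_const open_U x normal])
  then show ?thesis
    using frame_conn_metric[OF d, of \<kappa> "\<tau> x v" "\<tau> x w" "\<Xi> x"]
    by (simp add: N_def T_def frame_form.add_left frame_form.add_right)
qed

lemma h_eq: "x \<in> U \<Longrightarrow> h x v w = \<epsilon> * ip (T x v w) (\<Xi> x)"
  by (simp add: h_def ip_T_Xi)

lemma h_commute: "x \<in> U \<Longrightarrow> h x v w = h x w v"
  by (simp add: h_eq T_commute[of x v w])

text \<open>A dimension count: \<Xi> is not null, so its orthogonal complement is a proper subspace,
  and it contains the three-dimensional image of \<tau>. This is how all adapted vectors are lifted
  to the parameter domain.\<close>

lemma tangent: assumes x: "x \<in> U" and X: "ip X (\<Xi> x) = 0" obtains v where "\<tau> x v = X"
proof -
  define S where "S = {X. ip X (\<Xi> x) = 0}"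
  have S: "subspace S"
    by (auto simp: S_def subspace_def frame_form.add_left frame_form.scaleR_left frame_form.zero_left)
  have "\<Xi> x \<notin> S" using unit[OF x] eps by (auto simp: S_def)
  then have "span S \<subset> span UNIV" using S by (auto simp: span_eq_iff[THEN iffD2])
  from dim_psubset[OF this] have "dim S \<le> 3" by simp
  moreover have "dim (range (\<tau> x)) = 3"
    using dim_image_eq[OF linear_tau[OF x], of UNIV] inj_tau[OF x] by simp
  moreover have "range (\<tau> x) \<subseteq> S" using normal[OF x] by (auto simp: S_def)
  moreover have "subspace (range (\<tau> x))"
    by (rule linear_subspace_image[OF linear_tau[OF x] subspace_UNIV])
  ultimately have "range (\<tau> x) = S" using S by (intro subspace_dim_equal) auto
  then have "X \<in> range (\<tau> x)" using X by (simp add: S_def)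
  then show ?thesis using that by blast
qed

lemma tau_Gamma: assumes x: "x \<in> U"
  shows "\<tau> x (\<Gamma> x u v) = T x u v - (\<epsilon> * ip (T x u v) (\<Xi> x)) *\<^sub>R \<Xi> x"
proof -
  have "ip (T x u v - (\<epsilon> * ip (T x u v) (\<Xi> x)) *\<^sub>R \<Xi> x) (\<Xi> x) = 0"
    using unit[OF x] by (simp add: frame_form.diff_left frame_form.scaleR_left mult_ac)
  from tangent[OF x this] show ?thesis
    unfolding \<Gamma>_def by (metis f_inv_into_f rangeI)
qed

lemma bilinear_Gamma: assumes x: "x \<in> U" shows "bilinear (\<Gamma> x)"
  unfolding bilinear_def
  by (intro conjI allI linearI; rule injD[OF inj_tau[OF x]])
     (simp_all add: linear_add[OF linear_tau[OF x]] linear_scale[OF linear_tau[OF x]] tau_Gamma[OF x]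
       bilinear_ladd[OF bilinear_T[OF x]] bilinear_radd[OF bilinear_T[OF x]]
       bilinear_lmul[OF bilinear_T[OF x]] bilinear_rmul[OF bilinear_T[OF x]]
       frame_form.add_left frame_form.scaleR_left algebra_simps)

lemma Gamma_commute: "x \<in> U \<Longrightarrow> \<Gamma> x u v = \<Gamma> x v u"
  by (simp add: \<Gamma>_def T_commute[of x u v])

lemma ip_tau_Gamma: assumes x: "x \<in> U" and Y: "ip Y (\<Xi> x) = 0"
  shows "ip (\<tau> x (\<Gamma> x u v)) Y = ip (T x u v) Y"
  using Y by (simp add: tau_Gamma[OF x] frame_form.diff_left frame_form.scaleR_left
      frame_form_commute[of d "\<Xi> x"])

text \<open>The tangential projection of the ambient connection is symmetric and metric, hence
  Levi-Civita. The induced metric is nondegenerate because every vector splits into a tangent part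
  and a multiple of the non-null \<Xi>.\<close>

lemma christoffel_map_pullback:
  assumes x: "x \<in> U" and g: "\<And>y v w. y \<in> U \<Longrightarrow> g y v w = ip (\<tau> y v) (\<tau> y w)"
  shows "christoffel_map g x v w = \<Gamma> x v w"
proof (rule christoffel_map_unique)
  have "g x = (\<lambda>v w. ip (\<tau> x v) (\<tau> x w))" using g[OF x] by blast
  then show "bilinear (g x)"
    unfolding bilinear_def
    by (auto intro!: linearI simp: linear_add[OF linear_tau[OF x]] linear_scale[OF linear_tau[OF x]]
        frame_form.add_left frame_form.scaleR_left frame_form.add_right frame_form.scaleR_right)
  show "g x v w = g x w v" for v w
    by (simp add: g[OF x] frame_form_commute)
  show "v = 0" if v: "\<And>w. g x v w = 0" for v
  proof -
    have "\<tau> x v = 0"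
    proof (rule frame_form_nondegenerate[OF d])
      fix Y
      define c where "c = \<epsilon> * ip Y (\<Xi> x)"
      have "ip (Y - c *\<^sub>R \<Xi> x) (\<Xi> x) = 0"
        using unit[OF x] by (simp add: c_def frame_form.diff_left frame_form.scaleR_left mult_ac)
      then obtain w where w: "\<tau> x w = Y - c *\<^sub>R \<Xi> x" by (rule tangent[OF x])
      have "ip (\<tau> x v) (\<tau> x w) = 0" using v[of w] g[OF x] by simp
      then show "ip (\<tau> x v) Y = 0"
        using normal[OF x, of v] by (simp add: w frame_form.diff_right frame_form.scaleR_right)
    qed
    then show ?thesis using injD[OF inj_tau[OF x], of v 0] linear_0[OF linear_tau[OF x]] by simp
  qed
  show "((\<lambda>y. g y v w) has_derivative (\<lambda>u. g x (\<Gamma> x u v) w + g x v (\<Gamma> x u w))) (at x)" for v w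
  proof (rule has_derivative_transform_within_open[OF _ open_U x])
    have "ip (\<tau> x v) (\<tau>' x u w) + ip (\<tau>' x u v) (\<tau> x w) = g x (\<Gamma> x u v) w + g x v (\<Gamma> x u w)" for u
      using frame_conn_metric[OF d, of \<kappa> "\<tau> x u" "\<tau> x v" "\<tau> x w"]
      by (simp add: g[OF x] frame_form_commute[of d "\<tau> x v" "\<tau> x (\<Gamma> _ _ _)"] ip_tau_Gamma[OF x] normal[OF x]
           T_def frame_form.add_left frame_form_commute[of d "\<tau> x v"])
    then show "((\<lambda>y. ip (\<tau> y v) (\<tau> y w)) has_derivative (\<lambda>u. g x (\<Gamma> x u v) w + g x v (\<Gamma> x u w))) (at x)"
      by (intro has_derivative_eq_rhs[OF frame_form.FDERIV[OF deriv_tau[OF x] deriv_tau[OF x]]]) simp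
  qed (simp add: g)
  show "bilinear (\<Gamma> x)" by (rule bilinear_Gamma[OF x])
  show "\<Gamma> x v w = \<Gamma> x w v" for v w by (rule Gamma_commute[OF x])
qed

lemma deriv_h: assumes x: "x \<in> U"
  shows "((\<lambda>y. h y v w) has_derivative
    (\<lambda>u. - \<epsilon> * (ip (\<tau>' x u w) (N x v) + ip (\<tau> x w) (N' x u v)))) (at x)"
  unfolding h_def
  using has_derivative_mult_right[OF frame_form.FDERIV[OF deriv_tau[OF x] deriv_N[OF x]], of "- \<epsilon>"]
  by (simp add: add.commute)

text \<open>Metric compatibility moves the derivative off the tangent slot, so that
  \<open>\<nabla>h\<close> becomes the covariant derivative of the shape map
  \<open>N\<close>.\<close>

lemma P_eq: assumes x: "x \<in> U"
  shows "P x u v w = - \<epsilon> * ip (\<tau> x w) (N' x u v + conn (\<tau> x u) (N x v) - N x (\<Gamma> x u v))"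
proof -
  have "ip (\<tau> x (\<Gamma> x u w)) (N x v) = ip (\<tau>' x u w) (N x v) - ip (\<tau> x w) (conn (\<tau> x u) (N x v))"
    using frame_conn_metric[OF d, of \<kappa> "\<tau> x u" "\<tau> x w" "N x v"]
    by (simp add: ip_tau_Gamma[OF x N_orthogonal[OF x]] T_def frame_form.add_left)
  then show ?thesis
    unfolding P_def h_def by (simp only:) (simp add: frame_form.add_right frame_form.diff_right algebra_simps)
qed

text \<open>Antisymmetrizing cancels \<Xi>'' and \<Gamma>. What remains are iterated connection
  terms, and \<open>torsion\<close> supplies the bracket that completes them to the
  curvature.\<close>

lemma codazzi: assumes x: "x \<in> U"
  shows "P x u v w - P x v u w = - \<epsilon> * ip (\<tau> x w) (frame_curvature \<kappa> d (\<tau> x u) (\<tau> x v) (\<Xi> x))"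
proof -
  have "N' x u v + conn (\<tau> x u) (N x v) - (N' x v u + conn (\<tau> x v) (N x u))
    = frame_curvature \<kappa> d (\<tau> x u) (\<tau> x v) (\<Xi> x)
      + (conn (\<tau>' x u v - \<tau>' x v u) (\<Xi> x) + conn (frame_bracket \<kappa> (\<tau> x u) (\<tau> x v)) (\<Xi> x))"
    unfolding N'_def N_def frame_curvature_def
    by (simp add: sym_Xi''[OF x, of v u] frame_conn.add_right frame_conn.diff_left)
  also have "\<dots> = frame_curvature \<kappa> d (\<tau> x u) (\<tau> x v) (\<Xi> x)"
    unfolding torsion[OF x] by (simp add: frame_conn.minus_left)
  finally have "N' x u v + conn (\<tau> x u) (N x v)
      = N' x v u + conn (\<tau> x v) (N x u) + frame_curvature \<kappa> d (\<tau> x u) (\<tau> x v) (\<Xi> x)"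
    by (simp add: algebra_simps)
  then show ?thesis
    unfolding P_eq[OF x] Gamma_commute[OF x, of v u]
    by (simp add: frame_form.add_right frame_form.diff_right algebra_simps)
qed

end

section \<open>Restrictions on the normal of a parallel hypersurface\<close>

context frame_hypersurface
begin

text \<open>The \<open>u\<^sub>1\<close>-component of \<open>N x v - \<kappa> \<delta> \<tau> x v\<close>; see \<open>N_eq\<close>.\<close>

definition \<eta> where "\<eta> x v = \<Xi>' x v $ 1 - \<Xi> x $ 1 * \<tau> x v $ 4 + \<Xi> x $ 4 * \<tau> x v $ 3"

lemma deriv_Xi_nth: "x \<in> U \<Longrightarrow> ((\<lambda>y. \<Xi> y $ i) has_derivative (\<lambda>u. \<Xi>' x u $ i)) (at x)"
  by (rule bounded_linear.has_derivative[OF bounded_linear_vec_nth deriv_Xi])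

lemma deriv_Xi'_nth: "x \<in> U \<Longrightarrow> ((\<lambda>y. \<Xi>' y v $ i) has_derivative (\<lambda>u. \<Xi>'' x u v $ i)) (at x)"
  by (rule bounded_linear.has_derivative[OF bounded_linear_vec_nth deriv_Xi'])

lemma deriv_tau_nth: "x \<in> U \<Longrightarrow> ((\<lambda>y. \<tau> y v $ i) has_derivative (\<lambda>u. \<tau>' x u v $ i)) (at x)"
  by (rule bounded_linear.has_derivative[OF bounded_linear_vec_nth deriv_tau])

lemma linear_eta: "x \<in> U \<Longrightarrow> linear (\<eta> x)"
  unfolding \<eta>_def
  by (rule linearI) (simp_all add: linear_add[OF linear_Xi'] linear_scale[OF linear_Xi']
      linear_add[OF linear_tau] linear_scale[OF linear_tau] algebra_simps)

lemma deriv_eta: "x \<in> U \<Longrightarrow> \<exists>\<eta>'. ((\<lambda>y. \<eta> y v) has_derivative \<eta>') (at x)"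
  unfolding \<eta>_def
  by (rule exI) (rule has_derivative_add has_derivative_diff has_derivative_mult deriv_Xi_nth deriv_Xi'_nth deriv_tau_nth | assumption)+

lemma Xi'_nth_eq_0:
  assumes "x \<in> U" "\<And>y. y \<in> U \<Longrightarrow> \<Xi> y $ i = c"
  shows "\<Xi>' x u $ i = 0"
  by (rule has_derivative_eq_on_open[OF deriv_Xi_nth has_derivative_const open_U])
     (use assms in auto)

lemma normal_components:
  assumes "x \<in> U" "\<Xi> x $ 3 = 0"
  shows "\<tau> x v $ 2 * \<Xi> x $ 2 - \<tau> x v $ 3 * \<Xi> x $ 1 + d * \<tau> x v $ 4 * \<Xi> x $ 4 = 0"
  using normal[OF assms(1), of v] assms(2) by (simp add: frame_form_def)

lemma unit_components:
  assumes "x \<in> U" "\<Xi> x $ 3 = 0"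
  shows "\<Xi> x $ 2 * \<Xi> x $ 2 + d * \<Xi> x $ 4 * \<Xi> x $ 4 = \<epsilon>"
  using unit[OF assms(1)] assms(2) by (simp add: frame_form_def)

lemma curvature_vanishes:
  assumes x: "x \<in> U" and P: "\<And>u v w. P x u v w = 0"
    and "ip X (\<Xi> x) = 0" "ip Y (\<Xi> x) = 0" "ip W (\<Xi> x) = 0"
  shows "\<kappa> / d * (X $ 2 * Y $ 3 - X $ 3 * Y $ 2) * (\<Xi> x $ 3 * W $ 2 - \<Xi> x $ 2 * W $ 3)
    + (2 * \<kappa> - 2) * (X $ 3 * Y $ 4 - X $ 4 * Y $ 3) * (\<Xi> x $ 4 * W $ 3 - \<Xi> x $ 3 * W $ 4) = 0"
proof -
  obtain u v w where t: "\<tau> x u = X" "\<tau> x v = Y" "\<tau> x w = W"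
    using tangent[OF x] assms(3-5) by metis
  have "ip W (frame_curvature \<kappa> d X Y (\<Xi> x)) = 0"
    using codazzi[OF x, of u v w] eps by (auto simp: P t)
  then show ?thesis
    using frame_form_curvature[OF d assms(3,4), of \<kappa> W]
    by (simp add: frame_form_commute[of d W])
qed

lemma parallel_normal_shape:
  assumes x: "x \<in> U" and P: "\<And>u v w. P x u v w = 0"
  shows "\<Xi> x $ 3 = 0" and "\<Xi> x $ 2 = 0 \<or> \<Xi> x $ 4 = 0 \<or> \<kappa> = 2"
proof -
  note curv = curvature_vanishes[OF x P]
  show g: "\<Xi> x $ 3 = 0"
  proof (rule ccontr)
    assume g: "\<Xi> x $ 3 \<noteq> 0"
    \<comment> \<open>For \<gamma> \<noteq> 0 orthogonality to \<Xi> can be solved for the first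
      component, so the other three are free. Choosing them to isolate each curvature coefficient
      gives \<kappa> = 0 and then 2 \<gamma> = 0.\<close>
    define t where "t q r s = vec4
      ((q * \<Xi> x $ 2 + r * (\<Xi> x $ 3 - \<Xi> x $ 1) + d * s * \<Xi> x $ 4) / \<Xi> x $ 3) q r s" for q r s
    have t: "ip (t q r s) (\<Xi> x) = 0" for q r s
      using g by (simp add: t_def frame_form_def field_simps)
    have "\<kappa> = 0"
      using curv[OF t[of 1 0 0] t[of 0 1 0] t[of 1 0 0]] g d by (simp add: t_def)
    then show False
      using curv[OF t[of 0 1 0] t[of 0 0 1] t[of 0 0 1]] g by (simp add: t_def)
  qed
  show "\<Xi> x $ 2 = 0 \<or> \<Xi> x $ 4 = 0 \<or> \<kappa> = 2"
  proof (rule ccontr)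
    assume n: "\<not> (\<Xi> x $ 2 = 0 \<or> \<Xi> x $ 4 = 0 \<or> \<kappa> = 2)"
    \<comment> \<open>These are \<open>V\<^sub>2\<close> and \<open>V\<^sub>3\<close> of case (3).
      On them the two curvature coefficients combine as (2 \<kappa> - 2) - \<kappa> = \<kappa> -
      2.\<close>
    have t: "ip (vec4 0 (d * \<Xi> x $ 4) 0 (- \<Xi> x $ 2)) (\<Xi> x) = 0"
      "ip (vec4 0 (\<Xi> x $ 1) (\<Xi> x $ 2) 0) (\<Xi> x) = 0"
      using g by (simp_all add: frame_form_def)
    have "\<Xi> x $ 2 ^ 3 * \<Xi> x $ 4 * (\<kappa> - 2) = 0"
      using curv[OF t(1) t(2) t(2)] d g by (simp add: field_simps power3_eq_cube)
    then show False using n by simp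
  qed
qed

text \<open>Pairing with \<open>u\<^sub>1\<close> extracts minus the third component, so only that
  component of the derivative of \<open>N\<close> has to be computed. The differential of \<delta>
  enters through the fourth component of \<open>N\<close>.\<close>

lemma P_null_direction:
  assumes x: "x \<in> U" and g: "\<And>y. y \<in> U \<Longrightarrow> \<Xi> y $ 3 = 0" and w: "\<tau> x w = axis 1 1"
  shows "P x u v w = \<epsilon> * \<kappa> * (\<Xi>' x u $ 4 * \<tau> x v $ 3 + \<tau> x u $ 3 * \<Xi>' x v $ 4)"
proof -
  have g': "\<Xi>' y u $ 3 = 0" if "y \<in> U" for y u
    by (rule Xi'_nth_eq_0[OF that g])
  have g'': "\<Xi>'' x u v $ 3 = 0"
    by (rule has_derivative_eq_on_open[OF deriv_Xi'_nth[OF x] has_derivative_const open_U x g'])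
  have n: "\<kappa> * (\<tau> x v $ 2 * \<Xi> x $ 2 - \<tau> x v $ 3 * \<Xi> x $ 1) / d = - \<kappa> * \<tau> x v $ 4 * \<Xi> x $ 4"
    using normal_components[OF x g[OF x], of v] d by (simp add: field_simps) algebra
  have N3: "N x v $ 3 = \<kappa> * \<tau> x v $ 3 * \<Xi> x $ 4" for v
    using g[OF x] g'[OF x] by (simp add: N_def frame_conn_def)
  have N4: "N x v $ 4 = \<Xi>' x v $ 4 + \<kappa> * \<tau> x v $ 4 * \<Xi> x $ 4"
    using g[OF x] n by (simp add: N_def frame_conn_def)
  have "P x u v w = \<epsilon> * (N' x u v + conn (\<tau> x u) (N x v) - N x (\<Gamma> x u v)) $ 3"
    unfolding P_eq[OF x] w by (simp add: frame_form_def axis_def algebra_simps)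
  also have "(N' x u v + conn (\<tau> x u) (N x v) - N x (\<Gamma> x u v)) $ 3
      = \<kappa> * (\<Xi>' x u $ 4 * \<tau> x v $ 3 + \<tau> x u $ 3 * \<Xi>' x v $ 4)"
    by (simp add: N3 N'_def g'' tau_Gamma[OF x] g[OF x] T_def g'[OF x])
       (simp add: frame_conn_def N3 N4 g[OF x] g'[OF x] algebra_simps)
  finally show ?thesis by simp
qed

lemma parallel_delta:
  assumes P: "\<And>y u v w. y \<in> U \<Longrightarrow> P y u v w = 0" and x: "x \<in> U"
  shows "\<Xi>' x u $ 4 = 0"
proof -
  have g: "\<Xi> y $ 3 = 0" if "y \<in> U" for y
    by (rule parallel_normal_shape[OF that P[OF that]])
  show ?thesis
  proof (cases "\<kappa> = 0")
    case False
    have "ip (axis 1 1) (\<Xi> x) = 0" using g[OF x] by (simp add: frame_form_def axis_def)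
    then obtain w where w: "\<tau> x w = axis 1 1" by (rule tangent[OF x])
    \<comment> \<open>The symmetric product of the differential of \<delta> with
      \<open>\<theta>\<^sup>3\<close> vanishes. A tangent vector on which
      \<open>\<theta>\<^sup>3\<close> is nonzero then annihilates this differential, first on itself
      and then on every vector.\<close>
    have sym: "\<Xi>' x u $ 4 * \<tau> x v $ 3 + \<tau> x u $ 3 * \<Xi>' x v $ 4 = 0" for u v
      using P_null_direction[OF x g w, of u v] P[OF x] False eps by auto
    have "\<exists>v. \<tau> x v $ 3 \<noteq> 0"
    proof (cases "\<Xi> x $ 2 = 0")
      case True
      have "ip (vec4 0 0 (d * \<Xi> x $ 4) (\<Xi> x $ 1)) (\<Xi> x) = 0" using g[OF x] by (simp add: frame_form_def)
      then obtain v where "\<tau> x v = vec4 0 0 (d * \<Xi> x $ 4) (\<Xi> x $ 1)" by (rule tangent[OF x])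
      moreover have "\<Xi> x $ 4 \<noteq> 0" using unit_components[OF x g[OF x]] True eps by auto
      ultimately show ?thesis using d by (intro exI[of _ v]) simp
    next
      case False
      have "ip (vec4 0 (\<Xi> x $ 1) (\<Xi> x $ 2) 0) (\<Xi> x) = 0" using g[OF x] by (simp add: frame_form_def)
      then obtain v where "\<tau> x v = vec4 0 (\<Xi> x $ 1) (\<Xi> x $ 2) 0" by (rule tangent[OF x])
      then show ?thesis using False by (intro exI[of _ v]) simp
    qed
    then obtain v where v: "\<tau> x v $ 3 \<noteq> 0" by blast
    then have "\<Xi>' x v $ 4 = 0" using sym[of v v] by simp
    then show ?thesis using sym[of u v] v by simp
  next
    case True
    \<comment> \<open>Now \<open>d \<delta>\<^sup>2\<close> takes only the values \<open>0\<close> and \<open>\<epsilon>\<close>.\<close>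
    define q where "q y = \<Xi> y $ 4" for y
    have q: "q y = 0 \<or> d * (q y)\<^sup>2 = \<epsilon>" if "y \<in> U" for y
      using parallel_normal_shape(2)[OF that P[OF that]] unit_components[OF that g[OF that]] True
      by (auto simp: q_def power2_eq_square mult.assoc)
    \<comment> \<open>This cubic in \<open>q\<close> vanishes identically and has simple roots: its
      derivative there is \<open>- \<epsilon>\<close> or \<open>2 * \<epsilon>\<close>. So the
      differential of \<open>q\<close> is zero.\<close>
    have "((\<lambda>y. q y * (d * (q y)\<^sup>2 - \<epsilon>)) has_derivative (\<lambda>u. (3 * d * (q x)\<^sup>2 - \<epsilon>) * \<Xi>' x u $ 4)) (at x)"
      using deriv_Xi_nth[OF x, of 4] unfolding q_def
      by (auto intro!: derivative_eq_intros simp: fun_eq_iff power2_eq_square algebra_simps)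
    then have "(3 * d * (q x)\<^sup>2 - \<epsilon>) * \<Xi>' x u $ 4 = 0"
      by (rule has_derivative_eq_on_open[OF _ has_derivative_const open_U x]) (use q in force)
    moreover have "3 * d * (q x)\<^sup>2 - \<epsilon> \<noteq> 0" using q[OF x] eps by auto
    ultimately show ?thesis by simp
  qed
qed

text \<open>When only the first component of \<Xi> varies, all else in \<open>N\<close> comes from
  the connection. Normality is what makes its fourth component agree with that of \<kappa> \<delta>
  \<tau>.\<close>

lemma N_eq:
  assumes x: "x \<in> U" and "\<Xi> x $ 3 = 0" "\<And>v. \<Xi>' x v $ 2 = 0" "\<And>v. \<Xi>' x v $ 3 = 0" "\<And>v. \<Xi>' x v $ 4 = 0"
  shows "N x v = (\<kappa> * \<Xi> x $ 4) *\<^sub>R \<tau> x v + \<eta> x v *\<^sub>R axis 1 1"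
proof -
  have "(\<kappa> * (\<Xi> x $ 1 * \<tau> x v $ 3) - \<kappa> * (\<Xi> x $ 2 * \<tau> x v $ 2)) / d = \<kappa> * (\<Xi> x $ 4 * \<tau> x v $ 4)"
    using normal_components[OF assms(1,2), of v] d by (simp add: field_simps) algebra
  then show ?thesis
    using assms by (simp add: N_def \<eta>_def vec4_eq_iff frame_conn_def axis_def algebra_simps)
qed

end

text \<open>The situation common to all three cases; \<open>\<gamma> = 0\<close> means that the null field \<open>u\<^sub>1\<close> is tangent.\<close>

locale null_tangent_hypersurface = frame_hypersurface +
  assumes Xi_3: "x \<in> U \<Longrightarrow> \<Xi> x $ 3 = 0"
    and Xi'_2: "x \<in> U \<Longrightarrow> \<Xi>' x v $ 2 = 0" and Xi'_4: "x \<in> U \<Longrightarrow> \<Xi>' x v $ 4 = 0"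
begin

lemma Xi'_3: "x \<in> U \<Longrightarrow> \<Xi>' x v $ 3 = 0"
  by (rule Xi'_nth_eq_0[OF _ Xi_3])

lemma N_eta: "x \<in> U \<Longrightarrow> N x v = (\<kappa> * \<Xi> x $ 4) *\<^sub>R \<tau> x v + \<eta> x v *\<^sub>R axis 1 1"
  by (intro N_eq Xi_3 Xi'_2 Xi'_3 Xi'_4)

lemma ip_axis_1: "ip X (axis 1 1) = - X $ 3"
  by (simp add: frame_form_def axis_def)

lemma h_eta: "x \<in> U \<Longrightarrow>
    h x v w = - \<epsilon> * (\<kappa> * \<Xi> x $ 4 * ip (\<tau> x w) (\<tau> x v) - \<eta> x v * \<tau> x w $ 3)"
  by (simp add: h_def N_eta frame_form.add_right frame_form.scaleR_right ip_axis_1)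

lemma eta_commute: "x \<in> U \<Longrightarrow> \<eta> x v * \<tau> x w $ 3 = \<eta> x w * \<tau> x v $ 3"
  using h_commute[of x v w] eps
  by (auto simp: h_eta frame_form_commute[of d "\<tau> x w"])

text \<open>As \<delta> has zero differential, the summand \<kappa> \<delta> Id of the shape map
  contributes only a multiple of \<Xi>, invisible to tangent vectors. The last term is the
  derivative of \<open>u\<^sub>1\<close>.\<close>

lemma P_eta:
  assumes x: "x \<in> U" and \<eta>': "((\<lambda>y. \<eta> y v) has_derivative \<eta>') (at x)"
  shows "P x u v w = \<epsilon> * ((\<eta>' u - \<eta> x (\<Gamma> x u v)) * \<tau> x w $ 3
    - \<eta> x v * (\<kappa> * \<tau> x u $ 3 * \<tau> x w $ 4 + \<tau> x u $ 4 * \<tau> x w $ 3))"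
proof -
  let ?l = "\<kappa> * \<Xi> x $ 4"
  have "((\<lambda>y. (\<kappa> * \<Xi> y $ 4) *\<^sub>R \<tau> y v + \<eta> y v *\<^sub>R axis 1 1) has_derivative
      (\<lambda>u. ?l *\<^sub>R \<tau>' x u v + \<eta>' u *\<^sub>R axis 1 1)) (at x)"
    by (rule has_derivative_eq_rhs,
        (rule has_derivative_add has_derivative_scaleR has_derivative_mult_right has_derivative_const
          deriv_Xi_nth deriv_tau \<eta>' x)+)
       (simp add: Xi'_4[OF x])
  from has_derivative_eq_on_open[OF deriv_N[OF x] this open_U x N_eta]
  have N': "N' x u v = ?l *\<^sub>R \<tau>' x u v + \<eta>' u *\<^sub>R axis 1 1" .
  have "N' x u v + conn (\<tau> x u) (N x v) - N x (\<Gamma> x u v)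
    = (\<eta>' u - \<eta> x (\<Gamma> x u v)) *\<^sub>R axis 1 1 + \<eta> x v *\<^sub>R conn (\<tau> x u) (axis 1 1)
      + (?l * (\<epsilon> * ip (T x u v) (\<Xi> x))) *\<^sub>R \<Xi> x"
    unfolding N' N_eta[OF x] tau_Gamma[OF x]
    by (simp add: T_def frame_conn.add_right frame_conn.scaleR_right scaleR_add_right scaleR_diff_right
        scaleR_diff_left)
  note N_sum = this
  have C: "ip (\<tau> x w) (conn (\<tau> x u) (axis 1 1)) = \<kappa> * \<tau> x u $ 3 * \<tau> x w $ 4 + \<tau> x u $ 4 * \<tau> x w $ 3"
    using d by (simp add: frame_form_def frame_conn_def axis_def field_simps)
  show ?thesis
    unfolding P_eq[OF x] N_sum frame_form.add_right frame_form.scaleR_right C ip_axis_1 normal[OF x]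
    by (simp add: algebra_simps)
qed

lemma P_nu:
  assumes x: "x \<in> U" and \<nu>: "\<And>y v. y \<in> U \<Longrightarrow> \<eta> y v = \<nu> y * \<tau> y v $ 3"
    and \<nu>': "(\<nu> has_derivative \<nu>') (at x)"
  shows "P x u v w = \<epsilon> * (\<nu>' u * \<tau> x v $ 3 * \<tau> x w $ 3
    - \<nu> x * ((\<kappa> * \<tau> x u $ 3 * \<tau> x v $ 4 + \<tau> x u $ 4 * \<tau> x v $ 3) * \<tau> x w $ 3
      + \<tau> x v $ 3 * (\<kappa> * \<tau> x u $ 3 * \<tau> x w $ 4 + \<tau> x u $ 4 * \<tau> x w $ 3)))"
proof -
  have "((\<lambda>y. \<nu> y * \<tau> y v $ 3) has_derivative (\<lambda>u. \<nu> x * \<tau>' x u v $ 3 + \<nu>' u * \<tau> x v $ 3)) (at x)"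
    by (intro has_derivative_mult \<nu>' deriv_tau_nth x)
  then have "((\<lambda>y. \<eta> y v) has_derivative (\<lambda>u. \<nu> x * \<tau>' x u v $ 3 + \<nu>' u * \<tau> x v $ 3)) (at x)"
    by (rule has_derivative_transform_within_open[OF _ open_U x]) (simp add: \<nu>)
  note P = P_eta[OF x this, of u w]
  have eta: "\<eta> x (\<Gamma> x u v) = \<nu> x * (\<tau>' x u v $ 3 + \<kappa> * \<tau> x u $ 3 * \<tau> x v $ 4 + \<tau> x u $ 4 * \<tau> x v $ 3)"
    by (simp add: \<nu>[OF x] tau_Gamma[OF x] T_def Xi_3[OF x] frame_conn_def algebra_simps)
  show ?thesis unfolding P eta \<nu>[OF x, of v] by (simp add: algebra_simps)
qed

text \<open>For \<beta> = 0 normality makes \<open>\<theta>\<^sup>4\<close> a multiple of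
  \<open>\<theta>\<^sup>3\<close> on tangent vectors, for \<delta> = 0 it does so with
  \<open>\<theta>\<^sup>2\<close>. Either way one curvature term loses its antisymmetric factor and
  the other loses its normal factor.\<close>

lemma codazzi_symmetric:
  assumes x: "x \<in> U" and "\<Xi> x $ 2 = 0 \<or> \<Xi> x $ 4 = 0"
  shows "P x u v w = P x v u w"
proof -
  note f = frame_form_curvature[OF d normal[OF x] normal[OF x], of \<kappa> u v "\<tau> x w"]
  have "ip (frame_curvature \<kappa> d (\<tau> x u) (\<tau> x v) (\<Xi> x)) (\<tau> x w) = 0"
    using assms(2)
  proof
    assume b: "\<Xi> x $ 2 = 0"
    then have "\<Xi> x $ 4 \<noteq> 0" using unit_components[OF x Xi_3[OF x]] eps by auto
    then have V: "\<tau> x v $ 4 = \<tau> x v $ 3 * \<Xi> x $ 1 / (d * \<Xi> x $ 4)" for v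
      using normal_components[OF x Xi_3[OF x], of v] b d by (simp add: field_simps)
    show ?thesis unfolding f by (simp add: V b Xi_3[OF x])
  next
    assume b: "\<Xi> x $ 4 = 0"
    then have "\<Xi> x $ 2 \<noteq> 0" using unit_components[OF x Xi_3[OF x]] eps by auto
    then have V: "\<tau> x v $ 2 = \<tau> x v $ 3 * \<Xi> x $ 1 / \<Xi> x $ 2" for v
      using normal_components[OF x Xi_3[OF x], of v] b d by (simp add: field_simps)
    show ?thesis unfolding f by (simp add: V b Xi_3[OF x])
  qed
  then show ?thesis using codazzi[OF x, of u v w] by (simp add: frame_form_commute[of d "\<tau> x w"])
qed

end

section \<open>The three cases\<close>

context frame_hypersurface
begin

lemma Xi'_eq_0_of_square:
  assumes x: "x \<in> U" and sq: "\<And>y. y \<in> U \<Longrightarrow> (\<Xi> y $ i)\<^sup>2 = c" and "\<Xi> x $ i \<noteq> 0"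
  shows "\<Xi>' x u $ i = 0"
proof -
  have "((\<lambda>y. (\<Xi> y $ i)\<^sup>2) has_derivative (\<lambda>u. 2 * \<Xi> x $ i * \<Xi>' x u $ i)) (at x)"
    using deriv_Xi_nth[OF x, of i] by (auto intro!: derivative_eq_intros simp: fun_eq_iff)
  then have "2 * \<Xi> x $ i * \<Xi>' x u $ i = 0"
    by (rule has_derivative_eq_on_open[OF _ has_derivative_const open_U x sq])
  then show ?thesis using assms(3) by simp
qed

lemma linear_eq_0_adapted:
  assumes x: "x \<in> U" and l: "linear l" and g: "\<Xi> x $ 3 = 0" and b: "\<Xi> x $ 2 \<noteq> 0"
    and "\<And>u. \<tau> x u = axis 1 1 \<Longrightarrow> l u = (0::real)"
    and "\<And>u. \<tau> x u = vec4 0 (d * \<Xi> x $ 4) 0 (- \<Xi> x $ 2) \<Longrightarrow> l u = 0"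
    and "\<And>u. \<tau> x u = vec4 0 (\<Xi> x $ 1) (\<Xi> x $ 2) 0 \<Longrightarrow> l u = 0"
  shows "l v = 0"
proof -
  have t: "ip (axis 1 1) (\<Xi> x) = 0" "ip (vec4 0 (d * \<Xi> x $ 4) 0 (- \<Xi> x $ 2)) (\<Xi> x) = 0"
      "ip (vec4 0 (\<Xi> x $ 1) (\<Xi> x $ 2) 0) (\<Xi> x) = 0"
    using g by (simp_all add: frame_form_def axis_def)
  obtain v1 v2 v3 where v: "\<tau> x v1 = axis 1 1" "\<tau> x v2 = vec4 0 (d * \<Xi> x $ 4) 0 (- \<Xi> x $ 2)"
    "\<tau> x v3 = vec4 0 (\<Xi> x $ 1) (\<Xi> x $ 2) 0"
    using tangent[OF x] t by metis
  let ?V = "\<tau> x v"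
  \<comment> \<open>The coefficients are read off from components 1, 4 and 3; the second component
    then matches by normality.\<close>
  define w where "w = ?V $ 1 *\<^sub>R v1 + (- ?V $ 4 / \<Xi> x $ 2) *\<^sub>R v2 + (?V $ 3 / \<Xi> x $ 2) *\<^sub>R v3"
  have "\<tau> x v = \<tau> x w"
    using normal_components[OF x g, of v] b
    by (simp add: w_def linear_add[OF linear_tau[OF x]] linear_diff[OF linear_tau[OF x]] linear_scale[OF linear_tau[OF x]] v vec4_eq_iff
        axis_def field_simps)
  then have "v = w" using injD[OF inj_tau[OF x]] by blast
  moreover have "l w = 0"
    using assms(5)[OF v(1)] assms(6)[OF v(2)] assms(7)[OF v(3)]
    by (simp add: w_def linear_add[OF l] linear_diff[OF l] linear_scale[OF l])
  ultimately show ?thesis by metis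
qed

end

context null_tangent_hypersurface
begin

text \<open>Case (1): \<open>\<eta> = - \<phi> / (d \<delta>) \<theta>\<^sup>3\<close>.\<close>

context
  fixes \<phi> :: "real ^ 3 \<Rightarrow> real"
  assumes Xi_2: "y \<in> U \<Longrightarrow> \<Xi> y $ 2 = 0"
    and phi: "y \<in> U \<Longrightarrow> \<tau> y w = vec4 0 0 (d * \<Xi> y $ 4) (\<Xi> y $ 1) \<Longrightarrow>
      \<phi> y = (\<Xi> y $ 1)\<^sup>2 - \<epsilon> - \<Xi>' y w $ 1"
begin

lemma case1_delta:
  assumes x: "x \<in> U"
  shows "d * \<Xi> x $ 4 * \<Xi> x $ 4 = \<epsilon>" and "d * \<Xi> x $ 4 \<noteq> 0"
  using unit_components[OF x Xi_3[OF x]] Xi_2[OF x] eps by auto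

lemma case1_adapted:
  assumes x: "x \<in> U"
  obtains w where "\<tau> x w = vec4 0 0 (d * \<Xi> x $ 4) (\<Xi> x $ 1)"
  by (rule tangent[OF x, of "vec4 0 0 (d * \<Xi> x $ 4) (\<Xi> x $ 1)"])
     (simp_all add: frame_form_def Xi_3[OF x] Xi_2[OF x])

lemma case1_tau_4: "x \<in> U \<Longrightarrow> \<tau> x v $ 4 = \<tau> x v $ 3 * \<Xi> x $ 1 / (d * \<Xi> x $ 4)"
  using normal_components[of x v] case1_delta(2)[of x] by (simp add: Xi_3 Xi_2 field_simps)

lemma case1_eta:
  assumes x: "x \<in> U"
  shows "\<eta> x v = - \<phi> x / (d * \<Xi> x $ 4) * \<tau> x v $ 3"
proof -
  obtain w where w: "\<tau> x w = vec4 0 0 (d * \<Xi> x $ 4) (\<Xi> x $ 1)" by (rule case1_adapted[OF x])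
  \<comment> \<open>The term \<delta> \<open>\<theta>\<^sup>3(w)\<close> equals
    \<open>d \<delta>\<^sup>2\<close>, that is \<epsilon>, and this produces the constant in
    \<phi>.\<close>
  have "\<eta> x w = - \<phi> x"
    using phi[OF x w] case1_delta(1)[OF x] by (simp add: \<eta>_def w power2_eq_square algebra_simps)
  then show ?thesis
    using eta_commute[OF x, of v w] case1_delta(2)[OF x] by (simp add: w field_simps)
qed

lemma case1_alpha:
  assumes x: "x \<in> U" and "\<tau> x u = axis 1 1 \<or> \<tau> x u = axis 2 1"
  shows "\<Xi>' x u $ 1 = 0"
  using case1_eta[OF x, of u] assms(2) by (auto simp: \<eta>_def axis_def)

lemma case1_P:
  assumes x: "x \<in> U" and phi': "(\<phi> has_derivative \<phi>') (at x)"
  shows "P x u v w = - \<epsilon> / (d * \<Xi> x $ 4) * \<tau> x v $ 3 * \<tau> x w $ 3 *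
    (\<phi>' u - 2 * (\<kappa> + 1) * \<Xi> x $ 1 * \<phi> x * \<tau> x u $ 3 / (d * \<Xi> x $ 4))"
proof -
  have d4: "\<Xi> y $ 4 \<noteq> 0" if "y \<in> U" for y using case1_delta(2)[OF that] by auto
  have "((\<lambda>y. - \<phi> y / (d * \<Xi> y $ 4)) has_derivative (\<lambda>u. - \<phi>' u / (d * \<Xi> x $ 4))) (at x)"
    using phi' deriv_Xi_nth[OF x, of 4] d d4[OF x]
    by (auto intro!: derivative_eq_intros simp: fun_eq_iff Xi'_4[OF x] field_simps)
  note P = P_nu[OF x case1_eta this]
  \<comment> \<open>Here \<open>i\<close> stands for the inverse of \<open>d * \<Xi> x $ 4\<close>;
    kept as a variable, it makes the claim a polynomial identity.\<close>
  have eq: "e * (- p * i * V * W - - f * i * ((c * U * (V * A * i) + U * A * i * V) * W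
      + V * (c * U * (W * A * i) + U * A * i * W)))
    = - e * i * V * W * (p - 2 * (c + 1) * A * f * U * i)" for e p i V W f c U A :: real
    by algebra
  show ?thesis
    by (subst P, assumption, unfold case1_tau_4[OF x] divide_inverse) (rule eq)
qed

text \<open>The condition differentiates \<phi> along \<open>w\<close> only and yields
  \<open>P x w u w = 0\<close>. Codazzi symmetry moves \<open>w\<close> out of the first slot, and
  \<open>P x u w w = 0\<close> determines the differential of \<phi> on every
  \<open>u\<close>.\<close>

lemma case1_parallel_iff:
  assumes x: "x \<in> U" and phi': "(\<phi> has_derivative \<phi>') (at x)"
    and w: "\<tau> x w = vec4 0 0 (d * \<Xi> x $ 4) (\<Xi> x $ 1)"
  shows "(\<forall>u v w. P x u v w = 0) \<longleftrightarrow> \<phi>' w = 2 * (\<kappa> + 1) * \<Xi> x $ 1 * \<phi> x"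
proof
  let ?k = "d * \<Xi> x $ 4"
  note k = case1_delta(2)[OF x]
  have eps0: "\<epsilon> \<noteq> 0" using eps by auto
  have Pww: "P x u w w = 0 \<longleftrightarrow> \<phi>' u = 2 * (\<kappa> + 1) * \<Xi> x $ 1 * \<phi> x * \<tau> x u $ 3 / ?k" for u
    using k eps0 unfolding case1_P[OF x phi'] by (simp add: w)
  {
    assume "\<forall>u v w. P x u v w = 0"
    then show "\<phi>' w = 2 * (\<kappa> + 1) * \<Xi> x $ 1 * \<phi> x"
      using Pww[of w] k by (simp add: w)
  next
    assume "\<phi>' w = 2 * (\<kappa> + 1) * \<Xi> x $ 1 * \<phi> x"
    then have "P x w u w = 0" for u
      unfolding case1_P[OF x phi'] using k by (simp add: w)
    then have "P x u w w = 0" for u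
      using codazzi_symmetric[OF x, of u w w] Xi_2[OF x] by simp
    then have "\<phi>' u = 2 * (\<kappa> + 1) * \<Xi> x $ 1 * \<phi> x * \<tau> x u $ 3 / ?k" for u using Pww by blast
    then show "\<forall>u v w. P x u v w = 0"
      unfolding case1_P[OF x phi'] by simp
  }
qed

lemma case1_geodesic_iff:
  assumes x: "x \<in> U"
  shows "(\<forall>v w. h x v w = 0) \<longleftrightarrow> \<kappa> = 0 \<and> \<phi> x = 0"
proof
  assume h: "\<forall>v w. h x v w = 0"
  note k = case1_delta(2)[OF x]
  \<comment> \<open>On the unit vector \<open>u\<^sub>2\<close> the form
    \<open>\<theta>\<^sup>3\<close> vanishes, which isolates the coefficient \<kappa>
    \<delta>.\<close>
  obtain v where v: "\<tau> x v = axis 2 1"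
    by (rule tangent[OF x, of "axis 2 1"]) (auto simp: frame_form_def axis_def Xi_2[OF x])
  have "ip (axis 2 1) (axis 2 1) = 1" by (simp add: frame_form_def axis_def)
  moreover have "(axis 2 1 :: real ^ 4) $ 3 = 0" by (simp add: axis_def)
  ultimately have \<kappa>: "\<kappa> = 0"
    using h[rule_format, of v v] k eps unfolding h_eta[OF x] by (auto simp: v)
  obtain w where w: "\<tau> x w = vec4 0 0 (d * \<Xi> x $ 4) (\<Xi> x $ 1)" by (rule case1_adapted[OF x])
  have "\<phi> x = 0"
    using h[rule_format, of w w] k eps unfolding h_eta[OF x] case1_eta[OF x] by (auto simp: w \<kappa>)
  with \<kappa> show "\<kappa> = 0 \<and> \<phi> x = 0" by simp
next
  assume "\<kappa> = 0 \<and> \<phi> x = 0"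
  then show "\<forall>v w. h x v w = 0" unfolding h_eta[OF x] case1_eta[OF x] by simp
qed

end

text \<open>Case (2): \<open>\<eta> = \<psi> / \<beta> \<theta>\<^sup>3\<close> with \<open>\<psi> = W\<^sub>2(\<alpha>)\<close>.\<close>

context
  fixes \<psi> :: "real ^ 3 \<Rightarrow> real"
  assumes Xi_4: "y \<in> U \<Longrightarrow> \<Xi> y $ 4 = 0"
    and psi: "y \<in> U \<Longrightarrow> \<tau> y w = vec4 0 (\<Xi> y $ 1) (\<Xi> y $ 2) 0 \<Longrightarrow> \<psi> y = \<Xi>' y w $ 1"
begin

lemma case2_beta: assumes x: "x \<in> U" shows "\<Xi> x $ 2 \<noteq> 0"
  using unit_components[OF x Xi_3[OF x]] Xi_4[OF x] eps by auto

lemma case2_adapted: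
  assumes x: "x \<in> U"
  obtains w where "\<tau> x w = vec4 0 (\<Xi> x $ 1) (\<Xi> x $ 2) 0"
  by (rule tangent[OF x, of "vec4 0 (\<Xi> x $ 1) (\<Xi> x $ 2) 0"])
     (simp_all add: frame_form_def Xi_3[OF x] Xi_4[OF x])

lemma case2_eta:
  assumes x: "x \<in> U"
  shows "\<eta> x v = \<psi> x / \<Xi> x $ 2 * \<tau> x v $ 3"
proof -
  obtain w where w: "\<tau> x w = vec4 0 (\<Xi> x $ 1) (\<Xi> x $ 2) 0" by (rule case2_adapted[OF x])
  have "\<eta> x w = \<psi> x"
    using psi[OF x w] by (simp add: \<eta>_def w Xi_4[OF x])
  then show ?thesis
    using eta_commute[OF x, of v w] case2_beta[OF x] by (simp add: w field_simps)
qed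

lemma case2_alpha:
  assumes x: "x \<in> U"
  shows "\<tau> x u = axis 1 1 \<Longrightarrow> \<Xi>' x u $ 1 = 0"
    and "\<tau> x u = axis 4 1 \<Longrightarrow> \<Xi>' x u $ 1 = \<Xi> x $ 1"
  using case2_eta[OF x, of u] by (auto simp: \<eta>_def axis_def Xi_4[OF x])

lemma case2_P:
  assumes x: "x \<in> U" and psi': "(\<psi> has_derivative \<psi>') (at x)"
  shows "P x u v w = \<epsilon> / \<Xi> x $ 2 * (\<psi>' u * \<tau> x v $ 3 * \<tau> x w $ 3
    - \<psi> x * ((\<kappa> * \<tau> x u $ 3 * \<tau> x v $ 4 + \<tau> x u $ 4 * \<tau> x v $ 3) * \<tau> x w $ 3
      + \<tau> x v $ 3 * (\<kappa> * \<tau> x u $ 3 * \<tau> x w $ 4 + \<tau> x u $ 4 * \<tau> x w $ 3)))"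
proof -
  have "((\<lambda>y. \<psi> y / \<Xi> y $ 2) has_derivative (\<lambda>u. \<psi>' u / \<Xi> x $ 2)) (at x)"
    using psi' deriv_Xi_nth[OF x, of 2] case2_beta[OF x]
    by (auto intro!: derivative_eq_intros simp: fun_eq_iff Xi'_2[OF x])
  from P_nu[OF x case2_eta this] show ?thesis
    using case2_beta[OF x] by (simp add: field_simps)
qed

text \<open>As \<open>\<theta>\<^sup>4\<close> vanishes on \<open>w\<close> and
  \<open>\<theta>\<^sup>3\<close> on \<open>u\<^sub>4\<close>, the arguments \<open>w\<close>,
  \<open>w\<close>, \<open>u\<^sub>4\<close> leave only \<kappa> \<psi>. With \<open>w\<close> in
  the last two slots the \<kappa>-terms drop out and the differential of \<psi> appears.\<close>

lemma case2_parallel: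
  assumes x: "x \<in> U" and psi': "(\<psi> has_derivative \<psi>') (at x)" and P: "\<And>u v w. P x u v w = 0"
  shows "\<kappa> * \<psi> x = 0" and "\<psi>' u = 2 * \<psi> x * \<tau> x u $ 4"
proof -
  note b = case2_beta[OF x]
  have eps0: "\<epsilon> \<noteq> 0" using eps by auto
  obtain w where w: "\<tau> x w = vec4 0 (\<Xi> x $ 1) (\<Xi> x $ 2) 0" by (rule case2_adapted[OF x])
  obtain v where v: "\<tau> x v = axis 4 1"
    by (rule tangent[OF x, of "axis 4 1"]) (auto simp: frame_form_def axis_def Xi_4[OF x])
  show "\<kappa> * \<psi> x = 0"
    using P[of w w v] b eps0 unfolding case2_P[OF x psi'] by (auto simp: w v axis_def)
  show "\<psi>' u = 2 * \<psi> x * \<tau> x u $ 4"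
    using P[of u w w] b eps0 unfolding case2_P[OF x psi'] by (auto simp: w algebra_simps)
qed

lemma case2_geodesic:
  assumes "x \<in> U" "\<psi> x = 0"
  shows "h x v w = 0"
  by (simp add: h_eta assms Xi_4 case2_eta)

lemma case2_not_geodesic:
  assumes x: "x \<in> U" and "\<psi> x \<noteq> 0"
  shows "\<exists>v w. h x v w \<noteq> 0"
proof -
  obtain w where w: "\<tau> x w = vec4 0 (\<Xi> x $ 1) (\<Xi> x $ 2) 0" by (rule case2_adapted[OF x])
  have "h x w w \<noteq> 0"
    using assms(2) case2_beta[OF x] eps by (auto simp: h_eta[OF x] Xi_4[OF x] case2_eta[OF x] w)
  then show ?thesis by blast
qed

lemma case2_parallel_if_psi_0:
  assumes x: "x \<in> U" and psi0: "\<And>y. y \<in> U \<Longrightarrow> \<psi> y = 0"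
  shows "P x u v w = 0"
proof -
  have "(\<psi> has_derivative (\<lambda>_. 0)) (at x)"
    by (rule has_derivative_transform_within_open[OF has_derivative_const open_U x]) (simp add: psi0)
  from case2_P[OF x this] show ?thesis by (simp add: psi0[OF x])
qed

text \<open>The argument of \<open>case1_parallel_iff\<close>: Codazzi symmetry extends the
  information from the direction \<open>w\<close> to all directions.\<close>

lemma case2_parallel_if_kappa_0:
  assumes x: "x \<in> U" and psi': "(\<psi> has_derivative \<psi>') (at x)" and "\<kappa> = 0"
    and w: "\<tau> x w = vec4 0 (\<Xi> x $ 1) (\<Xi> x $ 2) 0" and 0: "\<psi>' w = 0"
  shows "P x u v v' = 0"
proof -
  note b = case2_beta[OF x]
  have eps0: "\<epsilon> \<noteq> 0" using eps by auto
  have "P x w u w = 0" for u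
    unfolding case2_P[OF x psi'] by (simp add: w 0 \<open>\<kappa> = 0\<close>)
  then have "P x u w w = 0" for u
    using codazzi_symmetric[OF x, of u w w] Xi_4[OF x] by simp
  then have "\<psi>' u = 2 * \<psi> x * \<tau> x u $ 4" for u
    using b eps0 unfolding case2_P[OF x psi'] by (auto simp: w \<open>\<kappa> = 0\<close> algebra_simps)
  then show ?thesis
    unfolding case2_P[OF x psi'] by (simp add: \<open>\<kappa> = 0\<close> algebra_simps)
qed

end

text \<open>Case (3): \<open>\<eta> = 0\<close>.\<close>

lemma case3_eta:
  assumes x: "x \<in> U" and "\<kappa> = 2" "\<Xi> x $ 2 \<noteq> 0" "\<Xi> x $ 4 \<noteq> 0" and P: "\<And>u v w. P x u v w = 0"
  shows "\<eta> x v = 0"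
proof -
  obtain w where w: "\<tau> x w = vec4 0 (d * \<Xi> x $ 4) 0 (- \<Xi> x $ 2)"
    by (rule tangent[OF x, of "vec4 0 (d * \<Xi> x $ 4) 0 (- \<Xi> x $ 2)"])
       (simp_all add: frame_form_def Xi_3[OF x])
  obtain u where u: "\<tau> x u = vec4 0 (\<Xi> x $ 1) (\<Xi> x $ 2) 0"
    by (rule tangent[OF x, of "vec4 0 (\<Xi> x $ 1) (\<Xi> x $ 2) 0"])
       (simp_all add: frame_form_def Xi_3[OF x])
  obtain \<eta>' where "((\<lambda>y. \<eta> y v) has_derivative \<eta>') (at x)" using deriv_eta[OF x] by blast
  from P_eta[OF x this, of u w] show ?thesis
    using P[of u v w] assms(2-4) eps by (auto simp: u w)
qed

lemma case3_alpha:
  assumes x: "x \<in> U" and "\<kappa> = 2" "\<Xi> x $ 2 \<noteq> 0" "\<Xi> x $ 4 \<noteq> 0" and P: "\<And>u v w. P x u v w = 0"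
  shows "\<tau> x u = axis 1 1 \<Longrightarrow> \<Xi>' x u $ 1 = 0"
    and "\<tau> x u = vec4 0 (d * \<Xi> x $ 4) 0 (- \<Xi> x $ 2) \<Longrightarrow> \<Xi>' x u $ 1 + \<Xi> x $ 1 * \<Xi> x $ 2 = 0"
    and "\<tau> x u = vec4 0 (\<Xi> x $ 1) (\<Xi> x $ 2) 0 \<Longrightarrow> \<Xi>' x u $ 1 + \<Xi> x $ 2 * \<Xi> x $ 4 = 0"
  using case3_eta[OF assms, of u] by (auto simp: \<eta>_def axis_def mult.commute)

lemma case3_parallel:
  assumes x: "x \<in> U" and b: "\<And>y. y \<in> U \<Longrightarrow> \<Xi> y $ 2 \<noteq> 0"
    and "\<And>y u. y \<in> U \<Longrightarrow> \<tau> y u = axis 1 1 \<Longrightarrow> \<Xi>' y u $ 1 = 0"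
    and "\<And>y u. y \<in> U \<Longrightarrow> \<tau> y u = vec4 0 (d * \<Xi> y $ 4) 0 (- \<Xi> y $ 2) \<Longrightarrow> \<Xi>' y u $ 1 + \<Xi> y $ 1 * \<Xi> y $ 2 = 0"
    and "\<And>y u. y \<in> U \<Longrightarrow> \<tau> y u = vec4 0 (\<Xi> y $ 1) (\<Xi> y $ 2) 0 \<Longrightarrow> \<Xi>' y u $ 1 + \<Xi> y $ 2 * \<Xi> y $ 4 = 0"
  shows "P x u v w = 0"
proof -
  have eta: "\<eta> y v = 0" if y: "y \<in> U" for y v
    by (rule linear_eq_0_adapted[OF y linear_eta[OF y] Xi_3[OF y] b[OF y]])
       (use assms(3-5)[OF y] in \<open>auto simp: \<eta>_def axis_def mult.commute\<close>)
  have "((\<lambda>y. \<eta> y v) has_derivative (\<lambda>_. 0)) (at x)"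
    by (rule has_derivative_transform_within_open[OF has_derivative_const open_U x]) (simp add: eta)
  from P_eta[OF x this] show ?thesis by (simp add: eta[OF x])
qed

lemma case3_not_geodesic:
  assumes x: "x \<in> U" and "\<kappa> = 2" "\<Xi> x $ 2 \<noteq> 0" "\<Xi> x $ 4 \<noteq> 0"
  shows "\<exists>v w. h x v w \<noteq> 0"
proof -
  obtain w where w: "\<tau> x w = vec4 0 (d * \<Xi> x $ 4) 0 (- \<Xi> x $ 2)"
    by (rule tangent[OF x, of "vec4 0 (d * \<Xi> x $ 4) 0 (- \<Xi> x $ 2)"])
       (simp_all add: frame_form_def Xi_3[OF x])
  have "ip (\<tau> x w) (\<tau> x w) = d * (\<Xi> x $ 2 * \<Xi> x $ 2 + d * \<Xi> x $ 4 * \<Xi> x $ 4)"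
    by (simp add: w frame_form_def algebra_simps)
  then have ip: "ip (\<tau> x w) (\<tau> x w) = d * \<epsilon>" using unit_components[OF x Xi_3[OF x]] by simp
  have "\<tau> x w $ 3 = 0" by (simp add: w)
  then have "h x w w = - 2 * \<Xi> x $ 4 * d"
    unfolding h_eta[OF x] ip using \<open>\<kappa> = 2\<close> by (simp add: mult_ac)
  then have "h x w w \<noteq> 0" using assms(4) d by simp
  then show ?thesis by blast
qed

end

section \<open>Immersions into the group of type A2\<close>

lemma vec4_eq_axis: "vec4 p q r s = p *\<^sub>R axis 1 1 + q *\<^sub>R axis 2 1 + r *\<^sub>R axis 3 1 + s *\<^sub>R axis 4 1"
  by (simp add: vec4_eq_iff axis_def)

lemma has_derivative_vec4:
  assumes "(p has_derivative p') F" "(q has_derivative q') F" "(r has_derivative r') F" "(s has_derivative s') F"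
  shows "((\<lambda>x. vec4 (p x) (q x) (r x) (s x)) has_derivative (\<lambda>v. vec4 (p' v) (q' v) (r' v) (s' v))) F"
  unfolding vec4_eq_axis using assms by (intro has_derivative_add has_derivative_scaleR_left)

text \<open>The dual of \<open>A2_normal_frame\<close>; the subtracted term compensates the
  \<open>u\<^sub>1\<close>-part of the fourth frame field.\<close>

definition A2_normal_coframe :: "real \<Rightarrow> real \<Rightarrow> real \<Rightarrow> real \<Rightarrow> real ^ 4 \<Rightarrow> real ^ 4 \<Rightarrow> real ^ 4" where
  "A2_normal_coframe \<kappa> a b c p v = vec4
     (a / sqrt b * A2_coframe \<kappa> 1 p v - c / sqrt b * A2_coframe \<kappa> 4 p v)
     (sqrt a * A2_coframe \<kappa> 2 p v) (sqrt b * A2_coframe \<kappa> 3 p v) (A2_coframe \<kappa> 4 p v)"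

definition A2_combination :: "real \<Rightarrow> real \<Rightarrow> real \<Rightarrow> real \<Rightarrow> real ^ 4 \<Rightarrow> real ^ 4 \<Rightarrow> real ^ 4" where
  "A2_combination \<kappa> a b c p X = X $ 1 *\<^sub>R A2_normal_frame \<kappa> a b c 1 p + X $ 2 *\<^sub>R A2_normal_frame \<kappa> a b c 2 p
     + X $ 3 *\<^sub>R A2_normal_frame \<kappa> a b c 3 p + X $ 4 *\<^sub>R A2_normal_frame \<kappa> a b c 4 p"

text \<open>The derivative of the components \<open>A2_normal_coframe\<close> of a constant vector field.\<close>

definition coframe_deriv :: "real \<Rightarrow> real \<Rightarrow> real \<Rightarrow> real ^ 4 \<Rightarrow> real ^ 4 \<Rightarrow> real ^ 4" where
  "coframe_deriv \<kappa> b c X Y = vec4 ((\<kappa> + 1) * X $ 4 * (Y $ 1 + c / sqrt b * Y $ 4))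
     (\<kappa> * X $ 4 * Y $ 2) ((\<kappa> - 1) * X $ 4 * Y $ 3) 0"

lemma coframe_deriv_torsion:
  "coframe_deriv \<kappa> b c X Y - coframe_deriv \<kappa> b c Y X = - frame_bracket \<kappa> X Y"
  by (simp add: coframe_deriv_def frame_bracket_def vec4_eq_iff algebra_simps)

lemma bilinear_coframe_deriv: "bilinear (coframe_deriv \<kappa> b c)"
  unfolding bilinear_def linear_iff coframe_deriv_def vec4_eq_iff by (simp add: algebra_simps)

lemma linear_A2_combination: "linear (A2_combination \<kappa> a b c p)"
  unfolding A2_combination_def by (rule linearI) (simp_all add: algebra_simps)

lemma linear_A2_normal_coframe: "linear (A2_normal_coframe \<kappa> a b c p)"
  unfolding A2_normal_coframe_def A2_coframe_def vec4_eq_axis by (rule linearI) (simp_all add: algebra_simps)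

lemma linear_coordinate_sum4:
  fixes l :: "real ^ 4 \<Rightarrow> 'b::real_vector"
  assumes "linear l"
  shows "l v = v $ 1 *\<^sub>R l (axis 1 1) + v $ 2 *\<^sub>R l (axis 2 1) + v $ 3 *\<^sub>R l (axis 3 1) + v $ 4 *\<^sub>R l (axis 4 1)"
proof -
  have "v = vec4 (v $ 1) (v $ 2) (v $ 3) (v $ 4)" by (simp add: vec4_eq_iff)
  then have "l v = l (v $ 1 *\<^sub>R axis 1 1 + v $ 2 *\<^sub>R axis 2 1 + v $ 3 *\<^sub>R axis 3 1 + v $ 4 *\<^sub>R axis 4 1)"
    unfolding vec4_eq_axis by metis
  then show ?thesis by (simp only: linear_add[OF assms] linear_scale[OF assms])
qed

text \<open>Smoothness gives differentiability of the derivative of \<open>k\<close> in a fixed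
  direction only. For the varying direction \<open>Y y\<close> it is expanded in the standard
  basis.\<close>

lemma differentiable_frechet_derivative_along:
  fixes k :: "real ^ 4 \<Rightarrow> real" and f Y :: "'a::real_normed_vector \<Rightarrow> real ^ 4"
  assumes k: "smooth_on M k" and M: "open M" and U: "open U" "x \<in> U" and fM: "f ` U \<subseteq> M"
    and f: "f differentiable (at x)" and Y: "Y differentiable (at x)"
  shows "(\<lambda>y. frechet_derivative k (at (f y)) (Y y)) differentiable (at x)"
proof -
  have diff: "(\<lambda>y. Y y $ i * frechet_derivative k (at (f y)) (axis i 1)) differentiable (at x)" for i
  proof (intro differentiable_mult)
    show "(\<lambda>y. Y y $ i) differentiable (at x)"
      using Y bounded_linear.has_derivative[OF bounded_linear_vec_nth] unfolding differentiable_def by blast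
    have "(\<lambda>p. frechet_derivative k (at p) (axis i 1)) differentiable (at (f x))"
      using smooth_on_has_derivative[OF smooth_on_frechet_derivative[OF k], of "f x"] fM U(2)
      unfolding differentiable_def by blast
    then show "(\<lambda>y. frechet_derivative k (at (f y)) (axis i 1)) differentiable (at x)"
      using f by (rule differentiable_compose)
  qed
  have "(\<lambda>y. Y y $ 1 * frechet_derivative k (at (f y)) (axis 1 1) + Y y $ 2 * frechet_derivative k (at (f y)) (axis 2 1)
    + Y y $ 3 * frechet_derivative k (at (f y)) (axis 3 1) + Y y $ 4 * frechet_derivative k (at (f y)) (axis 4 1))
    differentiable (at x)"
    by (intro differentiable_add diff)
  then obtain D where D: "((\<lambda>y. Y y $ 1 * frechet_derivative k (at (f y)) (axis 1 1) + Y y $ 2 * frechet_derivative k (at (f y)) (axis 2 1)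
    + Y y $ 3 * frechet_derivative k (at (f y)) (axis 3 1) + Y y $ 4 * frechet_derivative k (at (f y)) (axis 4 1))
    has_derivative D) (at x)" unfolding differentiable_def by blast
  have "((\<lambda>y. frechet_derivative k (at (f y)) (Y y)) has_derivative D) (at x)"
  proof (rule has_derivative_transform_within_open[OF D U])
    fix y assume "y \<in> U"
    then have "linear (frechet_derivative k (at (f y)))"
      using fM by (intro has_derivative_linear[OF smooth_on_has_derivative[OF k]]) blast
    from linear_coordinate_sum4[OF this, of "Y y"]
    show "Y y $ 1 * frechet_derivative k (at (f y)) (axis 1 1) + Y y $ 2 * frechet_derivative k (at (f y)) (axis 2 1)
      + Y y $ 3 * frechet_derivative k (at (f y)) (axis 3 1) + Y y $ 4 * frechet_derivative k (at (f y)) (axis 4 1)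
      = frechet_derivative k (at (f y)) (Y y)" by simp
  qed
  then show ?thesis unfolding differentiable_def by blast
qed

section \<open>The normalized coframe and the Levi-Civita connection of the group\<close>

locale A2_parameters =
  fixes \<kappa> a b c :: real
  assumes a: "a > 0" and b: "b > 0"
begin

abbreviation "\<theta> \<equiv> A2_normal_coframe \<kappa> a b c"
abbreviation "E \<equiv> A2_combination \<kappa> a b c"

lemma coframe_combination: "\<theta> p (E p X) = X"
proof -
  have "sqrt a \<noteq> 0" "sqrt b \<noteq> 0" using a b by auto
  then show ?thesis
    using a b
    by (simp add: vec4_eq_iff A2_normal_coframe_def A2_combination_def A2_normal_frame_def A2_frame_eq
        A2_coframe_def axis_def field_simps flip: exp_add)
qed

lemma combination_coframe: "E p (\<theta> p v) = v"
proof -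
  have "sqrt a \<noteq> 0" "sqrt b \<noteq> 0" using a b by auto
  then show ?thesis
    using a b
    by (simp add: vec4_eq_iff A2_normal_coframe_def A2_combination_def A2_normal_frame_def A2_frame_eq
        A2_coframe_def axis_def field_simps)
       (simp flip: exp_add)
qed

lemma coframe_inject: "\<theta> p v = \<theta> p w \<longleftrightarrow> v = w"
  by (metis combination_coframe)

text \<open>This is the normalization: \<open>a\<close>, \<open>b\<close>, \<open>c\<close> are
  absorbed into the coframe and no longer enter the metric in components.\<close>

lemma A2_metric_eq: "A2_metric \<kappa> a b c d p v w = frame_form d (\<theta> p v) (\<theta> p w)"
proof -
  define s where "s = sqrt b"
  define t where "t = sqrt a"
  have s: "b = s * s" "s \<noteq> 0" using b by (auto simp: s_def)
  have t: "a = t * t" "t \<noteq> 0" using a by (auto simp: t_def)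
  show ?thesis
    unfolding A2_metric_def Let_def sym_prod_def frame_form_def A2_normal_coframe_def vec4_nth
      s_def[symmetric] t_def[symmetric]
    using s(2) by (simp add: s(1) t(1) field_simps)
qed

lemma has_derivative_A2_coframe:
  assumes "(f has_derivative f') (at x)" "(Y has_derivative Y') (at x)"
  shows "((\<lambda>y. A2_coframe \<kappa> i (f y) (Y y)) has_derivative
    (\<lambda>u. A2_weight \<kappa> i * f' u $ 4 * A2_coframe \<kappa> i (f x) (Y x) + A2_coframe \<kappa> i (f x) (Y' u))) (at x)"
proof -
  note nth = bounded_linear.has_derivative[OF bounded_linear_vec_nth]
  have "((\<lambda>y. exp (A2_weight \<kappa> i * f y $ 4)) has_derivative
      (\<lambda>u. exp (A2_weight \<kappa> i * f x $ 4) * (A2_weight \<kappa> i * f' u $ 4))) (at x)"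
    using nth[OF assms(1), of 4] by (auto intro!: derivative_eq_intros)
  from has_derivative_mult[OF this nth[OF assms(2), of i]] show ?thesis
    unfolding A2_coframe_def by (rule has_derivative_eq_rhs) (simp add: fun_eq_iff algebra_simps)
qed

text \<open>Only the first three left-invariant forms carry exponential factors. The first
  normalized form also contains the fourth one; adding back \<open>c / sqrt b\<close> times it, as
  \<open>coframe_deriv\<close> does, recovers the part of weight \<kappa> + 1.\<close>

lemma has_derivative_normal_coframe:
  assumes "(f has_derivative f') (at x)" "(Y has_derivative Y') (at x)"
  shows "((\<lambda>y. \<theta> (f y) (Y y)) has_derivative
    (\<lambda>u. coframe_deriv \<kappa> b c (\<theta> (f x) (f' u)) (\<theta> (f x) (Y x)) + \<theta> (f x) (Y' u))) (at x)"
  unfolding A2_normal_coframe_def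
proof (rule has_derivative_eq_rhs,
    (rule has_derivative_vec4 has_derivative_diff has_derivative_mult_right has_derivative_A2_coframe assms)+)
qed (simp add: fun_eq_iff vec4_eq_iff coframe_deriv_def A2_coframe_def algebra_simps add_divide_distrib)

lemma frame_deriv_sum_commute:
  "frame_conn \<kappa> d X Y + coframe_deriv \<kappa> b c X Y = frame_conn \<kappa> d Y X + coframe_deriv \<kappa> b c Y X"
  using frame_conn_torsion[of \<kappa> d X Y] coframe_deriv_torsion[of \<kappa> b c X Y] by (simp add: algebra_simps)

text \<open>A constant coordinate field has varying frame components; \<open>coframe_deriv\<close>
  is their derivative, to which \<open>frame_conn\<close> is added.\<close>

lemma christoffel_map_A2:
  assumes d: "d \<noteq> 0"
  shows "\<theta> p (christoffel_map (A2_metric \<kappa> a b c d) p v w) =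
    frame_conn \<kappa> d (\<theta> p v) (\<theta> p w) + coframe_deriv \<kappa> b c (\<theta> p v) (\<theta> p w)"
proof -
  define Z where "Z v w = E p (frame_conn \<kappa> d (\<theta> p v) (\<theta> p w) + coframe_deriv \<kappa> b c (\<theta> p v) (\<theta> p w))" for v w
  note lin\<theta> = linear_A2_normal_coframe[of \<kappa> a b c p] and linE = linear_A2_combination[of \<kappa> a b c p]
  have "christoffel_map (A2_metric \<kappa> a b c d) p v w = Z v w"
  proof (rule christoffel_map_unique)
    have "A2_metric \<kappa> a b c d p = (\<lambda>v w. frame_form d (\<theta> p v) (\<theta> p w))"
      using A2_metric_eq by blast
    then show "bilinear (A2_metric \<kappa> a b c d p)"
      unfolding bilinear_def
      by (auto intro!: linearI simp: linear_add[OF lin\<theta>] linear_scale[OF lin\<theta>]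
          frame_form.add_left frame_form.scaleR_left frame_form.add_right frame_form.scaleR_right)
    show "A2_metric \<kappa> a b c d p v w = A2_metric \<kappa> a b c d p w v" for v w
      by (simp add: A2_metric_eq frame_form_commute)
    show "v = 0" if v: "\<And>w. A2_metric \<kappa> a b c d p v w = 0" for v
    proof -
      have "\<theta> p v = 0"
        by (rule frame_form_nondegenerate[OF d]) (metis A2_metric_eq coframe_combination v)
      then show ?thesis using coframe_inject[of p v 0] linear_0[OF lin\<theta>] by simp
    qed
    show "((\<lambda>y. A2_metric \<kappa> a b c d y v w) has_derivative
        (\<lambda>u. A2_metric \<kappa> a b c d p (Z u v) w + A2_metric \<kappa> a b c d p v (Z u w))) (at p)" for v w
    proof -
      have D: "((\<lambda>y. \<theta> y v) has_derivative (\<lambda>u. coframe_deriv \<kappa> b c (\<theta> p u) (\<theta> p v))) (at p)" for v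
        using has_derivative_normal_coframe[OF has_derivative_ident has_derivative_const, of v p]
        by (simp add: linear_0[OF lin\<theta>])
      show ?thesis
        unfolding A2_metric_eq
      proof (rule has_derivative_eq_rhs[OF frame_form.FDERIV[OF D D]], rule ext)
        fix u
        show "frame_form d (\<theta> p v) (coframe_deriv \<kappa> b c (\<theta> p u) (\<theta> p w))
            + frame_form d (coframe_deriv \<kappa> b c (\<theta> p u) (\<theta> p v)) (\<theta> p w)
          = frame_form d (\<theta> p (Z u v)) (\<theta> p w) + frame_form d (\<theta> p v) (\<theta> p (Z u w))"
          using frame_conn_metric[OF d, of \<kappa> "\<theta> p u" "\<theta> p v" "\<theta> p w"]
          by (simp add: Z_def coframe_combination frame_form.add_left frame_form.add_right)
      qed
    qed
    show "bilinear Z"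
      unfolding bilinear_def Z_def
      by (intro conjI allI linearI)
         (simp_all add: linear_add[OF lin\<theta>] linear_scale[OF lin\<theta>] linear_add[OF linE] linear_scale[OF linE]
           frame_conn.add_left frame_conn.add_right frame_conn.scaleR_left frame_conn.scaleR_right
           bilinear_ladd[OF bilinear_coframe_deriv] bilinear_radd[OF bilinear_coframe_deriv]
           bilinear_lmul[OF bilinear_coframe_deriv] bilinear_rmul[OF bilinear_coframe_deriv] scaleR_add_right)
    show "Z v w = Z w v" for v w
      unfolding Z_def by (simp only: frame_deriv_sum_commute)
  qed
  then show ?thesis by (simp add: Z_def coframe_combination)
qed

end

section \<open>A single parametrized piece of the hypersurface\<close>

locale A2_immersion = A2_parameters \<kappa> a b c
  for \<kappa> a b c :: real +
  fixes d \<epsilon> :: real and U :: "(real ^ 3) set" and M :: "(real ^ 4) set"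
    and f :: "real ^ 3 \<Rightarrow> real ^ 4" and \<alpha> \<beta> \<gamma> \<delta> :: "real ^ 4 \<Rightarrow> real"
  assumes d: "d \<noteq> 0" and eps: "\<epsilon> = 1 \<or> \<epsilon> = - 1"
    and U: "open U" and M: "open M" and fM: "f ` U \<subseteq> M"
    and f: "smooth_on U f" and inj_f: "x \<in> U \<Longrightarrow> inj (frechet_derivative f (at x))"
    and \<alpha>: "smooth_on M \<alpha>" and \<beta>: "smooth_on M \<beta>" and \<gamma>: "smooth_on M \<gamma>" and \<delta>: "smooth_on M \<delta>"
    and normal_f: "x \<in> U \<Longrightarrow> frame_form d (A2_normal_coframe \<kappa> a b c (f x) (frechet_derivative f (at x) v))
      (vec4 (\<alpha> (f x)) (\<beta> (f x)) (\<gamma> (f x)) (\<delta> (f x))) = 0"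
    and unit_f: "x \<in> U \<Longrightarrow> frame_form d (vec4 (\<alpha> (f x)) (\<beta> (f x)) (\<gamma> (f x)) (\<delta> (f x)))
      (vec4 (\<alpha> (f x)) (\<beta> (f x)) (\<gamma> (f x)) (\<delta> (f x))) = \<epsilon>"
begin

abbreviation "g \<equiv> A2_metric \<kappa> a b c d"
abbreviation "Df x \<equiv> frechet_derivative f (at x)"
abbreviation "D2f x u v \<equiv> frechet_derivative (\<lambda>y. Df y v) (at x) u"

definition \<xi> where "\<xi> p = A2_combination \<kappa> a b c p (vec4 (\<alpha> p) (\<beta> p) (\<gamma> p) (\<delta> p))"
definition \<tau> where "\<tau> x v = \<theta> (f x) (Df x v)"
definition \<tau>' where "\<tau>' x u v = coframe_deriv \<kappa> b c (\<tau> x u) (\<tau> x v) + \<theta> (f x) (D2f x u v)"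
definition \<Xi> where "\<Xi> x = vec4 (\<alpha> (f x)) (\<beta> (f x)) (\<gamma> (f x)) (\<delta> (f x))"
definition \<Xi>' where "\<Xi>' x v = vec4 (frechet_derivative \<alpha> (at (f x)) (Df x v))
  (frechet_derivative \<beta> (at (f x)) (Df x v)) (frechet_derivative \<gamma> (at (f x)) (Df x v))
  (frechet_derivative \<delta> (at (f x)) (Df x v))"
definition \<Xi>'' where "\<Xi>'' x u v = frechet_derivative (\<lambda>y. \<Xi>' y v) (at x) u"

lemma deriv_f: "x \<in> U \<Longrightarrow> (f has_derivative Df x) (at x)"
  by (rule smooth_on_has_derivative[OF f])

lemma deriv_Df: "x \<in> U \<Longrightarrow> ((\<lambda>y. Df y v) has_derivative (\<lambda>u. D2f x u v)) (at x)"
  by (rule smooth_on_has_derivative[OF smooth_on_frechet_derivative[OF f]])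

lemma D2f_commute: assumes x: "x \<in> U" shows "D2f x u v = D2f x v u"
  by (rule second_derivative_symmetric[OF U x deriv_f deriv_Df[OF x]])

lemma deriv_along:
  assumes "smooth_on M k" "x \<in> U"
  shows "((\<lambda>y. k (f y)) has_derivative (\<lambda>u. frechet_derivative k (at (f x)) (Df x u))) (at x)"
  using assms fM
  by (intro has_derivative_compose[OF deriv_f] smooth_on_has_derivative[OF assms(1)]) auto

lemma deriv_Xi: "x \<in> U \<Longrightarrow> (\<Xi> has_derivative \<Xi>' x) (at x)"
  unfolding \<Xi>_def[abs_def] \<Xi>'_def[abs_def]
  by (intro has_derivative_vec4 deriv_along \<alpha> \<beta> \<gamma> \<delta>)

lemma deriv_Xi':
  assumes x: "x \<in> U"
  shows "((\<lambda>y. \<Xi>' y v) has_derivative (\<lambda>u. \<Xi>'' x u v)) (at x)"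
proof -
  have "(\<lambda>y. frechet_derivative k (at (f y)) (Df y v)) differentiable (at x)" if "smooth_on M k"
    for k :: "real ^ 4 \<Rightarrow> real"
    using deriv_f[OF x] deriv_Df[OF x, of v]
    by (intro differentiable_frechet_derivative_along[OF that M U x fM]) (auto simp: differentiable_def)
  from this[OF \<alpha>] this[OF \<beta>] this[OF \<gamma>] this[OF \<delta>]
  have "(\<lambda>y. \<Xi>' y v) differentiable (at x)"
    unfolding \<Xi>'_def differentiable_def by (elim exE) (rule exI, rule has_derivative_vec4)
  then show ?thesis unfolding \<Xi>''_def by (simp flip: frechet_derivative_works)
qed

lemma linear_Df: "x \<in> U \<Longrightarrow> linear (Df x)"
  by (rule has_derivative_linear[OF deriv_f])

lemma linear_tau_f: "x \<in> U \<Longrightarrow> linear (\<tau> x)"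
  unfolding \<tau>_def[abs_def]
  using linear_compose[OF linear_Df linear_A2_normal_coframe] by (simp add: o_def)

lemma inj_tau_f: "x \<in> U \<Longrightarrow> inj (\<tau> x)"
  unfolding \<tau>_def[abs_def]
  by (rule injI, rule injD[OF inj_f], assumption, rule coframe_inject[THEN iffD1])

lemma deriv_tau_f: "x \<in> U \<Longrightarrow> ((\<lambda>y. \<tau> y v) has_derivative (\<lambda>u. \<tau>' x u v)) (at x)"
  unfolding \<tau>_def \<tau>'_def by (rule has_derivative_normal_coframe[OF deriv_f deriv_Df])

lemma torsion_f: "x \<in> U \<Longrightarrow> \<tau>' x u v - \<tau>' x v u = - frame_bracket \<kappa> (\<tau> x u) (\<tau> x v)"
  unfolding \<tau>'_def D2f_commute[of x u v]
  using coframe_deriv_torsion[of \<kappa> b c "\<tau> x u" "\<tau> x v"] by simp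

lemma Xi''_commute: "x \<in> U \<Longrightarrow> \<Xi>'' x u v = \<Xi>'' x v u"
  by (rule second_derivative_symmetric[OF U _ deriv_Xi deriv_Xi'])

sublocale frame_hypersurface \<kappa> d \<epsilon> U \<tau> \<tau>' \<Xi> \<Xi>' \<Xi>''
proof (rule frame_hypersurface.intro)
  show "frame_form d (\<tau> x v) (\<Xi> x) = 0" if "x \<in> U" for x v
    unfolding \<tau>_def \<Xi>_def by (rule normal_f[OF that])
  show "frame_form d (\<Xi> x) (\<Xi> x) = \<epsilon>" if "x \<in> U" for x
    unfolding \<Xi>_def by (rule unit_f[OF that])
qed (rule U d eps linear_tau_f inj_tau_f deriv_tau_f torsion_f deriv_Xi deriv_Xi' Xi''_commute; assumption)+

lemma coframe_xi: "\<theta> (f x) (\<xi> (f x)) = \<Xi> x"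
  by (simp add: \<xi>_def \<Xi>_def coframe_combination)

lemma pullback_eq: "pullback_metric g f y v w = frame_form d (\<tau> y v) (\<tau> y w)"
  by (simp add: pullback_metric_def A2_metric_eq \<tau>_def)

lemma christoffel_map_pullback_f: "x \<in> U \<Longrightarrow> christoffel_map (pullback_metric g f) x v w = \<Gamma> x v w"
  by (rule christoffel_map_pullback, assumption, rule pullback_eq)

lemma coframe_cov_deriv:
  assumes x: "x \<in> U"
  shows "\<theta> (f x) (cov_deriv_along g f (\<lambda>y. Df y w) x v) = T x v w"
  by (simp add: cov_deriv_along_def linear_add[OF linear_A2_normal_coframe] christoffel_map_A2[OF d]
      T_def \<tau>'_def \<tau>_def)

lemma second_fundamental_form_eq:
  assumes x: "x \<in> U"
  shows "second_fundamental_form g \<xi> f x v w = h x v w"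
  unfolding second_fundamental_form_def christoffel_map_pullback_f[OF x]
proof (rule the_equality)
  note lin = linear_A2_normal_coframe[of \<kappa> a b c "f x"]
  have *: "cov_deriv_along g f (\<lambda>y. Df y w) x v = Df x (\<Gamma> x v w) + r *\<^sub>R \<xi> (f x) \<longleftrightarrow>
      T x v w = T x v w - h x v w *\<^sub>R \<Xi> x + r *\<^sub>R \<Xi> x" for r
    using tau_Gamma[OF x, of v w]
    by (subst coframe_inject[of "f x", symmetric])
       (simp add: linear_add[OF lin] linear_scale[OF lin] coframe_xi coframe_cov_deriv[OF x] \<tau>_def h_eq[OF x])
  show "cov_deriv_along g f (\<lambda>y. Df y w) x v = Df x (\<Gamma> x v w) + h x v w *\<^sub>R \<xi> (f x)"
    by (simp add: *)
  \<comment> \<open>A nonzero normal makes the coefficient in the Gauss formula unique, as the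
    definite description demands.\<close>
  have "\<Xi> x \<noteq> 0" using unit[OF x] eps by (auto simp: frame_form.zero_left)
  then show "r = h x v w"
    if "cov_deriv_along g f (\<lambda>y. Df y w) x v = Df x (\<Gamma> x v w) + r *\<^sub>R \<xi> (f x)" for r
    using that unfolding * by (simp add: algebra_simps)
qed

lemma cov_deriv_form_eq:
  assumes x: "x \<in> U"
  shows "cov_deriv_form (pullback_metric g f) (second_fundamental_form g \<xi> f) x u v w = P x u v w"
proof -
  have "((\<lambda>y. second_fundamental_form g \<xi> f y v w) has_derivative
    (\<lambda>u. - \<epsilon> * (ip (\<tau>' x u w) (N x v) + ip (\<tau> x w) (N' x u v)))) (at x)"
    by (rule has_derivative_transform_within_open[OF deriv_h[OF x] U x])
       (simp add: second_fundamental_form_eq)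
  from frechet_derivative_at[OF this, symmetric] show ?thesis
    by (simp add: cov_deriv_form_def christoffel_map_pullback_f[OF x] second_fundamental_form_eq[OF x] P_def)
qed

lemma tau_eq_iff: "\<tau> x v = X \<longleftrightarrow> Df x v = A2_combination \<kappa> a b c (f x) X"
  unfolding \<tau>_def by (metis coframe_combination combination_coframe)

lemma Xi_components [simp]:
  "\<Xi> x $ 1 = \<alpha> (f x)" "\<Xi> x $ 2 = \<beta> (f x)" "\<Xi> x $ 3 = \<gamma> (f x)" "\<Xi> x $ 4 = \<delta> (f x)"
  by (simp_all add: \<Xi>_def)

lemma Xi'_components:
  assumes "\<tau> x v = X" and "V (f x) = A2_combination \<kappa> a b c (f x) X"
  shows "\<Xi>' x v $ 1 = dir_deriv V \<alpha> (f x)" "\<Xi>' x v $ 2 = dir_deriv V \<beta> (f x)"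
    "\<Xi>' x v $ 3 = dir_deriv V \<gamma> (f x)" "\<Xi>' x v $ 4 = dir_deriv V \<delta> (f x)"
  using assms by (simp_all add: \<Xi>'_def dir_deriv_def tau_eq_iff)

end

section \<open>The three cases expressed by ambient functions in one chart\<close>

lemma differentiable_A2_normal_frame: "A2_normal_frame \<kappa> a b c i differentiable (at p)"
proof -
  have F: "(\<lambda>q. A2_frame \<kappa> j q) differentiable (at p)" for j
    using A2_frame_has_derivative unfolding differentiable_def by blast
  have S: "(\<lambda>q. r *\<^sub>R A2_frame \<kappa> j q) differentiable (at p)" for r j
    by (intro differentiable_scaleR F differentiable_const)
  show ?thesis
    unfolding A2_normal_frame_def[abs_def]
    by (cases "i = 1"; cases "i = 2"; cases "i = 3") (auto intro!: S F differentiable_add)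
qed

context A2_immersion
begin

abbreviation "fr \<equiv> A2_normal_frame \<kappa> a b c"

definition V3 where "V3 p = (d * \<delta> p) *\<^sub>R fr 3 p + \<alpha> p *\<^sub>R fr 4 p"
definition W2 where "W2 p = \<alpha> p *\<^sub>R fr 2 p + \<beta> p *\<^sub>R fr 3 p"
definition Z2 where "Z2 p = (d * \<delta> p) *\<^sub>R fr 2 p - \<beta> p *\<^sub>R fr 4 p"
definition \<phi> where "\<phi> p = (\<alpha> p)\<^sup>2 - \<epsilon> - dir_deriv V3 \<alpha> p"
definition \<psi> where "\<psi> = dir_deriv W2 \<alpha>"

lemma frame_combinations:
  "fr 1 p = A2_combination \<kappa> a b c p (axis 1 1)" "fr 2 p = A2_combination \<kappa> a b c p (axis 2 1)"
  "fr 4 p = A2_combination \<kappa> a b c p (axis 4 1)"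
  "V3 p = A2_combination \<kappa> a b c p (vec4 0 0 (d * \<delta> p) (\<alpha> p))"
  "W2 p = A2_combination \<kappa> a b c p (vec4 0 (\<alpha> p) (\<beta> p) 0)"
  "Z2 p = A2_combination \<kappa> a b c p (vec4 0 (d * \<delta> p) 0 (- \<beta> p))"
  by (simp_all add: A2_combination_def axis_def V3_def W2_def Z2_def)

lemma fx_in_M: "x \<in> U \<Longrightarrow> f x \<in> M"
  using fM by blast

lemma smooth_differentiable: "smooth_on M k \<Longrightarrow> p \<in> M \<Longrightarrow> k differentiable (at p)"
  using smooth_on_has_derivative unfolding differentiable_def by blast

lemma differentiable_dir_deriv:
  fixes k :: "real ^ 4 \<Rightarrow> real"
  assumes "smooth_on M k" "V differentiable (at p)" "p \<in> M"
  shows "dir_deriv V k differentiable (at p)"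
  unfolding dir_deriv_def[abs_def]
  by (rule differentiable_frechet_derivative_along[OF assms(1) M M assms(3)])
     (use assms(2) in auto)

lemma differentiable_phi: assumes "p \<in> M" shows "\<phi> differentiable (at p)"
proof -
  have "V3 differentiable (at p)"
    unfolding V3_def[abs_def]
    by (intro differentiable_add differentiable_scaleR differentiable_mult differentiable_const
        smooth_differentiable[OF \<delta> assms] smooth_differentiable[OF \<alpha> assms] differentiable_A2_normal_frame)
  then show ?thesis
    unfolding \<phi>_def[abs_def]
    by (intro differentiable_diff differentiable_power differentiable_const smooth_differentiable[OF \<alpha> assms]
        differentiable_dir_deriv[OF \<alpha> _ assms])
qed

lemma differentiable_psi: assumes "p \<in> M" shows "\<psi> differentiable (at p)"
proof -
  have "W2 differentiable (at p)"
    unfolding W2_def[abs_def]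
    by (intro differentiable_add differentiable_scaleR
        smooth_differentiable[OF \<beta> assms] smooth_differentiable[OF \<alpha> assms] differentiable_A2_normal_frame)
  then show ?thesis
    unfolding \<psi>_def by (intro differentiable_dir_deriv[OF \<alpha> _ assms])
qed

lemma has_derivative_along:
  assumes "x \<in> U" "k differentiable (at (f x))"
  shows "((\<lambda>y. k (f y)) has_derivative (\<lambda>u. frechet_derivative k (at (f x)) (Df x u))) (at x)"
  using assms by (intro has_derivative_compose[OF deriv_f]) (auto simp flip: frechet_derivative_works)

lemma frechet_derivative_tau:
  assumes "\<tau> x v = X" and "V (f x) = A2_combination \<kappa> a b c (f x) X"
  shows "frechet_derivative k (at (f x)) (Df x v) = dir_deriv V k (f x)"
  using assms by (simp add: dir_deriv_def tau_eq_iff)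

text \<open>\<open>V3\<close> is tangent here, so it is the image of a parameter vector
  \<open>w\<close>. Hence the ambient \<phi>, restricted to the hypersurface, is the function
  required by the abstract case (1), and \<open>V3(\<phi>)\<close> is its derivative along
  \<open>w\<close>.\<close>

lemma case1_chart:
  assumes shape: "\<And>x. x \<in> U \<Longrightarrow> \<beta> (f x) = 0 \<and> \<gamma> (f x) = 0 \<and> d * (\<delta> (f x))\<^sup>2 = \<epsilon>" and x: "x \<in> U"
  shows "dir_deriv (fr 1) \<alpha> (f x) = 0" "dir_deriv (fr 2) \<alpha> (f x) = 0"
    and "(\<forall>u v w. P x u v w = 0) \<longleftrightarrow> dir_deriv V3 \<phi> (f x) = 2 * (\<kappa> + 1) * \<alpha> (f x) * \<phi> (f x)"
    and "(\<forall>v w. h x v w = 0) \<longleftrightarrow> \<kappa> = 0 \<and> \<phi> (f x) = 0"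
proof -
  have \<Xi>2: "\<Xi> y $ 2 = 0" and \<Xi>3: "\<Xi> y $ 3 = 0" if "y \<in> U" for y using shape[OF that] by simp_all
  have sq: "(\<Xi> y $ 4)\<^sup>2 = \<epsilon> / d" if "y \<in> U" for y using shape[OF that] d by (simp add: field_simps)
  have ne: "\<Xi> y $ 4 \<noteq> 0" if "y \<in> U" for y using shape[OF that] eps by auto
  interpret null_tangent_hypersurface \<kappa> d \<epsilon> U \<tau> \<tau>' \<Xi> \<Xi>' \<Xi>''
  proof unfold_locales
    show "\<Xi> y $ 3 = 0" if "y \<in> U" for y by (rule \<Xi>3[OF that])
    show "\<Xi>' y v $ 2 = 0" if "y \<in> U" for y v by (rule Xi'_nth_eq_0[OF that \<Xi>2])
    show "\<Xi>' y v $ 4 = 0" if "y \<in> U" for y v by (rule Xi'_eq_0_of_square[OF that sq ne[OF that]])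
  qed
  have phi: "\<phi> (f y) = (\<Xi> y $ 1)\<^sup>2 - \<epsilon> - \<Xi>' y w $ 1"
    if "y \<in> U" "\<tau> y w = vec4 0 0 (d * \<Xi> y $ 4) (\<Xi> y $ 1)" for y w
    using Xi'_components(1)[of y w "vec4 0 0 (d * \<Xi> y $ 4) (\<Xi> y $ 1)" V3] that
    by (simp add: \<phi>_def frame_combinations)
  note D = has_derivative_along[OF x differentiable_phi[OF fx_in_M[OF x]]]
  obtain w where w: "\<tau> x w = vec4 0 0 (d * \<Xi> x $ 4) (\<Xi> x $ 1)"
    using case1_adapted[OF \<Xi>2 phi x] by metis
  have "frechet_derivative \<phi> (at (f x)) (Df x w) = dir_deriv V3 \<phi> (f x)"
    by (rule frechet_derivative_tau[OF w]) (simp add: frame_combinations)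
  then show "(\<forall>u v w. P x u v w = 0) \<longleftrightarrow> dir_deriv V3 \<phi> (f x) = 2 * (\<kappa> + 1) * \<alpha> (f x) * \<phi> (f x)"
    using case1_parallel_iff[OF \<Xi>2 phi x D w] by simp
  show "(\<forall>v w. h x v w = 0) \<longleftrightarrow> \<kappa> = 0 \<and> \<phi> (f x) = 0"
    by (rule case1_geodesic_iff[OF \<Xi>2 phi x])
  obtain u where u: "\<tau> x u = axis 1 1"
    by (rule tangent[OF x, of "axis 1 1"]) (auto simp: frame_form_def axis_def \<Xi>3[OF x, simplified])
  show "dir_deriv (fr 1) \<alpha> (f x) = 0"
    using case1_alpha[OF \<Xi>2 phi x, of u] u Xi'_components(1)[OF u, of "fr 1"] by (simp add: frame_combinations)
  obtain v where v: "\<tau> x v = axis 2 1"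
    by (rule tangent[OF x, of "axis 2 1"]) (auto simp: frame_form_def axis_def \<Xi>2[OF x, simplified])
  show "dir_deriv (fr 2) \<alpha> (f x) = 0"
    using case1_alpha[OF \<Xi>2 phi x, of v] v Xi'_components(1)[OF v, of "fr 2"] by (simp add: frame_combinations)
qed

lemma case2_chart:
  assumes shape: "\<And>x. x \<in> U \<Longrightarrow> \<gamma> (f x) = 0 \<and> \<delta> (f x) = 0 \<and> (\<beta> (f x))\<^sup>2 = \<epsilon>" and x: "x \<in> U"
  shows "dir_deriv (fr 1) \<alpha> (f x) = 0" "dir_deriv (fr 4) \<alpha> (f x) = \<alpha> (f x)"
    and "\<And>u. (\<And>u v w. P x u v w = 0) \<Longrightarrow> \<kappa> * \<psi> (f x) = 0 \<and> dir_deriv W2 \<psi> (f x) = 0 \<and>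
        frechet_derivative \<psi> (at (f x)) (Df x u) = 2 * \<psi> (f x) * Df x u $ 4"
    and "\<And>u v w. (\<And>y. y \<in> U \<Longrightarrow> \<psi> (f y) = 0) \<Longrightarrow> P x u v w = 0"
    and "\<And>u v w. \<kappa> = 0 \<Longrightarrow> dir_deriv W2 \<psi> (f x) = 0 \<Longrightarrow> P x u v w = 0"
    and "(\<forall>v w. h x v w = 0) \<longleftrightarrow> \<psi> (f x) = 0"
proof -
  have \<Xi>4: "\<Xi> y $ 4 = 0" and \<Xi>3: "\<Xi> y $ 3 = 0" if "y \<in> U" for y using shape[OF that] by simp_all
  have sq: "(\<Xi> y $ 2)\<^sup>2 = \<epsilon>" if "y \<in> U" for y using shape[OF that] by simp
  have ne: "\<Xi> y $ 2 \<noteq> 0" if "y \<in> U" for y using shape[OF that] eps by auto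
  interpret null_tangent_hypersurface \<kappa> d \<epsilon> U \<tau> \<tau>' \<Xi> \<Xi>' \<Xi>''
  proof unfold_locales
    show "\<Xi> y $ 3 = 0" if "y \<in> U" for y by (rule \<Xi>3[OF that])
    show "\<Xi>' y v $ 4 = 0" if "y \<in> U" for y v by (rule Xi'_nth_eq_0[OF that \<Xi>4])
    show "\<Xi>' y v $ 2 = 0" if "y \<in> U" for y v by (rule Xi'_eq_0_of_square[OF that sq ne[OF that]])
  qed
  have psi: "\<psi> (f y) = \<Xi>' y w $ 1"
    if "y \<in> U" "\<tau> y w = vec4 0 (\<Xi> y $ 1) (\<Xi> y $ 2) 0" for y w
    using Xi'_components(1)[of y w "vec4 0 (\<Xi> y $ 1) (\<Xi> y $ 2) 0" W2] that
    by (simp add: \<psi>_def frame_combinations)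
  note D = has_derivative_along[OF x differentiable_psi[OF fx_in_M[OF x]]]
  obtain w where w: "\<tau> x w = vec4 0 (\<Xi> x $ 1) (\<Xi> x $ 2) 0"
    using case2_adapted[OF \<Xi>4 psi x] by metis
  have Dw: "frechet_derivative \<psi> (at (f x)) (Df x w) = dir_deriv W2 \<psi> (f x)"
    by (rule frechet_derivative_tau[OF w]) (simp add: frame_combinations)
  have tau4: "\<tau> x u $ 4 = Df x u $ 4" for u
    by (simp add: \<tau>_def A2_normal_coframe_def A2_coframe_def)
  show "\<kappa> * \<psi> (f x) = 0 \<and> dir_deriv W2 \<psi> (f x) = 0 \<and>
      frechet_derivative \<psi> (at (f x)) (Df x u) = 2 * \<psi> (f x) * Df x u $ 4"
    if P: "\<And>u v w. P x u v w = 0" for u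
  proof -
    note par = case2_parallel[OF \<Xi>4 psi x D P]
    have "dir_deriv W2 \<psi> (f x) = 0" using par(2)[of w] Dw by (simp add: w)
    then show ?thesis using par(1) par(2)[of u] by (simp add: tau4)
  qed
  show "P x u v w = 0" if "\<And>y. y \<in> U \<Longrightarrow> \<psi> (f y) = 0" for u v w
    by (rule case2_parallel_if_psi_0[OF \<Xi>4 psi x that])
  show "P x u v v' = 0" if "\<kappa> = 0" "dir_deriv W2 \<psi> (f x) = 0" for u v v'
    by (rule case2_parallel_if_kappa_0[OF \<Xi>4 psi x D that(1) w]) (simp_all only: Dw that(2))
  show "(\<forall>v w. h x v w = 0) \<longleftrightarrow> \<psi> (f x) = 0"
    using case2_geodesic[OF \<Xi>4 psi x] case2_not_geodesic[OF \<Xi>4 psi x] by blast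
  obtain u where u: "\<tau> x u = axis 1 1"
    by (rule tangent[OF x, of "axis 1 1"]) (auto simp: frame_form_def axis_def \<Xi>3[OF x, simplified])
  show "dir_deriv (fr 1) \<alpha> (f x) = 0"
    using case2_alpha(1)[OF \<Xi>4 psi x u] Xi'_components(1)[OF u, of "fr 1"] by (simp add: frame_combinations)
  obtain v where v: "\<tau> x v = axis 4 1"
    by (rule tangent[OF x, of "axis 4 1"]) (auto simp: frame_form_def axis_def \<Xi>4[OF x, simplified])
  show "dir_deriv (fr 4) \<alpha> (f x) = \<alpha> (f x)"
    using case2_alpha(2)[OF \<Xi>4 psi x v] Xi'_components(1)[OF v, of "fr 4"] by (simp add: frame_combinations)
qed

lemma case3_adapted:
  assumes x: "x \<in> U" and "\<gamma> (f x) = 0"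
  obtains v1 v2 v3 where "\<tau> x v1 = axis 1 1"
    and "\<tau> x v2 = vec4 0 (d * \<Xi> x $ 4) 0 (- \<Xi> x $ 2)" and "\<tau> x v3 = vec4 0 (\<Xi> x $ 1) (\<Xi> x $ 2) 0"
proof -
  have "ip (axis 1 1) (\<Xi> x) = 0" "ip (vec4 0 (d * \<Xi> x $ 4) 0 (- \<Xi> x $ 2)) (\<Xi> x) = 0"
      "ip (vec4 0 (\<Xi> x $ 1) (\<Xi> x $ 2) 0) (\<Xi> x) = 0"
    using assms(2) by (simp_all add: frame_form_def axis_def)
  then show ?thesis using tangent[OF x] that by metis
qed

lemma case3_chart_necessary:
  assumes shape: "\<And>x. x \<in> U \<Longrightarrow> \<gamma> (f x) = 0 \<and> \<beta> (f x) \<noteq> 0 \<and> \<delta> (f x) \<noteq> 0" and "\<kappa> = 2"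
    and \<beta>': "\<And>x u. x \<in> U \<Longrightarrow> \<Xi>' x u $ 2 = 0" and \<delta>': "\<And>x u. x \<in> U \<Longrightarrow> \<Xi>' x u $ 4 = 0"
    and x: "x \<in> U" and P: "\<And>u v w. P x u v w = 0"
  shows "dir_deriv (fr 1) \<beta> (f x) = 0" "dir_deriv Z2 \<beta> (f x) = 0" "dir_deriv W2 \<beta> (f x) = 0"
    "dir_deriv (fr 1) \<alpha> (f x) = 0" "dir_deriv Z2 \<alpha> (f x) + \<alpha> (f x) * \<beta> (f x) = 0"
    "dir_deriv W2 \<alpha> (f x) + \<beta> (f x) * \<delta> (f x) = 0"
proof -
  interpret null_tangent_hypersurface \<kappa> d \<epsilon> U \<tau> \<tau>' \<Xi> \<Xi>' \<Xi>''
    by unfold_locales (use shape \<beta>' \<delta>' in auto)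
  obtain v1 v2 v3 where v: "\<tau> x v1 = axis 1 1" "\<tau> x v2 = vec4 0 (d * \<Xi> x $ 4) 0 (- \<Xi> x $ 2)"
    "\<tau> x v3 = vec4 0 (\<Xi> x $ 1) (\<Xi> x $ 2) 0"
    using case3_adapted[OF x] shape[OF x] by blast
  have ne: "\<Xi> x $ 2 \<noteq> 0" "\<Xi> x $ 4 \<noteq> 0" using shape[OF x] by simp_all
  note al = case3_alpha[OF x \<open>\<kappa> = 2\<close> ne P]
  note C1 = Xi'_components[OF v(1), of "fr 1"] and C2 = Xi'_components[OF v(2), of Z2]
    and C3 = Xi'_components[OF v(3), of W2]
  show "dir_deriv (fr 1) \<beta> (f x) = 0" "dir_deriv (fr 1) \<alpha> (f x) = 0"
    using C1 \<beta>'[OF x] al(1)[OF v(1)] by (simp_all add: frame_combinations)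
  show "dir_deriv Z2 \<beta> (f x) = 0" "dir_deriv Z2 \<alpha> (f x) + \<alpha> (f x) * \<beta> (f x) = 0"
    using C2 \<beta>'[OF x] al(2)[OF v(2)] by (simp_all add: frame_combinations)
  show "dir_deriv W2 \<beta> (f x) = 0" "dir_deriv W2 \<alpha> (f x) + \<beta> (f x) * \<delta> (f x) = 0"
    using C3 \<beta>'[OF x] al(3)[OF v(3)] by (simp_all add: frame_combinations)
qed

text \<open>The conditions on \<beta> cover a tangent frame and make its differential zero;
  differentiating the unit length equation then does the same for \<delta>, as \<delta> \<noteq>
  0.\<close>

lemma case3_chart_sufficient:
  assumes shape: "\<And>x. x \<in> U \<Longrightarrow> \<gamma> (f x) = 0 \<and> \<beta> (f x) \<noteq> 0 \<and> \<delta> (f x) \<noteq> 0" and "\<kappa> = 2"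
    and cond: "\<And>x. x \<in> U \<Longrightarrow> dir_deriv (fr 1) \<beta> (f x) = 0 \<and> dir_deriv Z2 \<beta> (f x) = 0 \<and> dir_deriv W2 \<beta> (f x) = 0 \<and>
      dir_deriv (fr 1) \<alpha> (f x) = 0 \<and> dir_deriv Z2 \<alpha> (f x) + \<alpha> (f x) * \<beta> (f x) = 0 \<and>
      dir_deriv W2 \<alpha> (f x) + \<beta> (f x) * \<delta> (f x) = 0"
    and x: "x \<in> U"
  shows "P x u v w = 0" and "\<exists>v w. h x v w \<noteq> 0"
proof -
  have \<Xi>3: "\<Xi> y $ 3 = 0" and ne: "\<Xi> y $ 2 \<noteq> 0" "\<Xi> y $ 4 \<noteq> 0" if "y \<in> U" for y
    using shape[OF that] by simp_all
  have C: "\<tau> y u = axis 1 1 \<Longrightarrow> \<Xi>' y u $ 2 = 0 \<and> \<Xi>' y u $ 1 = 0"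
    "\<tau> y u = vec4 0 (d * \<Xi> y $ 4) 0 (- \<Xi> y $ 2) \<Longrightarrow>
      \<Xi>' y u $ 2 = 0 \<and> \<Xi>' y u $ 1 + \<Xi> y $ 1 * \<Xi> y $ 2 = 0"
    "\<tau> y u = vec4 0 (\<Xi> y $ 1) (\<Xi> y $ 2) 0 \<Longrightarrow>
      \<Xi>' y u $ 2 = 0 \<and> \<Xi>' y u $ 1 + \<Xi> y $ 2 * \<Xi> y $ 4 = 0" if y: "y \<in> U" for y u
    using cond[OF y] Xi'_components[of y u _ "fr 1"] Xi'_components[of y u _ Z2] Xi'_components[of y u _ W2]
    by (simp_all add: frame_combinations)
  have \<beta>': "\<Xi>' y u $ 2 = 0" if y: "y \<in> U" for y u
  proof (rule linear_eq_0_adapted[OF y _ \<Xi>3[OF y] ne(1)[OF y]])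
    show "linear (\<lambda>u. \<Xi>' y u $ 2)"
      by (rule linearI) (simp_all add: linear_add[OF linear_Xi'[OF y]] linear_scale[OF linear_Xi'[OF y]])
  qed (use C[OF y] in auto)
  have \<delta>': "\<Xi>' y u $ 4 = 0" if y: "y \<in> U" for y u
  proof -
    have "((\<lambda>z. \<Xi> z $ 2 * \<Xi> z $ 2 + d * \<Xi> z $ 4 * \<Xi> z $ 4) has_derivative
        (\<lambda>u. 2 * d * \<Xi> y $ 4 * \<Xi>' y u $ 4)) (at y)"
      using deriv_Xi_nth[OF y, of 2] deriv_Xi_nth[OF y, of 4]
      by (auto intro!: derivative_eq_intros simp: fun_eq_iff \<beta>'[OF y] algebra_simps simp del: Xi_components)
    then have "2 * d * \<Xi> y $ 4 * \<Xi>' y u $ 4 = 0"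
      by (rule has_derivative_eq_on_open[OF _ has_derivative_const open_U y]) (rule unit_components[OF _ \<Xi>3])
    then show ?thesis using ne[OF y] d by simp
  qed
  interpret null_tangent_hypersurface \<kappa> d \<epsilon> U \<tau> \<tau>' \<Xi> \<Xi>' \<Xi>''
    by unfold_locales (use shape \<beta>' \<delta>' in auto)
  show "P x u v w = 0" by (rule case3_parallel[OF x ne(1)]) (use C in auto)
  show "\<exists>v w. h x v w \<noteq> 0" by (rule case3_not_geodesic[OF x \<open>\<kappa> = 2\<close> ne[OF x]])
qed

end

section \<open>The classification\<close>

theorem theorem4:
  fixes \<kappa> a b c d \<epsilon> :: real
    and M :: "(real ^ 4) set"
    and A :: "('m::{t2_space, second_countable_topology}, 3) chart set"
    and F :: "'m \<Rightarrow> real ^ 4"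
    and \<alpha> \<beta> \<gamma> \<delta> :: "real ^ 4 \<Rightarrow> real"
  defines "g \<equiv> A2_metric \<kappa> a b c d"
    and "u \<equiv> A2_normal_frame \<kappa> a b c"
  defines "\<xi> \<equiv> (\<lambda>p. \<alpha> p *\<^sub>R u 1 p + \<beta> p *\<^sub>R u 2 p + \<gamma> p *\<^sub>R u 3 p + \<delta> p *\<^sub>R u 4 p)"
  defines "V3 \<equiv> (\<lambda>p. (d * \<delta> p) *\<^sub>R u 3 p + \<alpha> p *\<^sub>R u 4 p)"
    and "W2 \<equiv> (\<lambda>p. \<alpha> p *\<^sub>R u 2 p + \<beta> p *\<^sub>R u 3 p)"
    and "Z2 \<equiv> (\<lambda>p. (d * \<delta> p) *\<^sub>R u 2 p - \<beta> p *\<^sub>R u 4 p)"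
    and "Z3 \<equiv> (\<lambda>p. \<alpha> p *\<^sub>R u 2 p + \<beta> p *\<^sub>R u 3 p)"
  defines "\<phi> \<equiv> (\<lambda>p. (\<alpha> p)\<^sup>2 - \<epsilon> - dir_deriv V3 \<alpha> p)"
  defines "shape1 \<equiv> (\<forall>p\<in>range F. \<beta> p = 0 \<and> \<gamma> p = 0 \<and> d * (\<delta> p)\<^sup>2 = \<epsilon>)"
    and "cond1 \<equiv> (\<forall>p\<in>range F. dir_deriv (u 1) \<alpha> p = 0 \<and> dir_deriv (u 2) \<alpha> p = 0 \<and>
                     dir_deriv V3 \<phi> p = 2 * (\<kappa> + 1) * \<alpha> p * \<phi> p)"
    and "geod1 \<equiv> (\<forall>p\<in>range F. dir_deriv (u 1) \<alpha> p = 0 \<and> dir_deriv (u 2) \<alpha> p = 0 \<and>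
                     \<kappa> = 0 \<and> \<phi> p = 0)"
    and "shape2 \<equiv> (\<forall>p\<in>range F. \<gamma> p = 0 \<and> \<delta> p = 0 \<and> (\<beta> p)\<^sup>2 = \<epsilon> \<and> \<epsilon> = 1)"
    and "cond2a \<equiv> (\<forall>p\<in>range F. dir_deriv (u 1) \<alpha> p = 0 \<and> dir_deriv (u 4) \<alpha> p - \<alpha> p = 0 \<and>
                     dir_deriv W2 \<alpha> p = 0)"
    and "cond2b \<equiv> \<kappa> = 0 \<and>
                   (\<forall>p\<in>range F. dir_deriv (u 1) \<alpha> p = 0 \<and> dir_deriv (u 4) \<alpha> p - \<alpha> p = 0 \<and>
                     dir_deriv W2 (dir_deriv W2 \<alpha>) p = 0 \<and> dir_deriv W2 \<alpha> p \<noteq> 0)"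
    and "case3 \<equiv> \<kappa> = 2 \<and>
                   (\<forall>p\<in>range F. \<gamma> p = 0 \<and> \<beta> p \<noteq> 0 \<and> \<delta> p \<noteq> 0 \<and> (\<beta> p)\<^sup>2 + d * (\<delta> p)\<^sup>2 = \<epsilon> \<and>
                     dir_deriv (u 1) \<beta> p = 0 \<and> dir_deriv Z2 \<beta> p = 0 \<and> dir_deriv Z3 \<beta> p = 0 \<and>
                     dir_deriv (u 1) \<alpha> p = 0 \<and> dir_deriv Z2 \<alpha> p + \<alpha> p * \<beta> p = 0 \<and>
                     dir_deriv Z3 \<alpha> p + \<beta> p * \<delta> p = 0)"
  assumes "a > 0" and "b > 0" and "d \<noteq> 0"
    and "open M"
    and "smooth_atlas A" and "connected (UNIV :: 'm set)"
    and "smooth_immersion A F" and "range F \<subseteq> M"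
    and "smooth_on M \<alpha>" and "smooth_on M \<beta>" and "smooth_on M \<gamma>" and "smooth_on M \<delta>"
    and "normal_along g A F \<xi>"
    and "\<epsilon> = 1 \<or> \<epsilon> = - 1"
    and "\<forall>p\<in>range F. g p (\<xi> p) (\<xi> p) = \<epsilon>"
  shows "(parallel_hypersurface g A F \<xi> \<longleftrightarrow>
            (shape1 \<and> cond1) \<or> (shape2 \<and> (cond2a \<or> cond2b)) \<or> case3) \<and>
         (shape1 \<longrightarrow> (totally_geodesic g A F \<xi> \<longleftrightarrow> geod1)) \<and>
         (shape2 \<and> cond2a \<longrightarrow> totally_geodesic g A F \<xi>) \<and>
         (shape2 \<and> cond2b \<longrightarrow> \<not> totally_geodesic g A F \<xi>) \<and>
         (case3 \<longrightarrow> \<not> totally_geodesic g A F \<xi>)"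
proof -
  let ?f = "\<lambda>C :: ('m, 3) chart. F \<circ> local_param C"
  have xi: "\<xi> p = A2_combination \<kappa> a b c p (vec4 (\<alpha> p) (\<beta> p) (\<gamma> p) (\<delta> p))" for p
    by (simp add: \<xi>_def u_def A2_combination_def)
  interpret par: A2_parameters \<kappa> a b c
    by unfold_locales fact+
  have range_eq: "(\<forall>p\<in>range F. Q p) \<longleftrightarrow> (\<forall>C\<in>A. \<forall>x\<in>chart_dom C. Q (?f C x))" for Q
  proof
    assume Q: "\<forall>C\<in>A. \<forall>x\<in>chart_dom C. Q (?f C x)"
    show "\<forall>p\<in>range F. Q p"
    proof
      fix p assume "p \<in> range F"
      then obtain q where q: "p = F q" by blast
      have "q \<in> (\<Union>C\<in>A. fst C)" using \<open>smooth_atlas A\<close> by (simp add: smooth_atlas_def)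
      then obtain C where C: "C \<in> A" "q \<in> fst C" by blast
      then have "homeomorphism (fst C) (chart_dom C) (snd C) (local_param C)"
        using \<open>smooth_atlas A\<close> by (auto simp: smooth_atlas_def)
      then have "local_param C (snd C q) = q" "snd C q \<in> chart_dom C"
        using C(2) by (auto simp: homeomorphism_apply1 chart_dom_def)
      then show "Q p" using Q C(1) q by force
    qed
  qed auto
  have imm: "A2_immersion \<kappa> a b c d \<epsilon> (chart_dom C) M (?f C) \<alpha> \<beta> \<gamma> \<delta>" if C: "C \<in> A" for C
  proof (rule A2_immersion.intro[OF par.A2_parameters_axioms A2_immersion_axioms.intro])
    show "d \<noteq> 0" "\<epsilon> = 1 \<or> \<epsilon> = - 1" "open M" "smooth_on M \<alpha>" "smooth_on M \<beta>" "smooth_on M \<gamma>" "smooth_on M \<delta>"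
      by fact+
    show "open (chart_dom C)" using C \<open>smooth_atlas A\<close> by (simp add: smooth_atlas_def)
    show "?f C ` chart_dom C \<subseteq> M" using \<open>range F \<subseteq> M\<close> by auto
    show "smooth_on (chart_dom C) (?f C)"
      using C \<open>smooth_immersion A F\<close> unfolding smooth_immersion_def by blast
    fix x assume x: "x \<in> chart_dom C"
    show "inj (frechet_derivative (?f C) (at x))"
      using C x \<open>smooth_immersion A F\<close> unfolding smooth_immersion_def by blast
    have "g (?f C x) (\<xi> (?f C x)) (frechet_derivative (?f C) (at x) v) = 0" for v
      using C x \<open>normal_along g A F \<xi>\<close> unfolding normal_along_def Let_def by blast
    then show "frame_form d (A2_normal_coframe \<kappa> a b c (?f C x) (frechet_derivative (?f C) (at x) v))
        (vec4 (\<alpha> (?f C x)) (\<beta> (?f C x)) (\<gamma> (?f C x)) (\<delta> (?f C x))) = 0" for v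
      by (simp only: g_def par.A2_metric_eq xi par.coframe_combination frame_form_commute)
    have "g (?f C x) (\<xi> (?f C x)) (\<xi> (?f C x)) = \<epsilon>"
      using \<open>\<forall>p\<in>range F. g p (\<xi> p) (\<xi> p) = \<epsilon>\<close> by auto
    then show "frame_form d (vec4 (\<alpha> (?f C x)) (\<beta> (?f C x)) (\<gamma> (?f C x)) (\<delta> (?f C x)))
        (vec4 (\<alpha> (?f C x)) (\<beta> (?f C x)) (\<gamma> (?f C x)) (\<delta> (?f C x))) = \<epsilon>"
      by (simp only: g_def par.A2_metric_eq xi par.coframe_combination)
  qed
  have mem: "?f C x \<in> range F" for C x
    by simp
  define par where "par C x \<longleftrightarrow> (\<forall>u v w. cov_deriv_form (pullback_metric g (?f C))
    (second_fundamental_form g \<xi> (?f C)) x u v w = 0)" for C x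
  define geo where "geo C x \<longleftrightarrow> (\<forall>v w. second_fundamental_form g \<xi> (?f C) x v w = 0)" for C x
  have parallel: "parallel_hypersurface g A F \<xi> \<longleftrightarrow> (\<forall>C\<in>A. \<forall>x\<in>chart_dom C. par C x)"
    unfolding parallel_hypersurface_def par_def Let_def ..
  have geodesic: "totally_geodesic g A F \<xi> \<longleftrightarrow> (\<forall>C\<in>A. \<forall>x\<in>chart_dom C. geo C x)"
    unfolding totally_geodesic_def geo_def ..
  \<comment> \<open>The range of \<open>F\<close> is nonempty, so some chart has a point; the claims
    that a hypersurface is not totally geodesic need one.\<close>
  obtain C0 x0 where C0: "C0 \<in> A" "x0 \<in> chart_dom C0"
    using range_eq[of "\<lambda>_. False"] by blast
  define \<psi> where "\<psi> = dir_deriv W2 \<alpha>"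

  have chart1: "dir_deriv (u 1) \<alpha> (?f C x) = 0 \<and> dir_deriv (u 2) \<alpha> (?f C x) = 0 \<and>
      (par C x \<longleftrightarrow> dir_deriv V3 \<phi> (?f C x) = 2 * (\<kappa> + 1) * \<alpha> (?f C x) * \<phi> (?f C x)) \<and>
      (geo C x \<longleftrightarrow> \<kappa> = 0 \<and> \<phi> (?f C x) = 0)"
    if shape1 and C: "C \<in> A" and x: "x \<in> chart_dom C" for C x
  proof -
    interpret I: A2_immersion \<kappa> a b c d \<epsilon> "chart_dom C" M "?f C" \<alpha> \<beta> \<gamma> \<delta> by (rule imm[OF C])
    have V3: "I.V3 = V3" by (simp add: fun_eq_iff I.V3_def V3_def u_def)
    have "I.\<phi> = \<phi>" unfolding fun_eq_iff I.\<phi>_def V3 \<phi>_def by simp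
    moreover have "I.\<xi> = \<xi>" by (simp add: fun_eq_iff I.\<xi>_def xi)
    ultimately have eqs: "I.\<xi> = \<xi>" "I.V3 = V3" "I.\<phi> = \<phi>" using V3 by simp_all
    have "\<beta> (?f C y) = 0 \<and> \<gamma> (?f C y) = 0 \<and> d * (\<delta> (?f C y))\<^sup>2 = \<epsilon>" for y
      using \<open>shape1\<close> mem unfolding shape1_def by blast
    note I.case1_chart[OF this x]
    then show ?thesis
      using I.cov_deriv_form_eq[OF x] I.second_fundamental_form_eq[OF x]
      unfolding par_def geo_def eqs u_def g_def by simp
  qed

  have chart2: "dir_deriv (u 1) \<alpha> (?f C x) = 0 \<and> dir_deriv (u 4) \<alpha> (?f C x) - \<alpha> (?f C x) = 0 \<and>
      (par C x \<longrightarrow> \<kappa> * \<psi> (?f C x) = 0 \<and> dir_deriv W2 \<psi> (?f C x) = 0 \<and>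
        ((\<lambda>y. \<psi> (?f C y) * exp (- 2 * ?f C y $ 4)) has_derivative (\<lambda>_. 0)) (at x)) \<and>
      ((\<forall>y\<in>chart_dom C. \<psi> (?f C y) = 0) \<longrightarrow> par C x) \<and>
      (\<kappa> = 0 \<and> dir_deriv W2 \<psi> (?f C x) = 0 \<longrightarrow> par C x) \<and>
      (geo C x \<longleftrightarrow> \<psi> (?f C x) = 0)"
    if shape2 and C: "C \<in> A" and x: "x \<in> chart_dom C" for C x
  proof -
    interpret I: A2_immersion \<kappa> a b c d \<epsilon> "chart_dom C" M "?f C" \<alpha> \<beta> \<gamma> \<delta> by (rule imm[OF C])
    have W2: "I.W2 = W2" by (simp add: fun_eq_iff I.W2_def W2_def u_def)
    have eqs: "I.\<xi> = \<xi>" "I.\<psi> = \<psi>"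
      by (simp_all add: fun_eq_iff I.\<xi>_def xi I.\<psi>_def \<psi>_def W2)
    have "\<gamma> (?f C y) = 0 \<and> \<delta> (?f C y) = 0 \<and> (\<beta> (?f C y))\<^sup>2 = \<epsilon>" for y
      using \<open>shape2\<close> mem unfolding shape2_def by blast
    note c = I.case2_chart[OF this x, unfolded eqs W2]
    \<comment> \<open>In the group coordinates \<open>\<theta>\<^sup>4\<close> is the differential
      of the fourth coordinate, so the equation \<open>d\<psi> = 2 \<psi> \<theta>\<^sup>4\<close>
      integrates to this constant product.\<close>
    have "((\<lambda>y. \<psi> (?f C y) * exp (- 2 * ?f C y $ 4)) has_derivative (\<lambda>_. 0)) (at x)"
      if P: "\<And>u v w. I.P x u v w = 0"
    proof -
      have D: "((\<lambda>y. \<psi> (?f C y)) has_derivative (\<lambda>u. 2 * \<psi> (?f C x) * I.Df x u $ 4)) (at x)"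
        by (rule has_derivative_eq_rhs[OF I.has_derivative_along[OF x
              I.differentiable_psi[unfolded eqs, OF I.fx_in_M[OF x]]]])
           (use c(3)[OF P] in auto)
      have E: "((\<lambda>y. exp (- 2 * ?f C y $ 4)) has_derivative
          (\<lambda>u. exp (- 2 * ?f C x $ 4) * (- 2 * I.Df x u $ 4))) (at x)"
        by (rule has_derivative_eq_rhs[OF has_derivative_exp[OF has_derivative_mult_right[OF
              bounded_linear.has_derivative[OF bounded_linear_vec_nth I.deriv_f[OF x]]]]]) auto
      show ?thesis
        by (rule has_derivative_eq_rhs[OF has_derivative_mult[OF D E]]) (simp add: fun_eq_iff)
    qed
    moreover have "par C x \<longleftrightarrow> (\<forall>u v w. I.P x u v w = 0)" "geo C x \<longleftrightarrow> (\<forall>v w. I.h x v w = 0)"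
      using I.cov_deriv_form_eq[OF x] I.second_fundamental_form_eq[OF x]
      unfolding par_def geo_def eqs g_def by simp_all
    moreover have "\<kappa> * \<psi> (?f C x) = 0 \<and> dir_deriv W2 \<psi> (?f C x) = 0" if "\<And>u v w. I.P x u v w = 0"
      using c(3)[OF that] by blast
    moreover have "dir_deriv (u 1) \<alpha> (?f C x) = 0" "dir_deriv (u 4) \<alpha> (?f C x) - \<alpha> (?f C x) = 0"
      using c(1,2) unfolding u_def by simp_all
    ultimately show ?thesis using c(4-6) by blast
  qed

  have chart3: "par C x \<and> \<not> geo C x" if case3 and C: "C \<in> A" and x: "x \<in> chart_dom C" for C x
  proof -
    interpret I: A2_immersion \<kappa> a b c d \<epsilon> "chart_dom C" M "?f C" \<alpha> \<beta> \<gamma> \<delta> by (rule imm[OF C])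
    have eqs: "I.\<xi> = \<xi>" "I.W2 = Z3" "I.Z2 = Z2"
      by (simp_all add: fun_eq_iff I.\<xi>_def xi I.W2_def Z3_def u_def I.Z2_def Z2_def)
    have "\<kappa> = 2" using \<open>case3\<close> unfolding case3_def by blast
    have shape: "\<gamma> (?f C y) = 0 \<and> \<beta> (?f C y) \<noteq> 0 \<and> \<delta> (?f C y) \<noteq> 0" for y
      using \<open>case3\<close> mem unfolding case3_def by blast
    have cond: "dir_deriv (u 1) \<beta> (?f C y) = 0 \<and> dir_deriv Z2 \<beta> (?f C y) = 0 \<and> dir_deriv Z3 \<beta> (?f C y) = 0 \<and>
      dir_deriv (u 1) \<alpha> (?f C y) = 0 \<and> dir_deriv Z2 \<alpha> (?f C y) + \<alpha> (?f C y) * \<beta> (?f C y) = 0 \<and>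
      dir_deriv Z3 \<alpha> (?f C y) + \<beta> (?f C y) * \<delta> (?f C y) = 0" for y
      using \<open>case3\<close> mem unfolding case3_def by blast
    note I.case3_chart_sufficient[unfolded eqs, folded u_def, OF shape \<open>\<kappa> = 2\<close> cond x]
    then show ?thesis
      using I.cov_deriv_form_eq[OF x] I.second_fundamental_form_eq[OF x]
      unfolding par_def geo_def eqs g_def by simp
  qed

  have chart3': "dir_deriv (u 1) \<beta> (?f C x) = 0 \<and> dir_deriv Z2 \<beta> (?f C x) = 0 \<and> dir_deriv Z3 \<beta> (?f C x) = 0 \<and>
      dir_deriv (u 1) \<alpha> (?f C x) = 0 \<and> dir_deriv Z2 \<alpha> (?f C x) + \<alpha> (?f C x) * \<beta> (?f C x) = 0 \<and>
      dir_deriv Z3 \<alpha> (?f C x) + \<beta> (?f C x) * \<delta> (?f C x) = 0"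
    if shape: "\<And>q. \<gamma> (F q) = 0 \<and> \<beta> (F q) \<noteq> 0 \<and> \<delta> (F q) \<noteq> 0" and "\<kappa> = 2"
      and const: "\<And>q. (\<beta> (F q))\<^sup>2 = r" "\<And>q. \<delta> (F q) = s"
      and C: "C \<in> A" and x: "x \<in> chart_dom C" and "par C x" for C x r s
  proof -
    interpret I: A2_immersion \<kappa> a b c d \<epsilon> "chart_dom C" M "?f C" \<alpha> \<beta> \<gamma> \<delta> by (rule imm[OF C])
    have eqs: "I.\<xi> = \<xi>" "I.W2 = Z3" "I.Z2 = Z2"
      by (simp_all add: fun_eq_iff I.\<xi>_def xi I.W2_def Z3_def u_def I.Z2_def Z2_def)
    have "I.P x u v w = 0" for u v w
      using \<open>par C x\<close> I.cov_deriv_form_eq[OF x] unfolding par_def eqs g_def by simp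
    \<comment> \<open>Only the square of \<beta> is known to be constant; with \<beta> \<noteq> 0
      this suffices.\<close>
    moreover have "I.\<Xi>' y v $ 2 = 0" if "y \<in> chart_dom C" for y v
      by (rule I.Xi'_eq_0_of_square[OF that, of 2 r]) (use const shape in auto)
    moreover have "I.\<Xi>' y v $ 4 = 0" if "y \<in> chart_dom C" for y v
      by (rule I.Xi'_nth_eq_0[OF that, of 4 s]) (use const in auto)
    ultimately show ?thesis
      using I.case3_chart_necessary[unfolded eqs, folded u_def, OF _ \<open>\<kappa> = 2\<close> _ _ x] shape by simp
  qed

  have necessary: "(shape1 \<and> cond1) \<or> (shape2 \<and> (cond2a \<or> cond2b)) \<or> case3"
    if "parallel_hypersurface g A F \<xi>"
  proof -
    have par: "par C x" if "C \<in> A" "x \<in> chart_dom C" for C x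
      using \<open>parallel_hypersurface g A F \<xi>\<close> that parallel by blast
    have chart: "\<gamma> (?f C x) = 0 \<and> (\<beta> (?f C x) = 0 \<or> \<delta> (?f C x) = 0 \<or> \<kappa> = 2) \<and>
        (\<beta> (?f C x))\<^sup>2 + d * (\<delta> (?f C x))\<^sup>2 = \<epsilon> \<and>
        ((\<lambda>y. \<delta> (?f C y)) has_derivative (\<lambda>_. 0)) (at x)"
      if C: "C \<in> A" and x: "x \<in> chart_dom C" for C x
    proof -
      interpret I: A2_immersion \<kappa> a b c d \<epsilon> "chart_dom C" M "?f C" \<alpha> \<beta> \<gamma> \<delta> by (rule imm[OF C])
      have "I.\<xi> = \<xi>" by (simp add: fun_eq_iff I.\<xi>_def xi)
      then have P: "I.P y u v w = 0" if "y \<in> chart_dom C" for y u v w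
        using par[OF C that] I.cov_deriv_form_eq[OF that] unfolding par_def g_def by simp
      have \<gamma>: "I.\<Xi> x $ 3 = 0" and bd: "I.\<Xi> x $ 2 = 0 \<or> I.\<Xi> x $ 4 = 0 \<or> \<kappa> = 2"
        using I.parallel_normal_shape[OF x P[OF x]] by blast+
      have "((\<lambda>y. I.\<Xi> y $ 4) has_derivative (\<lambda>_. 0)) (at x)"
        by (rule has_derivative_eq_rhs[OF I.deriv_Xi_nth[OF x]]) (simp add: I.parallel_delta[OF P x])
      with I.unit_components[OF x \<gamma>] \<gamma> bd show ?thesis
        by (simp add: power2_eq_square mult.assoc)
    qed
    have "(\<forall>p\<in>range F. \<gamma> p = 0 \<and> (\<beta> p = 0 \<or> \<delta> p = 0 \<or> \<kappa> = 2) \<and> (\<beta> p)\<^sup>2 + d * (\<delta> p)\<^sup>2 = \<epsilon>)"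
      unfolding range_eq using chart by blast
    then have pt: "\<gamma> (F q) = 0" "\<beta> (F q) = 0 \<or> \<delta> (F q) = 0 \<or> \<kappa> = 2" "(\<beta> (F q))\<^sup>2 + d * (\<delta> (F q))\<^sup>2 = \<epsilon>" for q
      by auto
    have \<delta>_const: "(\<delta> \<circ> F) q = (\<delta> \<circ> F) q0" for q q0
      by (rule constant_on_connected_manifold[OF \<open>smooth_atlas A\<close> \<open>connected UNIV\<close>])
         (use chart in \<open>simp add: o_def\<close>)
    \<comment> \<open>\<open>undefined\<close> serves as an arbitrary base point. \<open>s\<close>
      and \<open>r\<close> are the constant values of \<delta> and \<open>\<beta>\<^sup>2\<close>,
      and their vanishing selects the case for the whole hypersurface at once.\<close>
    define s where "s = \<delta> (F undefined)"
    define r where "r = \<epsilon> - d * s\<^sup>2"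
    have s: "\<delta> (F q) = s" for q using \<delta>_const[of q undefined] by (simp add: s_def)
    have r: "(\<beta> (F q))\<^sup>2 = r" for q using pt(3)[of q] s[of q] by (simp add: r_def)
    consider "r = 0" | "s = 0" | "r \<noteq> 0" "s \<noteq> 0" by blast
    then show ?thesis
    proof cases
      case 1
      then have "\<beta> (F q) = 0" for q using r[of q] by simp
      moreover have "d * (\<delta> (F q))\<^sup>2 = \<epsilon>" for q using 1 s[of q] by (simp add: r_def)
      ultimately have sh: shape1 using pt(1) by (auto simp: shape1_def)
      moreover have cond1
        unfolding cond1_def range_eq using chart1[OF sh] par by blast
      ultimately show ?thesis by blast
    next
      case 2
      then have sq: "(\<beta> (F q))\<^sup>2 = \<epsilon>" for q using r[of q] by (simp add: r_def)
      then have "\<epsilon> = 1" using \<open>\<epsilon> = 1 \<or> \<epsilon> = - 1\<close> zero_le_power2[of "\<beta> (F undefined)"] by auto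
      then have sh: shape2 using pt(1) s 2 sq by (auto simp: shape2_def)
      note c = chart2[OF sh]
      \<comment> \<open>Here \<open>d\<psi> = 2 \<psi> \<theta>\<^sup>4\<close>, so \<open>\<psi>\<close> vanishes everywhere or nowhere.\<close>
      define k where "k q = \<psi> (F q) * exp (- 2 * F q $ 4)" for q
      have k: "k q = k q0" for q q0
        by (rule constant_on_connected_manifold[OF \<open>smooth_atlas A\<close> \<open>connected UNIV\<close>])
           (use c par in \<open>simp add: o_def k_def\<close>)
      have basic: "\<forall>p\<in>range F. dir_deriv (u 1) \<alpha> p = 0 \<and> dir_deriv (u 4) \<alpha> p - \<alpha> p = 0 \<and>
          \<kappa> * \<psi> p = 0 \<and> dir_deriv W2 \<psi> p = 0"
        unfolding range_eq using c par by blast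
      have "cond2a \<or> cond2b"
      proof (cases "k undefined = 0")
        case True
        then have "\<psi> (F q) = 0" for q using k[of q undefined] by (simp add: k_def)
        then show ?thesis using basic unfolding cond2a_def \<psi>_def by blast
      next
        case False
        then have ne: "\<psi> (F q) \<noteq> 0" for q using k[of q undefined] by (auto simp: k_def)
        then have "\<kappa> = 0" using basic by auto
        then show ?thesis using basic ne unfolding cond2b_def \<psi>_def by blast
      qed
      with sh show ?thesis by blast
    next
      case 3
      have ne: "\<beta> (F q) \<noteq> 0" "\<delta> (F q) \<noteq> 0" for q using 3 r[of q] s[of q] by auto
      then have "\<kappa> = 2" using pt(2) by blast
      have "\<forall>p\<in>range F. dir_deriv (u 1) \<beta> p = 0 \<and> dir_deriv Z2 \<beta> p = 0 \<and> dir_deriv Z3 \<beta> p = 0 \<and>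
          dir_deriv (u 1) \<alpha> p = 0 \<and> dir_deriv Z2 \<alpha> p + \<alpha> p * \<beta> p = 0 \<and> dir_deriv Z3 \<alpha> p + \<beta> p * \<delta> p = 0"
        unfolding range_eq
        by (intro ballI chart3'[OF _ \<open>\<kappa> = 2\<close> r s] par) (use pt(1) ne in auto)
      then have case3 unfolding case3_def using \<open>\<kappa> = 2\<close> pt ne by auto
      then show ?thesis by blast
    qed
  qed

  have geod1: "totally_geodesic g A F \<xi> \<longleftrightarrow> geod1" if shape1
    unfolding geodesic geod1_def range_eq using chart1[OF that] by blast
  have par1: "parallel_hypersurface g A F \<xi>" if shape1 cond1
    using that(2) chart1[OF that(1)] unfolding parallel cond1_def range_eq by blast
  have psi_0: "\<psi> (?f C x) = 0" if cond2a for C x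
    using that mem unfolding cond2a_def \<psi>_def by blast
  have par2a: "parallel_hypersurface g A F \<xi> \<and> totally_geodesic g A F \<xi>" if shape2 cond2a
    unfolding parallel geodesic using chart2[OF that(1)] psi_0[OF that(2)] by blast
  have cond2b: "\<kappa> = 0" "dir_deriv W2 \<psi> (?f C x) = 0" "\<psi> (?f C x) \<noteq> 0" if cond2b for C x
    using that mem unfolding cond2b_def \<psi>_def by blast+
  have par2b: "parallel_hypersurface g A F \<xi> \<and> \<not> totally_geodesic g A F \<xi>" if shape2 cond2b
    unfolding parallel geodesic using chart2[OF that(1)] cond2b[OF that(2)] C0 by blast
  have par3: "parallel_hypersurface g A F \<xi> \<and> \<not> totally_geodesic g A F \<xi>" if case3
    unfolding parallel geodesic using chart3[OF that] C0 by blast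
  show ?thesis
    using necessary geod1 par1 par2a par2b par3 by blast
qed

end
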